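(* Let $\alpha\in(0,1]$, let $N\ge 1$ be an integer, and let $\mathbf{X}$ be an $\alpha$-Hölder weakly geometric (resp. branched) rough path over $\mathbb{R}^{1+d}$ on $[0,T]$. (i) Let $v=(v_0,v_1,\dots,v_d)$ be a collection of elements of $\mathcal{L}^N(\mathbb{R}^{1+d})$ (resp. of $\mathcal{B}^N$). Then $T_v\mathbf{X}$ (resp. $M_v\mathbf{X}$) is an $\alpha/N$-Hölder weakly geometric (resp. branched) rough path satisfying $$\|T_v\mathbf{X}\|_{\alpha/N\text{-Höl};[s,t]}\ \ (\text{resp. } \|M_v\mathbf{X}\|_{\alpha/N\text{-Höl};[s,t]})\ \le\ C_v\,\|\mathbf{X}\|_{\alpha\text{-Höl};[s,t]}$$ for a constant $C_v$ depending polynomially on $v$. (ii) Let $v=(v_0,0,\dots,0)$ with $v_0\in\mathcal{L}^N(\mathbb{R}^{1+d})$ (resp. $v_0\in\mathcal{B}^N$). Suppose that $\mathbf{X}$ satisfies $$\|\mathbf{X}\|_{(1,\alpha)\text{-Höl};[s,t]}:=\max_{|w|\le\lfloor 1/\alpha\rfloor}\ \sup_{u\ne r\in[s,t]}\frac{|\langle \mathbf{X}_{u,r},w\rangle|}{|r-u|^{(1-\alpha)|w|_0+\alpha|w|}}<\infty ,$$ where the max runs over all words $w\in T(\mathbb{R}^{1+d})$ (resp. forests $w\in\mathcal{H}$) with $|w|\le\lfloor1/\alpha\rfloor$, and $|w|_0$ denotes the number of times the letter $e_0$ (resp. the label $0$) appears in $w$. Then $T_v\mathbf{X}$ (resp.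 $M_v\mathbf{X}$) is an $\alpha\wedge(1/N)$-Hölder weakly geometric (resp. branched) rough path over $\mathbb{R}^{1+d}$ satisfying $$\|T_v\mathbf{X}\|_{\alpha\wedge(1/N)\text{-Höl};[s,t]}\ \ (\text{resp. } \|M_v\mathbf{X}\|_{\alpha\wedge(1/N)\text{-Höl};[s,t]})\ \le\ C_v\,\|\mathbf{X}\|_{(1,\alpha)\text{-Höl};[s,t]}$$ for a constant $C_v$ depending polynomially on $v$. Finally, in the branched setting of (ii), let $M:\mathcal{H}^*\to\mathcal{H}^*$ be any algebra morphism which preserves $\mathcal{G}$ and such that $M\tau=\tau$ for every forest $\tau\in\mathcal{H}$ without a label $0$, and $M\bullet_0=M_v\bullet_0=\bullet_0+v_0$. Then $M\mathbf{X}=M_v\mathbf{X}$.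
   Context: **Geometric setting.** $\{e_0,\dots,e_d\}$ is the standard basis of $\mathbb{R}^{1+d}$. $T((\mathbb{R}^{1+d}))=\prod_{k\ge0}(\mathbb{R}^{1+d})^{\otimes k}$ (tensor series, product topology) with tensor (concatenation) product $*$; $T(\mathbb{R}^{1+d})=\bigoplus_{k\ge0}(\mathbb{R}^{1+d})^{\otimes k}$ has the words $e_{i_1\dots i_k}=e_{i_1}*\cdots*e_{i_k}$ as basis, and the two spaces are in duality with words orthonormal. $\sqcup\!\sqcup$ is the shuffle product on $T(\mathbb{R}^{1+d})$ and $\Delta_{\sqcup\!\sqcup}$ the dual coproduct on $T((\mathbb{R}^{1+d}))$. $\mathcal{L}((\mathbb{R}^{1+d}))$ is the set of primitive elements (Lie series), and $\mathcal{L}^N(\mathbb{R}^{1+d})$ is the step-$N$ free nilpotent Lie algebra, identified with the Lie polynomials of degree at most $N$. For $v=(v_0,\dots,v_d)\subset\mathcal{L}((\mathbb{R}^{1+d}))$, $T_v$ is the unique continuous algebra morphism of $(T((\mathbb{R}^{1+d})),* )$ with $T_v(e_i)=e_i+v_i$, $i=0,\dots,d$. An $\alpha$-Hölder weakly geometric rough path over $\mathbb{R}^{1+d}$ is a map $\mathbf{X}:[0,T]^2\to T((\mathbb{R}^{1+d}))$ with: $\langle\mathbf{X}_{s,t},x\sqcup\!\sqcup y\rangle=\langle\mathbf{X}_{s,t},x\rangle\langle\mathbf{X}_{s,t},y\rangle$ for all $x,y\in T(\mathbb{R}^{1+d})$; $\mathbf{X}_{s,t}=\mathbf{X}_{s,u}*\mathbf{X}_{u,t}$;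 and $\sup_{s\ne t}|\langle\mathbf{X}_{s,t},w\rangle|/|t-s|^{\alpha|w|}<\infty$ for every word $w$ (of length $|w|$). **Branched setting.** $\mathcal{B}$ is the real vector space spanned by unordered (non-planar) rooted trees with nodes labelled by $\{0,\dots,d\}$; $\mathcal{H}$ is the vector space spanned by forests of such trees (including the empty forest $1$), i.e. the free commutative algebra over $\mathcal{B}$ with product $\odot$ (often omitted), graded by the number of nodes $|\tau|$. $\bullet_i$ is the one-node tree with label $i$; $\mathbb{R}^{1+d}$ is identified with $\mathrm{span}\{\bullet_0,\dots,\bullet_d\}$ via $e_i\leftrightarrow\bullet_i$. $[\tau_1\cdots\tau_n]_{\bullet_i}$ is the tree obtained by grafting $\tau_1,\dots,\tau_n$ onto a root with label $i$. The Connes–Kreimer coproduct $\Delta_\star:\mathcal{H}\to\mathcal{H}\otimes\mathcal{H}$ is the algebra morphism with $\Delta_\star[\tau_1\cdots\tau_n]_{\bullet_i}=[\tau_1\cdots\tau_n]_{\bullet_i}\otimes1+(\mathrm{id}\otimes[\cdot]_{\bullet_i})\Delta_\star(\tau_1\cdots\tau_n)$. $\mathcal{H}^*$, $\mathcal{B}^*$ are the algebraic duals, identified with formal series of forests, resp. trees (forests being orthonormal for the pairing), with product topology; $\mathcal{B}^*\subset\mathcal{H}^*$. The Grossman–Larson product $\star$ on $\mathcal{H}^*$ is dual to $\Delta_\star$. $\mathcal{G}\subset\mathcal{H}^*$ (Butcher group) is the set of group-like elements, i.e. the characters of $(\mathcal{H},\odot)$. $\mathcal{B}^N$ is the truncation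 of $\mathcal{B}^*$ at level $N$, identified with the span of trees with at most $N$ nodes. The pre-Lie product on $\mathcal{B}$ is $\tau_1\curvearrowright\tau_2=\sum_\tau n(\tau_1,\tau_2,\tau)\tau$, where $n(\tau_1,\tau_2,\tau)$ is the number of edges of $\tau$ whose removal leaves the branch $\tau_1$ and the trunk (part containing the root) $\tau_2$; it extends to $\mathcal{B}^*$. For $v=(v_0,\dots,v_d)\subset\mathcal{B}^*$, $M_v:\mathcal{H}^*\to\mathcal{H}^*$ is the unique continuous algebra morphism (for $\star$) whose restriction to $\mathcal{B}^*$ is a pre-Lie morphism $\mathcal{B}^*\to\mathcal{B}^*$ and with $M_v\bullet_i=\bullet_i+v_i$, $i=0,\dots,d$. An $\alpha$-Hölder branched rough path is a map $\mathbf{X}:[0,T]^2\to\mathcal{H}^*$ with: $\langle\mathbf{X}_{s,t},\tau_1\odot\tau_2\rangle=\langle\mathbf{X}_{s,t},\tau_1\rangle\langle\mathbf{X}_{s,t},\tau_2\rangle$ for $\tau_1,\tau_2\in\mathcal{H}$; $\mathbf{X}_{s,t}=\mathbf{X}_{s,u}\star\mathbf{X}_{u,t}$; and $\sup_{s\ne t}|\langle\mathbf{X}_{s,t},\tau\rangle|/|t-s|^{\alpha|\tau|}<\infty$ for every forest $\tau$. **Action and norm.** Rough paths are regarded as fully lifted; translations act pointwise: $(T_v\mathbf{X})_{s,t}:=T_v(\mathbf{X}_{s,t})$, $(M_v\mathbf{X})_{s,t}:=M_v(\mathbf{X}_{s,t})$, $(M\mathbf{X})_{s,t}:=M(\mathbf{X}_{s,t})$.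 With $|w|$ the length of a word (resp. number of nodes of a forest), $\|\mathbf{X}\|_{\alpha\text{-Höl};[s,t]}=\max_{|w|\le\lfloor1/\alpha\rfloor}\sup_{u\ne r\in[s,t]}|\langle\mathbf{X}_{u,r},w\rangle|/|r-u|^{|w|\alpha}$, the max being over words (resp. forests) $w$. *)

theory Defs
  imports "HOL-Analysis.Analysis" "HOL-Library.Poly_Mapping" "HOL-Library.Multiset"
begin

text \<open>
  The label set \<open>{0,\<dots>,d}\<close> is a finite type \<open>'l\<close> with a distinguished element \<open>0 :: 'l\<close>
  (sort \<open>{finite, zero}\<close>, where \<open>zero\<close> carries no axioms), so that \<open>CARD('l) = 1 + d\<close>.

  A space with basis \<open>'b\<close> (words or forests) is the type \<open>'b \<Rightarrow>\<^sub>0 real\<close>; its algebraic dual, the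
  formal series, is \<open>'b \<Rightarrow> real\<close>, whose topology as a function type is the product topology.
\<close>

section \<open>Series and their pairing with finite combinations\<close>

definition basis_series :: "'b \<Rightarrow> 'b \<Rightarrow> real" where
  "basis_series k = (\<lambda>k'. if k' = k then 1 else 0)"

definition pairing :: "('b \<Rightarrow> real) \<Rightarrow> ('b \<Rightarrow>\<^sub>0 real) \<Rightarrow> real" where
  "pairing x p = (\<Sum>k\<in>Poly_Mapping.keys p. x k * Poly_Mapping.lookup p k)"

text \<open>The linear extension of a map between bases.\<close>

definition push_forward :: "('b \<Rightarrow> 'c) \<Rightarrow> ('b \<Rightarrow>\<^sub>0 real) \<Rightarrow> ('c \<Rightarrow>\<^sub>0 real)" where
  "push_forward g p =
     (\<Sum>k\<in>Poly_Mapping.keys p. Poly_Mapping.single (g k) (Poly_Mapping.lookup p k))"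

definition series_linear :: "(('b \<Rightarrow> real) \<Rightarrow> ('c \<Rightarrow> real)) \<Rightarrow> bool" where
  "series_linear M \<longleftrightarrow>
     (\<forall>a b x y. M (\<lambda>k. a * x k + b * y k) = (\<lambda>k. a * M x k + b * M y k))"

text \<open>Algebra morphisms are linear, multiplicative and unital; no continuity is required.\<close>

definition algebra_morphism ::
    "(('b \<Rightarrow> real) \<Rightarrow> ('b \<Rightarrow> real) \<Rightarrow> ('b \<Rightarrow> real)) \<Rightarrow> ('b \<Rightarrow> real) \<Rightarrow>
     (('b \<Rightarrow> real) \<Rightarrow> ('b \<Rightarrow> real)) \<Rightarrow> bool" where
  "algebra_morphism prd one M \<longleftrightarrow>
     series_linear M \<and> M one = one \<and> (\<forall>x y. M (prd x y) = prd (M x) (M y))"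

text \<open>Polynomial functions of the coordinates \<open>\<langle>v\<^sub>i, w\<rangle>\<close> of a family \<open>v\<close> of series
  (cf. \<open>real_polynomial_function\<close>).\<close>

inductive coordinate_polynomial :: "(('i \<Rightarrow> 'b \<Rightarrow> real) \<Rightarrow> real) \<Rightarrow> bool" where
  const: "coordinate_polynomial (\<lambda>v. c)"
| coord: "coordinate_polynomial (\<lambda>v. v i w)"
| add: "coordinate_polynomial p \<Longrightarrow> coordinate_polynomial q \<Longrightarrow> coordinate_polynomial (\<lambda>v. p v + q v)"
| mult: "coordinate_polynomial p \<Longrightarrow> coordinate_polynomial q \<Longrightarrow> coordinate_polynomial (\<lambda>v. p v * q v)"

text \<open>The family \<open>(v\<^sub>0, 0, \<dots>, 0)\<close>.\<close>

definition only_zero_label :: "('b \<Rightarrow> real) \<Rightarrow> 'l::zero \<Rightarrow> 'b \<Rightarrow> real" where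
  "only_zero_label v0 = (\<lambda>i. if i = 0 then v0 else (\<lambda>_. 0))"

section \<open>Tensor series\<close>

definition tensor_mult :: "('l list \<Rightarrow> real) \<Rightarrow> ('l list \<Rightarrow> real) \<Rightarrow> 'l list \<Rightarrow> real" where
  "tensor_mult x y = (\<lambda>w. \<Sum>k\<le>length w. x (take k w) * y (drop k w))"

fun shuffle_words :: "'l list \<Rightarrow> 'l list \<Rightarrow> ('l list \<Rightarrow>\<^sub>0 real)" where
  "shuffle_words [] w = Poly_Mapping.single w 1"
| "shuffle_words (a # u) [] = Poly_Mapping.single (a # u) 1"
| "shuffle_words (a # u) (b # w) =
     push_forward ((#) a) (shuffle_words u (b # w)) +
     push_forward ((#) b) (shuffle_words (a # u) w)"

definition shuffle :: "('l list \<Rightarrow>\<^sub>0 real) \<Rightarrow> ('l list \<Rightarrow>\<^sub>0 real) \<Rightarrow> ('l list \<Rightarrow>\<^sub>0 real)" where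
  "shuffle p q = (\<Sum>u\<in>Poly_Mapping.keys p. \<Sum>w\<in>Poly_Mapping.keys q.
     Poly_Mapping.map ((*) (Poly_Mapping.lookup p u * Poly_Mapping.lookup q w)) (shuffle_words u w))"

text \<open>The coproduct dual to the shuffle product, with values in the series indexed by pairs of words.\<close>

definition shuffle_coproduct :: "('l list \<Rightarrow> real) \<Rightarrow> 'l list \<times> 'l list \<Rightarrow> real" where
  "shuffle_coproduct x = (\<lambda>(u, w). pairing x (shuffle_words u w))"

text \<open>Primitive elements: \<open>\<Delta>x = x \<otimes> 1 + 1 \<otimes> x\<close>.\<close>

definition lie_series :: "('l list \<Rightarrow> real) set" where
  "lie_series = {x. shuffle_coproduct x =
     (\<lambda>(u, w). x u * basis_series [] w + basis_series [] u * x w)}"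

definition lie_polynomials :: "nat \<Rightarrow> ('l list \<Rightarrow> real) set" where
  "lie_polynomials N = {x \<in> lie_series. \<forall>w. length w > N \<longrightarrow> x w = 0}"

definition is_tensor_translation ::
    "('l \<Rightarrow> 'l list \<Rightarrow> real) \<Rightarrow> (('l list \<Rightarrow> real) \<Rightarrow> ('l list \<Rightarrow> real)) \<Rightarrow> bool" where
  "is_tensor_translation v M \<longleftrightarrow>
     continuous_on UNIV M \<and> algebra_morphism tensor_mult (basis_series []) M \<and>
     (\<forall>i. M (basis_series [i]) = (\<lambda>w. basis_series [i] w + v i w))"

definition tensor_translation ::
    "('l \<Rightarrow> 'l list \<Rightarrow> real) \<Rightarrow> ('l list \<Rightarrow> real) \<Rightarrow> ('l list \<Rightarrow> real)" where
  "tensor_translation v = (THE M. is_tensor_translation v M)"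

section \<open>Forests and the Grossman--Larson algebra\<close>

text \<open>Non-planar labelled rooted trees; a forest is a multiset of trees. The monoid algebra
  \<open>'l rtree multiset \<Rightarrow>\<^sub>0 real\<close> is the free commutative algebra over trees: its product \<open>*\<close>
  extends the union of forests bilinearly, and its unit is the empty forest. Likewise
  \<open>'l rtree multiset \<times> 'l rtree multiset \<Rightarrow>\<^sub>0 real\<close> is its tensor square, as an algebra.\<close>

datatype 'l rtree = Node 'l "'l rtree multiset"

type_synonym 'l forest = "'l rtree multiset"

primrec tree_labels :: "'l rtree \<Rightarrow> 'l multiset" where
  "tree_labels (Node i F) = add_mset i (sum_mset (image_mset tree_labels F))"

definition forest_labels :: "'l forest \<Rightarrow> 'l multiset" where
  "forest_labels F = sum_mset (image_mset tree_labels F)"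

definition forest_size :: "'l forest \<Rightarrow> nat" where
  "forest_size F = size (forest_labels F)"

definition bullet :: "'l \<Rightarrow> 'l rtree" where
  "bullet i = Node i {#}"

text \<open>The Connes--Kreimer coproduct; branches on the left, trunk on the right.\<close>

primrec tree_coproduct :: "'l rtree \<Rightarrow> ('l forest \<times> 'l forest \<Rightarrow>\<^sub>0 real)" where
  "tree_coproduct (Node i F) =
     Poly_Mapping.single ({#Node i F#}, {#}) 1 +
     push_forward (\<lambda>(a, b). (a, {#Node i b#})) (prod_mset (image_mset tree_coproduct F))"

definition forest_coproduct :: "'l forest \<Rightarrow> ('l forest \<times> 'l forest \<Rightarrow>\<^sub>0 real)" where
  "forest_coproduct F = prod_mset (image_mset tree_coproduct F)"

definition gl_mult :: "('l forest \<Rightarrow> real) \<Rightarrow> ('l forest \<Rightarrow> real) \<Rightarrow> 'l forest \<Rightarrow> real" where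
  "gl_mult x y = (\<lambda>F. pairing (\<lambda>(a, b). x a * y b) (forest_coproduct F))"

definition butcher_group :: "('l forest \<Rightarrow> real) set" where
  "butcher_group = {g. pairing g 1 = 1 \<and> (\<forall>p q. pairing g (p * q) = pairing g p * pairing g q)}"

definition tree_series :: "('l forest \<Rightarrow> real) set" where
  "tree_series = {x. \<forall>F. size F \<noteq> 1 \<longrightarrow> x F = 0}"

definition tree_polynomials :: "nat \<Rightarrow> ('l forest \<Rightarrow> real) set" where
  "tree_polynomials N = {x \<in> tree_series. \<forall>F. forest_size F > N \<longrightarrow> x F = 0}"

text \<open>The pairs (branch, trunk) obtained by removing one edge, one pair for each edge of the tree;
  thus \<open>n(\<tau>\<^sub>1,\<tau>\<^sub>2,\<tau>) = count (edge_cuts \<tau>) (\<tau>\<^sub>1,\<tau>\<^sub>2)\<close>.\<close>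

primrec edge_cuts :: "'l rtree \<Rightarrow> ('l rtree \<times> 'l rtree) multiset" where
  "edge_cuts (Node i F) = sum_mset (image_mset (\<lambda>t.
     add_mset (t, Node i (F - {#t#}))
       (image_mset (\<lambda>(b, s). (b, Node i (add_mset s (F - {#t#})))) (edge_cuts t))) F)"

text \<open>The pre-Lie product on tree series; the outer sum has exactly one term.\<close>

definition pre_lie :: "('l forest \<Rightarrow> real) \<Rightarrow> ('l forest \<Rightarrow> real) \<Rightarrow> 'l forest \<Rightarrow> real" where
  "pre_lie x y = (\<lambda>F. if size F = 1
     then \<Sum>t\<in>set_mset F. \<Sum>(a, b)\<in>set_mset (edge_cuts t).
            real (count (edge_cuts t) (a, b)) * x {#a#} * y {#b#}
     else 0)"

definition is_branched_translation ::
    "('l \<Rightarrow> 'l forest \<Rightarrow> real) \<Rightarrow> (('l forest \<Rightarrow> real) \<Rightarrow> ('l forest \<Rightarrow> real)) \<Rightarrow> bool" where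
  "is_branched_translation v M \<longleftrightarrow>
     continuous_on UNIV M \<and> algebra_morphism gl_mult (basis_series {#}) M \<and>
     (\<forall>x\<in>tree_series. M x \<in> tree_series) \<and>
     (\<forall>x\<in>tree_series. \<forall>y\<in>tree_series. M (pre_lie x y) = pre_lie (M x) (M y)) \<and>
     (\<forall>i. M (basis_series {#bullet i#}) = (\<lambda>F. basis_series {#bullet i#} F + v i F))"

definition branched_translation ::
    "('l \<Rightarrow> 'l forest \<Rightarrow> real) \<Rightarrow> ('l forest \<Rightarrow> real) \<Rightarrow> ('l forest \<Rightarrow> real)" where
  "branched_translation v = (THE M. is_branched_translation v M)"

section \<open>Rough paths\<close>

definition hoelder_sup ::
    "real \<Rightarrow> real set \<Rightarrow> (real \<Rightarrow> real \<Rightarrow> 'b \<Rightarrow> real) \<Rightarrow> 'b \<Rightarrow> ennreal" where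
  "hoelder_sup \<gamma> I X w =
     (SUP (u, r)\<in>{(u, r). u \<in> I \<and> r \<in> I \<and> u \<noteq> r}. ennreal (\<bar>X u r w\<bar> / \<bar>r - u\<bar> powr \<gamma>))"

definition geometric_rough_path ::
    "real \<Rightarrow> real \<Rightarrow> (real \<Rightarrow> real \<Rightarrow> 'l list \<Rightarrow> real) \<Rightarrow> bool" where
  "geometric_rough_path \<alpha> T X \<longleftrightarrow>
     (\<forall>s\<in>{0..T}. \<forall>t\<in>{0..T}. \<forall>p q.
        pairing (X s t) (shuffle p q) = pairing (X s t) p * pairing (X s t) q) \<and>
     (\<forall>s\<in>{0..T}. \<forall>u\<in>{0..T}. \<forall>t\<in>{0..T}. X s t = tensor_mult (X s u) (X u t)) \<and>
     (\<forall>w. hoelder_sup (\<alpha> * real (length w)) {0..T} X w < \<infinity>)"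

definition branched_rough_path ::
    "real \<Rightarrow> real \<Rightarrow> (real \<Rightarrow> real \<Rightarrow> 'l forest \<Rightarrow> real) \<Rightarrow> bool" where
  "branched_rough_path \<alpha> T X \<longleftrightarrow>
     (\<forall>s\<in>{0..T}. \<forall>t\<in>{0..T}. \<forall>p q.
        pairing (X s t) (p * q) = pairing (X s t) p * pairing (X s t) q) \<and>
     (\<forall>s\<in>{0..T}. \<forall>u\<in>{0..T}. \<forall>t\<in>{0..T}. X s t = gl_mult (X s u) (X u t)) \<and>
     (\<forall>F. hoelder_sup (\<alpha> * real (forest_size F)) {0..T} X F < \<infinity>)"

text \<open>The parameter \<open>len\<close> is \<open>length\<close> or \<open>forest_size\<close>, and \<open>zeros\<close> counts occurrences of the label
  \<open>0\<close>. The index \<open>w\<close> ranges over a finite set, so that the outer supremum is a maximum; the empty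
  word (or forest) is included.\<close>

definition hoelder_norm ::
    "('b \<Rightarrow> nat) \<Rightarrow> real \<Rightarrow> (real \<Rightarrow> real \<Rightarrow> 'b \<Rightarrow> real) \<Rightarrow> real \<Rightarrow> real \<Rightarrow> ennreal" where
  "hoelder_norm len \<alpha> X s t =
     (SUP w\<in>{w. len w \<le> nat \<lfloor>1 / \<alpha>\<rfloor>}. hoelder_sup (\<alpha> * real (len w)) {s..t} X w)"

definition hoelder_norm_1 ::
    "('b \<Rightarrow> nat) \<Rightarrow> ('b \<Rightarrow> nat) \<Rightarrow> real \<Rightarrow> (real \<Rightarrow> real \<Rightarrow> 'b \<Rightarrow> real) \<Rightarrow> real \<Rightarrow> real \<Rightarrow> ennreal" where
  "hoelder_norm_1 zeros len \<alpha> X s t =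
     (SUP w\<in>{w. len w \<le> nat \<lfloor>1 / \<alpha>\<rfloor>}.
        hoelder_sup ((1 - \<alpha>) * real (zeros w) + \<alpha> * real (len w)) {s..t} X w)"

definition word_zeros :: "'l::zero list \<Rightarrow> nat" where
  "word_zeros w = count_list w 0"

definition forest_zeros :: "'l::zero forest \<Rightarrow> nat" where
  "forest_zeros F = count (forest_labels F) 0"

end

theory Submission
  imports Defs "HOL-Library.Function_Algebras"
begin

text \<open>
  Both translations are transposes of maps on finite combinations: the coordinate of \<open>T\<^sub>v x\<close>
  (of \<open>M\<^sub>v x\<close>) at \<open>w\<close> is \<open>\<langle>x, \<Phi>\<^sub>v w\<rangle>\<close>, where \<open>\<Phi>\<^sub>v\<close> replaces an initial block of a word (the trunk of
  a cut of a tree) by a letter \<open>i\<close> with weight \<open>\<langle>e\<^sub>i + v\<^sub>i, block\<rangle>\<close> and recurses on the remaining word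
  (on the branches). By induction on the size, \<open>\<Phi>\<^sub>v\<close> commutes with deconcatenation and, if the \<open>v\<^sub>i\<close>
  are primitive, with the shuffle product (in the branched case with the Connes--Kreimer coproduct).
  Uniqueness of \<open>M\<^sub>v\<close> holds because every forest is the leading term of a Grossman--Larson or pre-Lie
  product of smaller ones.

  The coefficients of \<open>\<Phi>\<^sub>v w\<close> are polynomials in \<open>v\<close>, and the words occurring in it have at most
  \<open>|w|\<close> letters and Hoelder exponents at least \<open>\<gamma>|w|\<close>, where \<open>\<gamma>\<close> is the order of the translated path. The
  estimates thus reduce to a bound on the levels of \<open>X\<close> above \<open>\<lfloor>1/\<alpha>\<rfloor>\<close>, which follows from Chen's
  relation by repeated halving of the interval.

  For the last claim, let \<open>A\<close> be the closed algebra generated by \<open>\<bullet>\<^sub>0\<close> and the finitely many forests of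
  at most \<open>\<lfloor>1/\<alpha>\<rfloor>\<close> nodes without label \<open>0\<close>. Modulo \<open>A\<close>, each level of \<open>X\<close> is an additive function of
  the interval of Hoelder order above \<open>1\<close> and hence vanishes, so \<open>X\<close> takes values in \<open>A\<close>; and since \<open>A\<close>
  is finitely generated by elements of positive degree, algebra morphisms on \<open>A\<close> are determined by
  the generators even without continuity.
\<close>

section \<open>Linear extension\<close>

text \<open>All four estimates are one bookkeeping of exponents. Give each label i a weight, the
  Hoelder order that it contributes to the coordinates of X, and let \<kappa> i bound the length of
  the blocks that it can replace, that is, the degree of e_i + v_i. A word z in the support of
  \<open>\<Phi>\<^sub>v w\<close> then has |w| \<le> the sum of \<kappa> over the letters of z, so
  the order \<gamma> is reached as soon as \<gamma> * \<kappa> i \<le> the weight of i for every i.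
  In (i) all weights are \<alpha> and all \<kappa> are N, whence \<gamma> = \<alpha>/N. In (ii) the
  label 0 has weight 1 and \<kappa> = N, the others have weight \<alpha> and \<kappa> = 1, whence
  \<gamma> = min \<alpha> (1/N). Both translations are given by definite description, so existence
  and uniqueness come before any estimate. In the last claim the obstacle is that M, without
  continuity, can be applied only to finite sums, whereas X s t is an infinite series.\<close>

abbreviation single where "single \<equiv> Poly_Mapping.single"
abbreviation lookup where "lookup \<equiv> Poly_Mapping.lookup"
abbreviation keys where "keys \<equiv> Poly_Mapping.keys"

text \<open>This is the form in which scalars occur in the definition of
  \<open>shuffle\<close>.\<close>

definition scl :: "real \<Rightarrow> ('b \<Rightarrow>\<^sub>0 real) \<Rightarrow> ('b \<Rightarrow>\<^sub>0 real)" where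
  "scl c p = Poly_Mapping.map ((*) c) p"

definition lin :: "('b \<Rightarrow> 'c \<Rightarrow>\<^sub>0 real) \<Rightarrow> ('b \<Rightarrow>\<^sub>0 real) \<Rightarrow> ('c \<Rightarrow>\<^sub>0 real)" where
  "lin g p = (\<Sum>k\<in>keys p. scl (lookup p k) (g k))"

lemma lookup_scl [simp]: "lookup (scl c p) k = c * lookup p k"
  unfolding scl_def by (simp add: Poly_Mapping.map.rep_eq when_def)

lemma scl_simps [simp]:
  "scl c 0 = 0" "scl 0 p = 0" "scl 1 p = p" "scl c (scl d p) = scl (c * d) p"
  "scl c (single k d) = single k (c * d)"
  by (auto intro!: poly_mapping_eqI simp: lookup_single when_def)

lemma scl_add_right: "scl c (p + q) = scl c p + scl c q"
  by (auto intro!: poly_mapping_eqI simp: lookup_add algebra_simps)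

lemma scl_sum: "scl c (sum f A) = (\<Sum>i\<in>A. scl c (f i))"
  by (auto intro!: poly_mapping_eqI simp: lookup_sum sum_distrib_left)

lemma keys_scl: "keys (scl c p) \<subseteq> keys p"
  by (auto simp: in_keys_iff)

lemma scl_mult: "scl c p * q = scl c (p * q)" "q * scl c p = scl c (q * p)"
  for p q :: "'b::comm_monoid_add \<Rightarrow>\<^sub>0 real"
  unfolding scl_def mult_map_scale_conv_mult by (simp_all add: mult_ac)

lemma pairing_superset:
  assumes "finite S" "keys p \<subseteq> S"
  shows "pairing x p = (\<Sum>k\<in>S. x k * lookup p k)"
  unfolding pairing_def using assms
  by (intro sum.mono_neutral_left) (auto simp: in_keys_iff)

lemma pairing_0 [simp]: "pairing x 0 = 0"
  by (simp add: pairing_def)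

lemma pairing_add: "pairing x (p + q) = pairing x p + pairing x q"
proof -
  have *: "finite (keys p \<union> keys q)" "keys (p + q) \<subseteq> keys p \<union> keys q"
    using keys_add[of p q] by auto
  show ?thesis
    by (subst (1 2 3) pairing_superset[OF *(1)])
       (use * in \<open>auto simp: lookup_add algebra_simps sum.distrib\<close>)
qed

lemma pairing_single [simp]: "pairing x (single k c) = x k * c"
  by (subst pairing_superset[of "{k}"]) (auto simp: lookup_single)

lemma pairing_one: "pairing x 1 = x 0"
  unfolding single_one[symmetric] by (simp only: pairing_single mult_1_right)

lemma pairing_scl [simp]: "pairing x (scl c p) = c * pairing x p"
  by (subst (1 2) pairing_superset[of "keys p"])
     (auto simp: keys_scl[THEN subsetD] sum_distrib_left intro!: sum.cong)

lemma pairing_sum: "pairing x (sum f A) = (\<Sum>i\<in>A. pairing x (f i))"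
  by (induction A rule: infinite_finite_induct) (auto simp: pairing_add)

lemma pairing_cong: "(\<And>k. k \<in> keys p \<Longrightarrow> x k = y k) \<Longrightarrow> pairing x p = pairing y p"
  unfolding pairing_def by (auto intro: sum.cong)

lemma pairing_left_add: "pairing (\<lambda>k. x k + y k) p = pairing x p + pairing y p"
  and pairing_left_scale: "pairing (\<lambda>k. c * x k) p = c * pairing x p"
  and pairing_left_scale': "pairing (\<lambda>k. x k * c) p = pairing x p * c"
  and pairing_left_0 [simp]: "pairing (\<lambda>k. 0) p = 0"
  by (simp_all add: pairing_def sum.distrib algebra_simps sum_distrib_left sum_distrib_right)

lemma pairing_left_sum: "pairing (\<lambda>k. \<Sum>i\<in>A. x i k) p = (\<Sum>i\<in>A. pairing (x i) p)"
  unfolding pairing_def by (simp add: sum_distrib_right) (rule sum.swap)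

lemma pairing_basis: "pairing (basis_series k) p = lookup p k"
  unfolding pairing_def basis_series_def
  by (auto simp: if_distrib[of "\<lambda>z. z * _"] sum.delta in_keys_iff cong: if_cong)

lemma lookup_lin: "lookup (lin g p) j = pairing (\<lambda>k. lookup (g k) j) p"
  unfolding lin_def pairing_def by (simp add: lookup_sum mult_ac)

lemma lin_0 [simp]: "lin g 0 = 0"
  by (simp add: lin_def)

lemma lin_add: "lin g (p + q) = lin g p + lin g q"
  by (rule poly_mapping_eqI) (simp add: lookup_lin lookup_add pairing_add)

lemma lin_single [simp]: "lin g (single k c) = scl c (g k)"
  by (rule poly_mapping_eqI) (simp add: lookup_lin)

lemma lin_scl: "lin g (scl c p) = scl c (lin g p)"
  by (rule poly_mapping_eqI) (simp add: lookup_lin)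

lemma lin_sum: "lin g (sum f A) = (\<Sum>i\<in>A. lin g (f i))"
  by (rule poly_mapping_eqI) (simp add: lookup_lin lookup_sum pairing_sum)

lemma lin_cong: "(\<And>k. k \<in> keys p \<Longrightarrow> g k = h k) \<Longrightarrow> lin g p = lin h p"
  unfolding lin_def by (auto intro: sum.cong)

lemma lin_left_add: "lin (\<lambda>k. g k + h k) p = lin g p + lin h p"
  by (rule poly_mapping_eqI) (simp add: lookup_lin lookup_add pairing_left_add)

lemma lin_left_scl: "lin (\<lambda>k. scl c (g k)) p = scl c (lin g p)"
  by (rule poly_mapping_eqI) (simp add: lookup_lin pairing_left_scale)

lemma lin_left_sum: "lin (\<lambda>k. \<Sum>i\<in>A. g i k) p = (\<Sum>i\<in>A. lin (g i) p)"
  by (rule poly_mapping_eqI) (simp add: lookup_lin lookup_sum pairing_left_sum)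

lemma lin_left_0 [simp]: "lin (\<lambda>k. 0) p = 0"
  by (simp add: lin_def)

text \<open>A combination is the finite sum of its \<open>single\<close> terms, so linear identities
  need a check on basis elements only.\<close>

lemma poly_mapping_linear_induct [case_names zero add]:
  fixes p :: "'b \<Rightarrow>\<^sub>0 real"
  assumes "P 0" and "\<And>k c p. P p \<Longrightarrow> P (p + single k c)"
  shows "P p"
proof -
  have "P (\<Sum>k\<in>A. single k (lookup p k))" for A
    by (induction A rule: infinite_finite_induct)
       (auto simp: assms(1) add.commute[of "single _ _"] intro: assms(2))
  moreover have "p = (\<Sum>k\<in>keys p. single k (lookup p k))"
    by (rule poly_mapping_eqI)
       (auto simp: lookup_sum lookup_single when_def sum.delta' in_keys_iff)
  ultimately show ?thesis by metis
qed

text \<open>Transposition: a map of series given coordinatewise by pairing with \<open>g k\<close>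
  is the dual of \<open>lin g\<close>. Identities between translations become identities between
  finite combinations in this way.\<close>

lemma pairing_lin: "pairing x (lin g p) = pairing (\<lambda>k. pairing x (g k)) p"
  by (induction p rule: poly_mapping_linear_induct) (simp_all add: lin_add pairing_add mult.commute)

lemma lin_lin: "lin g (lin h p) = lin (\<lambda>k. lin g (h k)) p"
  by (rule poly_mapping_eqI) (simp add: lookup_lin pairing_lin)

lemma lin_ident [simp]: "lin (\<lambda>k. single k 1) p = p" for p :: "'b \<Rightarrow>\<^sub>0 real"
proof (rule poly_mapping_eqI)
  fix j :: 'b
  have "(\<lambda>k. lookup (single k (1::real)) j) = basis_series j"
    by (auto simp: basis_series_def lookup_single when_def)
  then show "lookup (lin (\<lambda>k. single k 1) p) j = lookup p j"
    by (simp only: lookup_lin pairing_basis)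
qed

lemma push_forward_lin: "push_forward g p = lin (\<lambda>k. single (g k) 1) p"
  unfolding push_forward_def lin_def by simp

lemma keys_lin: "keys (lin g p) \<subseteq> (\<Union>k\<in>keys p. keys (g k))"
proof
  fix j assume "j \<in> keys (lin g p)"
  then have "pairing (\<lambda>k. lookup (g k) j) p \<noteq> 0" by (simp add: in_keys_iff lookup_lin)
  then show "j \<in> (\<Union>k\<in>keys p. keys (g k))"
    unfolding pairing_def by (elim sum.not_neutral_contains_not_neutral) (auto simp: in_keys_iff)
qed

lemma keys_push_forward: "keys (push_forward g p) \<subseteq> g ` keys p"
  unfolding push_forward_lin using keys_lin[of "\<lambda>k. single (g k) 1" p] by fastforce

lemma push_forward_simps:
  "push_forward g 0 = 0" "push_forward g (p + q) = push_forward g p + push_forward g q"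
  "push_forward g (single k c) = single (g k) c"
  "push_forward g (scl c p) = scl c (push_forward g p)"
  "push_forward g (sum f A) = (\<Sum>i\<in>A. push_forward g (f i))"
  by (simp_all add: push_forward_lin lin_add lin_scl lin_sum)

lemma lin_push_forward: "lin h (push_forward g p) = lin (\<lambda>k. h (g k)) p"
  by (simp add: push_forward_lin lin_lin)

lemma push_forward_lin_right: "push_forward g (lin h p) = lin (\<lambda>k. push_forward g (h k)) p"
  by (simp add: push_forward_lin lin_lin)

lemma push_forward_push_forward: "push_forward g (push_forward h p) = push_forward (\<lambda>k. g (h k)) p"
  by (simp add: push_forward_lin lin_lin)

lemma pairing_push_forward: "pairing x (push_forward g p) = pairing (\<lambda>k. x (g k)) p"
  by (simp add: push_forward_lin pairing_lin)

text \<open>The universal property of a monoid algebra. It reduces identities about forests to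
  identities about single trees.\<close>

lemma lin_mult:
  fixes g :: "'b::monoid_add \<Rightarrow> 'c::comm_monoid_add \<Rightarrow>\<^sub>0 real"
  assumes "\<And>a b. g (a + b) = g a * g b"
  shows "lin g (p * q) = lin g p * lin g q"
proof (induction p rule: poly_mapping_linear_induct)
  case (add k c p)
  have "lin g (single k c * q) = lin g (single k c) * lin g q"
    by (induction q rule: poly_mapping_linear_induct)
       (simp_all add: distrib_left lin_add mult_single assms scl_mult mult_ac)
  then show ?case using add by (simp add: distrib_right lin_add)
qed simp

lemma push_forward_mult:
  fixes g :: "'b::comm_monoid_add \<Rightarrow> 'c::comm_monoid_add"
  assumes "\<And>a b. g (a + b) = g a + g b"
  shows "push_forward g (p * q) = push_forward g p * push_forward g q"
  unfolding push_forward_lin by (rule lin_mult) (simp add: assms mult_single)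

lemma push_forward_one:
  fixes g :: "'b::comm_monoid_add \<Rightarrow> 'c::comm_monoid_add"
  assumes "g 0 = 0"
  shows "push_forward g 1 = 1"
  unfolding single_one[symmetric] by (simp only: push_forward_simps assms)

lemma in_keys_sumE:
  assumes "z \<in> keys (sum f A)"
  obtains i where "i \<in> A" "z \<in> keys (f i)"
  using assms keys_sum[of f A] by blast

lemma in_keys_push_forwardE:
  assumes "z \<in> keys (push_forward g p)"
  obtains k where "k \<in> keys p" "z = g k"
  using assms keys_push_forward[of g p] by blast

lemma in_keys_linE:
  assumes "z \<in> keys (lin g p)"
  obtains k where "k \<in> keys p" "z \<in> keys (g k)"
  using assms keys_lin[of g p] by blast

lemma in_keys_multE:
  assumes "k \<in> keys (p * q)"
  obtains a b where "a \<in> keys p" "b \<in> keys q" "k = a + b"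
  using assms keys_mult[of p q] by blast

lemma push_forward_unit: "push_forward g 1 = single (g 0) 1"
  unfolding single_one[symmetric] by (simp only: push_forward_simps)

lemma push_forward_times_single:
  fixes p :: "'b::comm_monoid_add \<Rightarrow>\<^sub>0 real" and h :: "'b \<Rightarrow> 'c::comm_monoid_add"
  shows "push_forward h p * single c 1 = push_forward (\<lambda>a. h a + c) p"
  by (induction p rule: poly_mapping_linear_induct)
     (simp_all add: push_forward_simps distrib_right mult_single)

section \<open>Coordinate polynomials\<close>

lemma coordinate_polynomial_sum:
  assumes "\<And>i. i \<in> A \<Longrightarrow> coordinate_polynomial (p i)"
  shows "coordinate_polynomial (\<lambda>v. \<Sum>i\<in>A. p i v)"
  using assms by (induction A rule: infinite_finite_induct)
    (auto intro: coordinate_polynomial.intros)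

text \<open>The keys of a combination that depends on \<open>v\<close> vary with \<open>v\<close>.
  Polynomial dependence is therefore encoded as a finite sum of terms \<open>single k (c v)\<close>
  whose indices \<open>k\<close> are fixed in advance; this form is stable under \<open>lin\<close>
  and under products.\<close>

inductive polynomial_combination :: "(('i \<Rightarrow> 'b \<Rightarrow> real) \<Rightarrow> ('c \<Rightarrow>\<^sub>0 real)) \<Rightarrow> bool" where
  zero: "polynomial_combination (\<lambda>v. 0)"
| add_single: "polynomial_combination p \<Longrightarrow> coordinate_polynomial c \<Longrightarrow>
    polynomial_combination (\<lambda>v. p v + single k (c v))"

lemma polynomial_combination_const: "polynomial_combination (\<lambda>v. p)"
  by (induction p rule: poly_mapping_linear_induct)
     (auto intro: polynomial_combination.intros coordinate_polynomial.intros)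

lemma polynomial_combination_add:
  assumes "polynomial_combination p" "polynomial_combination q"
  shows "polynomial_combination (\<lambda>v. p v + q v)"
  using assms(2,1) by induction
    (auto intro: polynomial_combination.intros simp: add.assoc[symmetric])

lemma polynomial_combination_sum:
  assumes "\<And>i. i \<in> A \<Longrightarrow> polynomial_combination (p i)"
  shows "polynomial_combination (\<lambda>v. \<Sum>i\<in>A. p i v)"
  using assms by (induction A rule: infinite_finite_induct)
    (auto intro: polynomial_combination.zero polynomial_combination_add)

lemma polynomial_combination_scl:
  assumes "polynomial_combination p" "coordinate_polynomial c"
  shows "polynomial_combination (\<lambda>v. scl (c v) (p v))"
  using assms by induction
    (auto intro: polynomial_combination.intros coordinate_polynomial.intros simp: scl_add_right)

lemma polynomial_combination_lin:
  assumes "polynomial_combination p" "\<And>k. polynomial_combination (\<lambda>v. g v k)"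
  shows "polynomial_combination (\<lambda>v. lin (g v) (p v))"
  using assms by induction
    (auto intro!: polynomial_combination.zero polynomial_combination_add
      polynomial_combination_scl simp: lin_add)

lemma polynomial_combination_push_forward:
  assumes "polynomial_combination p"
  shows "polynomial_combination (\<lambda>v. push_forward g (p v))"
  unfolding push_forward_lin using assms
  by (intro polynomial_combination_lin polynomial_combination_const)

lemma polynomial_combination_mult:
  fixes p q :: "('i \<Rightarrow> 'b \<Rightarrow> real) \<Rightarrow> ('c::comm_monoid_add \<Rightarrow>\<^sub>0 real)"
  assumes "polynomial_combination p" "polynomial_combination q"
  shows "polynomial_combination (\<lambda>v. p v * q v)"
proof -
  have "polynomial_combination (\<lambda>v. q v * single k (c v))" if "coordinate_polynomial c" for k c
    using assms(2) by induction
      (auto intro!: polynomial_combination.intros coordinate_polynomial.mult that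
        simp: distrib_right mult_single)
  with assms(1) show ?thesis
    by induction (auto intro!: polynomial_combination.zero polynomial_combination_add
        simp: distrib_left mult.commute[of _ "q _"])
qed

lemma coordinate_polynomial_lookup:
  assumes "polynomial_combination p"
  shows "coordinate_polynomial (\<lambda>v. lookup (p v) k)"
  using assms
proof induction
  case (add_single p c j)
  then show ?case
    by (cases "j = k") (auto intro!: coordinate_polynomial.add simp: lookup_add lookup_single)
qed (auto intro: coordinate_polynomial.const)

section \<open>Hoelder estimates\<close>

abbreviation hoelder_bound ::
    "real \<Rightarrow> (real \<Rightarrow> real \<Rightarrow> 'b \<Rightarrow> real) \<Rightarrow> 'b \<Rightarrow> real \<Rightarrow> real \<Rightarrow> bool" where
  "hoelder_bound T X w C \<gamma> \<equiv> \<forall>s\<in>{0..T}. \<forall>t\<in>{0..T}. s \<noteq> t \<longrightarrow> \<bar>X s t w\<bar> \<le> C * \<bar>t - s\<bar> powr \<gamma>"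

lemma hoelder_sup_le_iff:
  assumes "0 \<le> c"
  shows "hoelder_sup \<gamma> I X w \<le> ennreal c \<longleftrightarrow>
    (\<forall>u\<in>I. \<forall>r\<in>I. u \<noteq> r \<longrightarrow> \<bar>X u r w\<bar> \<le> c * \<bar>r - u\<bar> powr \<gamma>)"
proof -
  have "ennreal (\<bar>X u r w\<bar> / \<bar>r - u\<bar> powr \<gamma>) \<le> ennreal c \<longleftrightarrow> \<bar>X u r w\<bar> \<le> c * \<bar>r - u\<bar> powr \<gamma>"
    if "u \<noteq> r" for u r
    using that assms by (simp add: pos_divide_le_eq)
  then show ?thesis
    unfolding hoelder_sup_def SUP_le_iff by auto
qed

lemma hoelder_sup_finite_iff:
  "hoelder_sup \<gamma> I X w < \<infinity> \<longleftrightarrow>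
    (\<exists>c\<ge>0. \<forall>u\<in>I. \<forall>r\<in>I. u \<noteq> r \<longrightarrow> \<bar>X u r w\<bar> \<le> c * \<bar>r - u\<bar> powr \<gamma>)"
proof
  assume "hoelder_sup \<gamma> I X w < \<infinity>"
  then obtain c where "0 \<le> c" "hoelder_sup \<gamma> I X w = ennreal c"
    by (cases "hoelder_sup \<gamma> I X w") auto
  then show "\<exists>c\<ge>0. \<forall>u\<in>I. \<forall>r\<in>I. u \<noteq> r \<longrightarrow> \<bar>X u r w\<bar> \<le> c * \<bar>r - u\<bar> powr \<gamma>"
    using hoelder_sup_le_iff[of c \<gamma> I X w] by auto
next
  assume "\<exists>c\<ge>0. \<forall>u\<in>I. \<forall>r\<in>I. u \<noteq> r \<longrightarrow> \<bar>X u r w\<bar> \<le> c * \<bar>r - u\<bar> powr \<gamma>"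
  then obtain c where "hoelder_sup \<gamma> I X w \<le> ennreal c"
    using hoelder_sup_le_iff[of _ \<gamma> I X w] by blast
  then show "hoelder_sup \<gamma> I X w < \<infinity>"
    by (rule le_less_trans) simp
qed

text \<open>The a priori exponent \<open>\<beta>\<close> only has to exceed \<open>1\<close>: halving the interval \<open>n\<close> times reduces its
  contribution by the factor \<open>2\<^bsup>n(1-\<beta>)\<^esup>\<close>.\<close>

lemma sewing_bound:
  fixes f :: "real \<Rightarrow> real \<Rightarrow> real" and T :: real
  assumes \<gamma>: "1 < \<gamma>" and \<beta>: "1 < \<beta>"
    and K: "\<And>s t. s \<in> {0..T} \<Longrightarrow> t \<in> {0..T} \<Longrightarrow> s \<noteq> t \<Longrightarrow> \<bar>f s t\<bar> \<le> K * \<bar>t - s\<bar> powr \<beta>"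
    and C: "\<And>s t. s \<in> {0..T} \<Longrightarrow> t \<in> {0..T} \<Longrightarrow> s \<noteq> t \<Longrightarrow>
      \<bar>f s t - f s ((s + t) / 2) - f ((s + t) / 2) t\<bar> \<le> C * \<bar>t - s\<bar> powr \<gamma>"
    and st: "s \<in> {0..T}" "t \<in> {0..T}" "s \<noteq> t"
  shows "\<bar>f s t\<bar> \<le> C / (1 - 2 powr (1 - \<gamma>)) * \<bar>t - s\<bar> powr \<gamma>"
proof -
  define L where "L = C / (1 - 2 powr (1 - \<gamma>))"
  have q: "2 powr (1 - \<gamma>) < 1" "2 powr (1 - \<beta>) < 1"
    using \<gamma> \<beta> powr_less_cancel_iff[of 2 "1 - \<gamma>" 0] powr_less_cancel_iff[of 2 "1 - \<beta>" 0] by simp_all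
  \<comment> \<open>\<open>L\<close> is the constant that one halving reproduces: the two halves
    contribute the factor \<open>2 powr (1 - \<gamma>)\<close>, the defect of additivity contributes
    \<open>C\<close>.\<close>
  have L: "2 powr (1 - \<gamma>) * L + C = L"
  proof -
    have "L * (1 - 2 powr (1 - \<gamma>)) = C" unfolding L_def using q(1) \<gamma> by simp
    then show ?thesis by (simp add: algebra_simps)
  qed
  have half: "2 * (h / 2) powr a = 2 powr (1 - a) * h powr a" if "0 \<le> h" for h a :: real
    using that by (simp add: powr_divide powr_diff)
  have *: "\<bar>f s t\<bar> \<le> L * \<bar>t - s\<bar> powr \<gamma> + K * (2 powr (1 - \<beta>)) ^ n * \<bar>t - s\<bar> powr \<beta>"
    if "s \<in> {0..T}" "t \<in> {0..T}" "s \<noteq> t" for n s t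
    using that
  proof (induction n arbitrary: s t)
    case 0
    have "0 \<le> C * \<bar>t - s\<bar> powr \<gamma>" using C[OF 0] by linarith
    then have "0 \<le> C" using 0 by (simp add: zero_le_mult_iff)
    then have "0 \<le> L" unfolding L_def using q(1) \<gamma> by simp
    then have "0 \<le> L * \<bar>t - s\<bar> powr \<gamma>" by simp
    with K[OF 0] show ?case by simp
  next
    case (Suc n)
    define m h where "m = (s + t) / 2" and "h = \<bar>t - s\<bar>"
    let ?b = "L * (h / 2) powr \<gamma> + K * (2 powr (1 - \<beta>)) ^ n * (h / 2) powr \<beta>"
    have m: "m \<in> {0..T}" "s \<noteq> m" "m \<noteq> t" "\<bar>m - s\<bar> = h / 2" "\<bar>t - m\<bar> = h / 2"
      using Suc.prems by (auto simp: m_def h_def abs_if field_simps)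
    have "\<bar>f s t\<bar> \<le> \<bar>f s t - f s m - f m t\<bar> + \<bar>f s m\<bar> + \<bar>f m t\<bar>" by linarith
    also have "\<dots> \<le> C * h powr \<gamma> + ?b + ?b"
      using C[OF Suc.prems] Suc.IH[of s m] Suc.IH[of m t] Suc.prems m
      unfolding m_def[symmetric] h_def[symmetric] by (intro add_mono) simp_all
    also have "\<dots> = C * h powr \<gamma> + L * (2 * (h / 2) powr \<gamma>) +
        K * (2 powr (1 - \<beta>)) ^ n * (2 * (h / 2) powr \<beta>)"
      by (simp add: algebra_simps)
    also have "\<dots> = (2 powr (1 - \<gamma>) * L + C) * h powr \<gamma> + K * (2 powr (1 - \<beta>)) ^ Suc n * h powr \<beta>"
      by (subst (1 2) half) (simp_all add: h_def algebra_simps)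
    finally show ?case by (simp add: L h_def)
  qed
  have "(\<lambda>n. (2 powr (1 - \<beta>)) ^ n) \<longlonglongrightarrow> (0::real)"
    by (rule LIMSEQ_power_zero) (use q in simp)
  then have "(\<lambda>n. L * \<bar>t - s\<bar> powr \<gamma> + K * (2 powr (1 - \<beta>)) ^ n * \<bar>t - s\<bar> powr \<beta>)
      \<longlonglongrightarrow> L * \<bar>t - s\<bar> powr \<gamma> + K * 0 * \<bar>t - s\<bar> powr \<beta>"
    by (intro tendsto_add tendsto_mult tendsto_const)
  then have "\<bar>f s t\<bar> \<le> L * \<bar>t - s\<bar> powr \<gamma> + K * 0 * \<bar>t - s\<bar> powr \<beta>"
    by (rule LIMSEQ_le_const) (use *[OF st] in auto)
  then show ?thesis by (simp add: L_def)
qed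

section \<open>Graded coalgebras and their convolution algebras\<close>

text \<open>A sum of nonnegative constants dominates each of them.\<close>

lemma uniform_bound:
  fixes P :: "'b \<Rightarrow> real \<Rightarrow> bool"
  assumes "finite A" and "\<And>w. w \<in> A \<Longrightarrow> \<exists>K\<ge>0. P w K"
    and mono: "\<And>w K K'. P w K \<Longrightarrow> K \<le> K' \<Longrightarrow> P w K'"
  shows "\<exists>K\<ge>0. \<forall>w\<in>A. P w K"
proof -
  obtain K where K: "\<And>w. w \<in> A \<Longrightarrow> 0 \<le> K w" "\<And>w. w \<in> A \<Longrightarrow> P w (K w)"
    using assms(2) by metis
  have "P w (sum K A)" if "w \<in> A" for w
    using K that assms(1) by (intro mono[OF K(2)]) (auto intro: member_le_sum)
  then show ?thesis
    using K(1) by (intro exI[of _ "sum K A"]) (auto intro: sum_nonneg)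
qed

text \<open>A connected graded coalgebra of finite type together with the convolution product on its
  dual. Words with deconcatenation and forests with the Connes--Kreimer coproduct are the two
  instances, so that the analysis is done once for both.\<close>

locale graded_coalgebra =
  fixes cut :: "'b \<Rightarrow> ('b \<times> 'b \<Rightarrow>\<^sub>0 real)" and one :: 'b and len :: "'b \<Rightarrow> nat"
    and mult :: "('b \<Rightarrow> real) \<Rightarrow> ('b \<Rightarrow> real) \<Rightarrow> 'b \<Rightarrow> real"
  assumes mult_eq: "mult x y w = pairing (\<lambda>(a, b). x a * y b) (cut w)"
    and mult_one_left: "mult (basis_series one) y = y"
    and mult_one_right: "mult x (basis_series one) = x"
    and len_cut: "(a, b) \<in> keys (cut w) \<Longrightarrow> len a + len b = len w"
    and len_eq_0_iff: "len w = 0 \<longleftrightarrow> w = one"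
    and finite_len: "finite {w. len w \<le> n}"
begin

lemma mult_cong:
  assumes "\<And>a b. (a, b) \<in> keys (cut w) \<Longrightarrow> x a * y b = x' a * y' b"
  shows "mult x y w = mult x' y' w"
  unfolding mult_eq by (rule pairing_cong) (use assms in auto)

lemma mult_add_left: "mult (\<lambda>k. x k + x' k) y w = mult x y w + mult x' y w"
  and mult_add_right: "mult x (\<lambda>k. y k + y' k) w = mult x y w + mult x y' w"
  and mult_scale_left: "mult (\<lambda>k. c * x k) y w = c * mult x y w"
  and mult_scale_right: "mult x (\<lambda>k. c * y k) w = c * mult x y w"
  by (simp_all add: mult_eq distrib_left distrib_right case_prod_unfold pairing_left_add
      pairing_left_scale[symmetric] mult_ac)

lemma mult_zero_left [simp]: "mult (\<lambda>_. 0) y w = 0"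
  and mult_zero_right [simp]: "mult x (\<lambda>_. 0) w = 0"
  by (simp_all add: mult_eq case_prod_unfold)

definition reduced :: "('b \<Rightarrow> real) \<Rightarrow> 'b \<Rightarrow> real" where
  "reduced x w = (if w = one then 0 else x w)"

text \<open>This is Chen's relation with the reduced coproduct: once the unit coordinates are split
  off, every remaining pair consists of elements of strictly smaller degree, so inductions on the
  degree apply to it.\<close>

lemma mult_split:
  "mult x y w = (if w = one then x one * y one else
     x one * y w + x w * y one + mult (reduced x) (reduced y) w)"
proof -
  have x: "x = (\<lambda>k. x one * basis_series one k + reduced x k)" for x
    by (auto simp: basis_series_def reduced_def)
  have m: "mult x y w = x one * y one * basis_series one w + x one * reduced y w +
      reduced x w * y one + mult (reduced x) (reduced y) w"
    by (subst x, subst x[of y])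
       (simp add: mult_add_left mult_add_right mult_scale_left mult_scale_right
         mult_one_left mult_one_right algebra_simps)
  show ?thesis
  proof (cases "w = one")
    case True
    have "mult (reduced x) (reduced y) one = mult (\<lambda>_. 0) (\<lambda>_. 0) one"
    proof (rule mult_cong)
      fix a b assume "(a, b) \<in> keys (cut one)"
      then have "len a = 0" using len_cut[of a b one] len_eq_0_iff[of one] by simp
      then show "reduced x a * reduced y b = 0 * 0"
        using len_eq_0_iff[of a] by (simp add: reduced_def)
    qed
    then show ?thesis using m True by (simp add: basis_series_def reduced_def)
  next
    case False
    then show ?thesis using m by (simp add: basis_series_def reduced_def)
  qed
qed

text \<open>What geometric and branched rough paths have in common for the estimates: of the
  character property only the value at the unit is kept.\<close>

definition regular_path :: "real \<Rightarrow> real \<Rightarrow> (real \<Rightarrow> real \<Rightarrow> 'b \<Rightarrow> real) \<Rightarrow> bool" where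
  "regular_path \<alpha> T X \<longleftrightarrow>
     (\<forall>s\<in>{0..T}. \<forall>u\<in>{0..T}. \<forall>t\<in>{0..T}. X s t = mult (X s u) (X u t)) \<and>
     (\<forall>s\<in>{0..T}. \<forall>t\<in>{0..T}. X s t one = 1) \<and>
     (\<forall>w. hoelder_sup (\<alpha> * real (len w)) {0..T} X w < \<infinity>)"

lemma
  assumes "regular_path \<alpha> T X" "s \<in> {0..T}" "t \<in> {0..T}"
  shows regular_path_chen: "u \<in> {0..T} \<Longrightarrow> X s t = mult (X s u) (X u t)"
    and regular_path_one: "X s t one = 1"
  using assms unfolding regular_path_def by blast+

text \<open>Lyons' extension: the levels up to \<open>\<lfloor>1/\<alpha>\<rfloor>\<close> control all higher levels.\<close>

lemma extension_bound:
  fixes wt :: "'b \<Rightarrow> real" and p :: nat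
  assumes \<alpha>: "0 < \<alpha>" "1 < \<alpha> * (real p + 1)" and R: "0 \<le> R"
    and wt_cut: "\<And>a b w. (a, b) \<in> keys (cut w) \<Longrightarrow> wt a + wt b = wt w"
    and wt_len: "\<And>w. \<alpha> * real (len w) \<le> wt w"
  shows "\<exists>K\<ge>0. \<forall>w. len w \<le> n \<longrightarrow> (\<forall>X. regular_path \<alpha> T X \<longrightarrow>
    (\<forall>w. len w \<le> p \<longrightarrow> hoelder_bound T X w R (wt w)) \<longrightarrow>
    hoelder_bound T X w K (wt w))"
    (is "\<exists>K\<ge>0. \<forall>w. len w \<le> n \<longrightarrow> ?P w K")
proof (induction n)
  case 0
  show ?case
    by (intro exI[of _ R]) (use R in auto)
next
  case (Suc n)
  obtain K where K: "0 \<le> K" "\<And>w. len w \<le> n \<Longrightarrow> ?P w K"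
    using Suc.IH by blast
  have mono: "?P w K'" if "?P w K" "K \<le> K'" for w K K'
  proof -
    have le: "K * h powr a \<le> K' * h powr a" for h a :: real
      using that(2) by (simp add: mult_right_mono)
    show ?thesis
      using that(1) by (intro allI impI ballI) (rule order_trans[OF _ le], simp)
  qed
  have "\<exists>K\<ge>0. ?P w K" if w: "len w \<le> Suc n" for w
  proof (cases "len w \<le> p \<or> len w \<le> n")
    case True
    then show ?thesis
    proof
      assume "len w \<le> p"
      then show ?thesis using R by (intro exI[of _ R]) auto
    next
      assume "len w \<le> n"
      then show ?thesis using K by blast
    qed
  next
    case False
    define C where "C = (\<Sum>k\<in>keys (cut w). \<bar>lookup (cut w) k\<bar> * (K * K))"
    have "1 < \<alpha> * (real p + 1)" by (rule \<alpha>)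
    also have "\<dots> \<le> \<alpha> * real (len w)" using False \<alpha>(1) by (intro mult_left_mono) auto
    finally have \<beta>: "1 < \<alpha> * real (len w)" .
    then have \<gamma>: "1 < wt w" using wt_len[of w] by linarith
    have wone: "w \<noteq> one" using False len_eq_0_iff[of w] by auto
    have C: "0 \<le> C" unfolding C_def using K(1) by (intro sum_nonneg) auto
    let ?K = "C / (1 - 2 powr (1 - wt w))"
    have "2 powr (1 - wt w) < 1"
      using \<gamma> powr_less_cancel_iff[of 2 "1 - wt w" 0] by simp
    then have K0: "0 \<le> ?K" using C by simp
    have "\<bar>X s t w\<bar> \<le> ?K * \<bar>t - s\<bar> powr wt w"
      if X: "regular_path \<alpha> T X"
        and XR: "\<forall>w. len w \<le> p \<longrightarrow> hoelder_bound T X w R (wt w)"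
        and st: "s \<in> {0..T}" "t \<in> {0..T}" "s \<noteq> t" for X s t
    proof -
      \<comment> \<open>\<open>B\<close> may depend on \<open>X\<close>, but it only starts the
        halving argument and does not enter \<open>?K\<close>, so the final bound is uniform over
        all paths.\<close>
      obtain B where B: "\<And>s t. s \<in> {0..T} \<Longrightarrow> t \<in> {0..T} \<Longrightarrow> s \<noteq> t \<Longrightarrow>
          \<bar>X s t w\<bar> \<le> B * \<bar>t - s\<bar> powr (\<alpha> * real (len w))"
        using X unfolding regular_path_def hoelder_sup_finite_iff by metis
      show ?thesis
      proof (rule sewing_bound[OF \<gamma> \<beta> B _ st])
        fix s t :: real assume st: "s \<in> {0..T}" "t \<in> {0..T}" "s \<noteq> t"
        define m h where "m = (s + t) / 2" and "h = \<bar>t - s\<bar>"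
        have m: "m \<in> {0..T}" "s \<noteq> m" "m \<noteq> t" "\<bar>m - s\<bar> \<le> h" "\<bar>t - m\<bar> \<le> h"
          using st by (auto simp: m_def h_def abs_if field_simps)
        have "X s t w = mult (X s m) (X m t) w"
          by (rule fun_cong[OF regular_path_chen[OF X st(1,2) m(1)]])
        also have "\<dots> = X m t w + X s m w + mult (reduced (X s m)) (reduced (X m t)) w"
          using wone regular_path_one[OF X st(1) m(1)] regular_path_one[OF X m(1) st(2)]
          by (subst mult_split) simp
        finally have "X s t w - X s m w - X m t w = mult (reduced (X s m)) (reduced (X m t)) w"
          by simp
        also have "\<bar>\<dots>\<bar> \<le> (\<Sum>k\<in>keys (cut w). \<bar>lookup (cut w) k\<bar> * (K * K) * h powr wt w)"
          unfolding mult_eq pairing_def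
        proof (rule order_trans[OF sum_abs sum_mono])
          fix k assume "k \<in> keys (cut w)"
          moreover obtain a b where k: "k = (a, b)" by (cases k)
          ultimately have ab: "(a, b) \<in> keys (cut w)" by simp
          show "\<bar>(case k of (a, b) \<Rightarrow> reduced (X s m) a * reduced (X m t) b) * lookup (cut w) k\<bar>
              \<le> \<bar>lookup (cut w) k\<bar> * (K * K) * h powr wt w"
          proof (cases "a = one \<or> b = one")
            case True
            then show ?thesis using K(1) by (auto simp: k reduced_def)
          next
            case False
            then have len: "len a \<le> n" "len b \<le> n"
              using len_cut[OF ab] w len_eq_0_iff[of a] len_eq_0_iff[of b] by auto
            have wt: "0 \<le> wt a" "0 \<le> wt b"
              using wt_len[of a] wt_len[of b] \<alpha>(1) by (auto intro: order_trans[rotated])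
            have "\<bar>X s m a\<bar> \<le> K * \<bar>m - s\<bar> powr wt a"
              using K(2)[OF len(1), rule_format, OF X XR[rule_format] st(1) m(1,2)] .
            also have "\<dots> \<le> K * h powr wt a"
              using K(1) wt m by (intro mult_left_mono powr_mono2) auto
            finally have a: "\<bar>X s m a\<bar> \<le> K * h powr wt a" .
            have "\<bar>X m t b\<bar> \<le> K * \<bar>t - m\<bar> powr wt b"
              using K(2)[OF len(2), rule_format, OF X XR[rule_format] m(1) st(2) m(3)] .
            also have "\<dots> \<le> K * h powr wt b"
              using K(1) wt m by (intro mult_left_mono powr_mono2) auto
            finally have b: "\<bar>X m t b\<bar> \<le> K * h powr wt b" .
            have "\<bar>X s m a\<bar> * \<bar>X m t b\<bar> \<le> (K * h powr wt a) * (K * h powr wt b)"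
              using a b by (intro mult_mono) auto
            also have "\<dots> = K * K * h powr wt w"
              using wt_cut[OF ab] by (simp add: powr_add[symmetric] algebra_simps)
            finally have "\<bar>lookup (cut w) k\<bar> * (\<bar>X s m a\<bar> * \<bar>X m t b\<bar>)
                \<le> \<bar>lookup (cut w) k\<bar> * (K * K * h powr wt w)"
              by (rule mult_left_mono) simp
            then show ?thesis using False by (simp add: k reduced_def abs_mult mult_ac)
          qed
        qed
        also have "\<dots> = C * h powr wt w"
          unfolding C_def by (simp add: sum_distrib_right)
        finally show "\<bar>X s t w - X s ((s + t) / 2) w - X ((s + t) / 2) t w\<bar> \<le> C * \<bar>t - s\<bar> powr wt w"
          unfolding m_def h_def .
      qed
    qed
    with K0 show ?thesis by (intro exI[of _ ?K]) simp
  qed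
  then have "\<exists>K\<ge>0. \<forall>w\<in>{w. len w \<le> Suc n}. ?P w K"
    by (intro uniform_bound[where P = ?P, OF finite_len _ mono]) (simp_all only: mem_Collect_eq)
  then show ?case by (simp only: Ball_def mem_Collect_eq)
qed

text \<open>\<open>1 + c\<^sup>2\<close> is a polynomial bound for \<open>\<bar>c\<bar>\<close>, and the combinations \<open>\<Phi> v w\<close> describe the
  transpose of a translation by \<open>v\<close>.\<close>

lemma translated_path_bound:
  fixes wt :: "'b \<Rightarrow> real" and \<Phi> :: "('l \<Rightarrow> 'b \<Rightarrow> real) \<Rightarrow> 'b \<Rightarrow> ('b \<Rightarrow>\<^sub>0 real)"
  assumes \<alpha>: "0 < \<alpha>" "1 < \<alpha> * (real p + 1)" and R: "0 \<le> R"
    and wt_cut: "\<And>a b w. (a, b) \<in> keys (cut w) \<Longrightarrow> wt a + wt b = wt w"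
    and wt_len: "\<And>w. \<alpha> * real (len w) \<le> wt w"
    and poly: "\<And>w. polynomial_combination (\<lambda>v. \<Phi> v w)"
    and keys_len: "\<And>v w w'. v \<in> V \<Longrightarrow> w' \<in> keys (\<Phi> v w) \<Longrightarrow> len w' \<le> len w"
    and keys_wt: "\<And>v w w'. v \<in> V \<Longrightarrow> w' \<in> keys (\<Phi> v w) \<Longrightarrow> \<gamma> * real (len w) \<le> wt w'"
  shows "\<exists>C. coordinate_polynomial C \<and> (\<forall>v. 0 \<le> C v) \<and> (\<forall>X. regular_path \<alpha> T X \<longrightarrow>
    (\<forall>w. len w \<le> p \<longrightarrow> hoelder_bound T X w R (wt w)) \<longrightarrow>
    (\<forall>v\<in>V. \<forall>w. len w \<le> n \<longrightarrow> hoelder_bound T (\<lambda>s t w. pairing (X s t) (\<Phi> v w)) w (C v) (\<gamma> * real (len w))))"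
proof -
  define A where "A = {w. len w \<le> n}"
  have fin: "finite A" unfolding A_def by (rule finite_len)
  obtain K where K: "0 \<le> K" "\<And>w X s t. w \<in> A \<Longrightarrow> regular_path \<alpha> T X \<Longrightarrow>
      \<forall>w. len w \<le> p \<longrightarrow> hoelder_bound T X w R (wt w) \<Longrightarrow>
      s \<in> {0..T} \<Longrightarrow> t \<in> {0..T} \<Longrightarrow> s \<noteq> t \<Longrightarrow> \<bar>X s t w\<bar> \<le> K * \<bar>t - s\<bar> powr wt w"
    using extension_bound[OF \<alpha> R wt_cut wt_len, where n = n and T = T] unfolding A_def by blast
  \<comment> \<open>Lowering the exponent from \<open>wt w'\<close> to
    \<open>\<gamma> * real (len w)\<close> costs a power of the length of the interval, which is at
    most \<open>max 1 T\<close>.\<close>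
  define D where "D w w' = K * (max 1 T) powr (wt w' - \<gamma> * real (len w))" for w w'
  have D: "0 \<le> D w w'" for w w' unfolding D_def using K(1) by simp
  \<comment> \<open>The sums run over the fixed finite set \<open>A\<close> and not over the keys of
    \<open>\<Phi> v w\<close>, which vary with \<open>v\<close>; otherwise \<open>C\<close> would
    not be a polynomial.\<close>
  define C where
    "C v = (\<Sum>w\<in>A. \<Sum>w'\<in>A. (1 + lookup (\<Phi> v w) w' * lookup (\<Phi> v w) w') * D w w')" for v
  have sq: "\<bar>c\<bar> \<le> 1 + c * c" for c :: real
  proof (cases "\<bar>c\<bar> \<le> 1")
    case False
    then have "\<bar>c\<bar> * 1 \<le> \<bar>c\<bar> * \<bar>c\<bar>" by (intro mult_left_mono) auto
    then show ?thesis by simp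
  qed (simp add: add_increasing2)
  have nn: "0 \<le> (\<Sum>w'\<in>A. (1 + lookup (\<Phi> v w) w' * lookup (\<Phi> v w) w') * D w w')" for v w
    using D by (intro sum_nonneg mult_nonneg_nonneg) auto
  have "coordinate_polynomial C"
    unfolding C_def
    by (intro coordinate_polynomial_sum coordinate_polynomial.add coordinate_polynomial.mult
        coordinate_polynomial.const coordinate_polynomial_lookup poly)
  moreover have "0 \<le> C v" for v
    unfolding C_def by (rule sum_nonneg) (rule nn)
  moreover have "\<bar>pairing (X s t) (\<Phi> v w)\<bar> \<le> C v * \<bar>t - s\<bar> powr (\<gamma> * real (len w))"
    if X: "regular_path \<alpha> T X"
      and XR: "\<forall>w. len w \<le> p \<longrightarrow> hoelder_bound T X w R (wt w)"
      and v: "v \<in> V" and w: "len w \<le> n"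
      and st: "s \<in> {0..T}" "t \<in> {0..T}" "s \<noteq> t" for X v w s t
  proof -
    define h where "h = \<bar>t - s\<bar>"
    have h: "0 < h" "h \<le> max 1 T" using st by (auto simp: h_def)
    have sub: "keys (\<Phi> v w) \<subseteq> A" using keys_len[OF v] w unfolding A_def by fastforce
    have "\<bar>pairing (X s t) (\<Phi> v w)\<bar> \<le> (\<Sum>w'\<in>A. \<bar>X s t w' * lookup (\<Phi> v w) w'\<bar>)"
      unfolding pairing_superset[OF fin sub] by (rule sum_abs)
    also have "\<dots> \<le> (\<Sum>w'\<in>A. (1 + lookup (\<Phi> v w) w' * lookup (\<Phi> v w) w') * D w w' *
        h powr (\<gamma> * real (len w)))"
    proof (rule sum_mono)
      fix w' assume w': "w' \<in> A"
      let ?c = "lookup (\<Phi> v w) w'"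
      show "\<bar>X s t w' * ?c\<bar> \<le> (1 + ?c * ?c) * D w w' * h powr (\<gamma> * real (len w))"
      proof (cases "w' \<in> keys (\<Phi> v w)")
        case False
        then have "?c = 0" by (simp add: in_keys_iff)
        then show ?thesis using D by simp
      next
        case True
        have "\<bar>X s t w'\<bar> \<le> K * h powr wt w'"
          unfolding h_def using K(2)[OF w' X XR st] .
        also have "h powr wt w' = h powr (wt w' - \<gamma> * real (len w)) * h powr (\<gamma> * real (len w))"
          by (simp add: powr_add[symmetric])
        also have "K * \<dots> \<le> K * (max 1 T powr (wt w' - \<gamma> * real (len w)) * h powr (\<gamma> * real (len w)))"
          using K(1) h keys_wt[OF v True] by (intro mult_left_mono mult_right_mono powr_mono2) auto
        finally have "\<bar>X s t w'\<bar> \<le> D w w' * h powr (\<gamma> * real (len w))"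
          by (simp add: D_def mult_ac)
        then have "\<bar>X s t w'\<bar> * \<bar>?c\<bar> \<le> D w w' * h powr (\<gamma> * real (len w)) * (1 + ?c * ?c)"
          using sq[of ?c] D by (intro mult_mono) auto
        then show ?thesis by (simp add: abs_mult mult_ac)
      qed
    qed
    also have "\<dots> = (\<Sum>w'\<in>A. (1 + lookup (\<Phi> v w) w' * lookup (\<Phi> v w) w') * D w w') *
        h powr (\<gamma> * real (len w))"
      by (simp add: sum_distrib_right)
    also have "\<dots> \<le> C v * h powr (\<gamma> * real (len w))"
      unfolding C_def using fin nn w
      by (intro mult_right_mono member_le_sum) (auto simp: A_def)
    finally show ?thesis unfolding h_def .
  qed
  ultimately show ?thesis by (intro exI[of _ C]) blast
qed

end

section \<open>Continuous linear maps of series\<close>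

lemma series_linear_add:
  assumes "series_linear M"
  shows "M (\<lambda>k. x k + y k) = (\<lambda>k. M x k + M y k)"
  using assms[unfolded series_linear_def, rule_format, of 1 x 1 y] by simp

lemma series_linear_scale:
  assumes "series_linear M"
  shows "M (\<lambda>k. c * x k) = (\<lambda>k. c * M x k)"
  using assms[unfolded series_linear_def, rule_format, of c x 0 x] by simp

lemma series_linear_zero:
  assumes "series_linear M"
  shows "M (\<lambda>k. 0) = (\<lambda>k. 0)"
  using series_linear_scale[OF assms, of 0 "\<lambda>k. 0"] by simp

lemma series_linear_sum:
  assumes "series_linear M"
  shows "M (\<lambda>k. \<Sum>i\<in>A. x i k) = (\<lambda>k. \<Sum>i\<in>A. M (x i) k)"
  by (induction A rule: infinite_finite_induct)
     (simp_all add: series_linear_zero[OF assms] series_linear_add[OF assms])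

lemma finite_support_expansion:
  assumes "finite S" "\<And>w. w \<notin> S \<Longrightarrow> x w = 0"
  shows "x = (\<lambda>k. \<Sum>w\<in>S. x w * basis_series w k)"
  using assms by (auto simp: basis_series_def if_distrib[of "(*) _"] sum.delta' cong: if_cong)

lemma series_linear_finite_support:
  assumes "series_linear M" "finite S" "\<And>w. w \<notin> S \<Longrightarrow> x w = 0"
  shows "M x = (\<lambda>k. \<Sum>w\<in>S. x w * M (basis_series w) k)"
  by (subst finite_support_expansion[OF assms(2,3)])
     (simp_all add: series_linear_sum[OF assms(1)] series_linear_scale[OF assms(1)])

lemma series_linear_pairing: "series_linear (\<lambda>x w. pairing x (\<Phi> w))"
  unfolding series_linear_def
  by (simp add: pairing_left_add pairing_left_scale)

lemma continuous_on_pairing: "continuous_on UNIV (\<lambda>x w. pairing x (\<Phi> w))"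
  unfolding pairing_def
  by (intro continuous_on_coordinatewise_then_product continuous_on_sum continuous_on_mult
      continuous_on_product_coordinates continuous_on_const)

context graded_coalgebra
begin

text \<open>Finitely supported series are dense in the product topology, and linearity determines
  both maps on them.\<close>

lemma continuous_linear_eqI:
  fixes M M' :: "('b \<Rightarrow> real) \<Rightarrow> ('c \<Rightarrow> real)"
  assumes M: "continuous_on UNIV M" "series_linear M"
    and M': "continuous_on UNIV M'" "series_linear M'"
    and eq: "\<And>w. M (basis_series w) = M' (basis_series w)"
  shows "M = M'"
proof (intro ext)
  fix x j
  \<comment> \<open>A cutoff in a continuous parameter: for e > 0 the factor vanishes once
    \<open>len w\<close> reaches 1/e, so \<open>h e\<close> has finite support, while
    \<open>h 0\<close> is \<open>x\<close>. Continuity at the boundary point 0 then replaces a limit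
    of truncations.\<close>
  define h where "h e w = max 0 (1 - e * real (len w)) * x w" for e :: real and w
  have "continuous_on {0..} (\<lambda>e. max 0 (1 - e * real (len w)) * x w)" for w
    by (intro continuous_intros)
  then have h: "continuous_on {0..} h"
    unfolding h_def by (rule continuous_on_coordinatewise_then_product)
  have "continuous_on {0..} (\<lambda>e. M (h e) j)" "continuous_on {0..} (\<lambda>e. M' (h e) j)"
    using continuous_on_compose2[OF M(1) h subset_UNIV]
      continuous_on_compose2[OF M'(1) h subset_UNIV]
    by (auto intro: continuous_on_product_then_coordinatewise)
  then have cont: "continuous_on (closure {0<..}) (\<lambda>e. M (h e) j - M' (h e) j)"
    by (intro continuous_on_diff) (simp_all add: closure_greaterThan)
  have zero: "M (h e) j - M' (h e) j = 0" if "e \<in> {0<..}" for e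
  proof -
    define S where "S = {w. len w \<le> nat \<lfloor>1 / e\<rfloor>}"
    have "h e w = 0" if "w \<notin> S" for w
    proof -
      have "1 / e < real (len w)" using that unfolding S_def by simp linarith
      then have "1 \<le> e * real (len w)" using \<open>e \<in> {0<..}\<close> by (simp add: field_simps)
      then show ?thesis by (simp add: h_def)
    qed
    then show ?thesis
      using series_linear_finite_support[OF M(2), of S "h e"]
        series_linear_finite_support[OF M'(2), of S "h e"] eq finite_len
      by (simp add: S_def)
  qed
  have "M (h 0) j - M' (h 0) j = 0"
    by (rule continuous_constant_on_closure[OF cont zero]) (auto simp: closure_greaterThan)
  moreover have "h 0 = x" by (simp add: h_def fun_eq_iff)
  ultimately show "M x j = M' x j" by simp
qed

end

section \<open>Words\<close>

definition word_cut :: "'l list \<Rightarrow> ('l list \<times> 'l list \<Rightarrow>\<^sub>0 real)" where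
  "word_cut w = (\<Sum>k\<le>length w. single (take k w, drop k w) 1)"

lemma keys_word_cut: "(a, b) \<in> keys (word_cut w) \<Longrightarrow> w = a @ b"
  unfolding word_cut_def using keys_sum by fastforce

lemma tensor_mult_Nil [simp]: "tensor_mult x y [] = x [] * y []"
  by (simp add: tensor_mult_def)

text \<open>Removing the first letter is a derivation twisted by the constant term. This recursion
  carries the inductions over words.\<close>

lemma tensor_mult_Cons:
  "tensor_mult x y (a # w) = x [] * y (a # w) + tensor_mult (\<lambda>z. x (a # z)) y w"
  by (simp add: tensor_mult_def sum.atMost_Suc_shift del: sum.atMost_Suc)

lemma tensor_mult_zero_left: "tensor_mult (\<lambda>z. 0) y w = 0"
  by (simp add: tensor_mult_def)

lemma tensor_mult_one_left: "tensor_mult (basis_series []) y = y"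
proof
  show "tensor_mult (basis_series []) y w = y w" for w
    by (cases w) (simp_all add: tensor_mult_Cons basis_series_def tensor_mult_zero_left)
qed

lemma tensor_mult_one_right: "tensor_mult x (basis_series []) = x"
proof
  show "tensor_mult x (basis_series []) w = x w" for w
    by (induction w arbitrary: x) (simp_all add: tensor_mult_Cons basis_series_def)
qed

interpretation word: graded_coalgebra word_cut "[] :: 'l::finite list" length tensor_mult
proof
  fix x y :: "'l list \<Rightarrow> real" and a b w :: "'l list" and n
  show "tensor_mult x y w = pairing (\<lambda>(a, b). x a * y b) (word_cut w)"
    by (simp add: word_cut_def pairing_sum tensor_mult_def)
  show "(a, b) \<in> keys (word_cut w) \<Longrightarrow> length a + length b = length w"
    using keys_word_cut by fastforce
  show "finite {w :: 'l list. length w \<le> n}"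
    using finite_lists_length_le[of "UNIV :: 'l set" n] by simp
qed (simp_all add: tensor_mult_one_left tensor_mult_one_right)

lemma tensor_mult_assoc:
  fixes x y z :: "'l::finite list \<Rightarrow> real"
  shows "tensor_mult (tensor_mult x y) z = tensor_mult x (tensor_mult y z)"
proof
  show "tensor_mult (tensor_mult x y) z w = tensor_mult x (tensor_mult y z) w" for w
    by (induction w arbitrary: x y)
       (simp_all add: tensor_mult_Cons word.mult_add_left word.mult_scale_left algebra_simps)
qed

lemma tensor_mult_sum_left:
  fixes x :: "'i \<Rightarrow> 'l::finite list \<Rightarrow> real"
  shows "tensor_mult (\<lambda>k. \<Sum>i\<in>A. x i k) y w = (\<Sum>i\<in>A. tensor_mult (x i) y w)"
  by (induction A rule: infinite_finite_induct) (simp_all add: word.mult_add_left)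

text \<open>A first factor without constant term uses up at least one letter, so the second factor
  is evaluated on shorter words only.\<close>

lemma tensor_mult_cong_shorter:
  assumes "x [] = 0" "\<And>z. length z < length w \<Longrightarrow> y z = y' z"
  shows "tensor_mult x y w = tensor_mult x y' w"
  unfolding tensor_mult_def
proof (rule sum.cong)
  fix k assume "k \<in> {..length w}"
  show "x (take k w) * y (drop k w) = x (take k w) * y' (drop k w)"
  proof (cases "k = 0 \<or> w = []")
    case False
    then have "length (drop k w) < length w" by simp
    then show ?thesis by (simp only: assms(2))
  qed (auto simp: assms(1))
qed simp

section \<open>Translation of tensor series\<close>

definition letter_image :: "('l \<Rightarrow> 'l list \<Rightarrow> real) \<Rightarrow> 'l \<Rightarrow> 'l list \<Rightarrow> real" where
  "letter_image v i = (\<lambda>w. basis_series [i] w + v i w)"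

text \<open>The condition under which substituting e_i + v_i for e_i in an infinite tensor series
  makes sense: each coordinate of the result is a finite sum.\<close>

definition constant_free :: "('l \<Rightarrow> 'l list \<Rightarrow> real) \<Rightarrow> bool" where
  "constant_free v \<longleftrightarrow> (\<forall>i. v i [] = 0)"

lemma letter_image_Nil: "constant_free v \<Longrightarrow> letter_image v i [] = 0"
  by (simp add: constant_free_def letter_image_def basis_series_def)

text \<open>The transpose of the translation: \<open>\<langle>T\<^sub>v x, w\<rangle> = \<langle>x, word_dual v w\<rangle>\<close>.\<close>

function word_dual :: "('l::finite \<Rightarrow> 'l list \<Rightarrow> real) \<Rightarrow> 'l list \<Rightarrow> ('l list \<Rightarrow>\<^sub>0 real)" where
  "word_dual v w = (if w = [] then single [] 1 else
     (\<Sum>i\<in>UNIV. push_forward ((#) i)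
       (\<Sum>k\<in>{1..length w}. scl (letter_image v i (take k w)) (word_dual v (drop k w)))))"
  by pat_completeness auto
termination
  by (relation "Wellfounded.measure (\<lambda>(v, w). length w)") auto

declare word_dual.simps [simp del]

definition word_translation :: "('l::finite \<Rightarrow> 'l list \<Rightarrow> real) \<Rightarrow> ('l list \<Rightarrow> real) \<Rightarrow> 'l list \<Rightarrow> real"
  where "word_translation v x = (\<lambda>w. pairing x (word_dual v w))"

lemma word_dual_Nil [simp]: "word_dual v [] = single [] 1"
  by (simp add: word_dual.simps)

lemma word_translation_Nil [simp]: "word_translation v x [] = x []"
  by (simp add: word_translation_def)

lemma series_linear_word_translation: "series_linear (word_translation v)"
  unfolding word_translation_def[abs_def] by (rule series_linear_pairing)

text \<open>The recursion starts at k = 1 in order to terminate. For a constant free family the term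
  k = 0 vanishes, and adding it turns the transposed recursion into a full
  \<open>tensor_mult\<close>.\<close>

lemma word_dual_nonempty:
  assumes "constant_free v" "w \<noteq> []"
  shows "word_dual v w = (\<Sum>i\<in>UNIV. push_forward ((#) i)
       (\<Sum>k\<le>length w. scl (letter_image v i (take k w)) (word_dual v (drop k w))))"
proof -
  have "(\<Sum>k\<in>{1..length w}. scl (letter_image v i (take k w)) (word_dual v (drop k w))) =
      (\<Sum>k\<le>length w. scl (letter_image v i (take k w)) (word_dual v (drop k w)))" for i
    by (rule sum.mono_neutral_left)
       (auto simp: letter_image_Nil[OF assms(1)] not_le)
  then show ?thesis using assms(2) by (subst word_dual.simps) simp
qed

lemma word_translation_nonempty:
  assumes "constant_free v" "w \<noteq> []"
  shows "word_translation v x w =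
    (\<Sum>i\<in>UNIV. tensor_mult (letter_image v i) (word_translation v (\<lambda>z. x (i # z))) w)"
  unfolding word_translation_def
  by (simp add: word_dual_nonempty[OF assms] pairing_sum pairing_push_forward tensor_mult_def)

text \<open>Expanding \<open>x\<close> by its first letter gives x [] plus the sum of the e_i times
  the series that remains after i; this is the image of that expansion under the
  substitution.\<close>

lemma word_translation_eq:
  assumes "constant_free v"
  shows "word_translation v x = (\<lambda>w. x [] * basis_series [] w +
    (\<Sum>i\<in>UNIV. tensor_mult (letter_image v i) (word_translation v (\<lambda>z. x (i # z))) w))"
proof
  fix w
  show "word_translation v x w = x [] * basis_series [] w +
    (\<Sum>i\<in>UNIV. tensor_mult (letter_image v i) (word_translation v (\<lambda>z. x (i # z))) w)"
  proof (cases "w = []")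
    case True
    then show ?thesis
      by (simp add: basis_series_def letter_image_Nil[OF assms])
  next
    case False
    then show ?thesis by (simp add: word_translation_nonempty[OF assms] basis_series_def)
  qed
qed

text \<open>Induction on the length of the word for arbitrary \<open>x\<close>. By
  \<open>tensor_mult_Cons\<close> a first letter of the product is taken from one of the two
  factors; the images of the letters have no constant term, so the induction hypothesis is needed on
  shorter words only, and associativity collects the terms.\<close>

lemma word_translation_mult:
  fixes v :: "'l::finite \<Rightarrow> 'l list \<Rightarrow> real"
  assumes v: "constant_free v"
  shows "word_translation v (tensor_mult x y) =
    tensor_mult (word_translation v x) (word_translation v y)"
proof
  show "word_translation v (tensor_mult x y) w =
    tensor_mult (word_translation v x) (word_translation v y) w" for w
  proof (induction w arbitrary: x rule: measure_induct_rule[of length])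
    case (less w)
    let ?M = "word_translation v"
    let ?L = "\<lambda>x i z. x (i # z)"
    show ?case
    proof (cases "w = []")
      case False
      have u: "letter_image v i [] = 0" for i
        by (rule letter_image_Nil[OF v])
      have "tensor_mult (letter_image v i) (?M (?L (tensor_mult x y) i)) w =
          x [] * tensor_mult (letter_image v i) (?M (?L y i)) w +
          tensor_mult (tensor_mult (letter_image v i) (?M (?L x i))) (?M y) w" for i
      proof -
        have "tensor_mult (letter_image v i) (?M (?L (tensor_mult x y) i)) w =
          tensor_mult (letter_image v i)
            (\<lambda>z. x [] * ?M (?L y i) z + tensor_mult (?M (?L x i)) (?M y) z) w"
        proof (rule tensor_mult_cong_shorter[of "letter_image v i", OF u])
          fix z :: "'l list" assume "length z < length w"
          then show "?M (?L (tensor_mult x y) i) z =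
              x [] * ?M (?L y i) z + tensor_mult (?M (?L x i)) (?M y) z"
            by (simp add: tensor_mult_Cons series_linear_add[OF series_linear_word_translation]
                series_linear_scale[OF series_linear_word_translation] less.IH)
        qed
        then show ?thesis
          by (simp add: word.mult_add_right word.mult_scale_right tensor_mult_assoc)
      qed
      then have "?M (tensor_mult x y) w = x [] * ?M y w + tensor_mult
          (\<lambda>w. \<Sum>i\<in>UNIV. tensor_mult (letter_image v i) (?M (?L x i)) w) (?M y) w"
        using word_translation_nonempty[OF v False]
        by (simp add: sum.distrib sum_distrib_left[symmetric] tensor_mult_sum_left)
      also have "\<dots> = tensor_mult (?M x) (?M y) w"
        by (subst (3) word_translation_eq[OF v])
           (simp add: word.mult_add_left word.mult_scale_left tensor_mult_one_left)
      finally show ?thesis .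
    qed simp
  qed
qed

lemma word_translation_one:
  assumes v: "constant_free v"
  shows "word_translation v (basis_series []) = basis_series []"
proof -
  have "(\<lambda>z. basis_series [] (i # z)) = (\<lambda>z. 0)" for i :: 'a
    by (auto simp: basis_series_def)
  then show ?thesis
    by (subst word_translation_eq[OF v])
       (simp add: series_linear_zero[OF series_linear_word_translation] basis_series_def)
qed

lemma word_translation_letter:
  assumes v: "constant_free v"
  shows "word_translation v (basis_series [i]) = letter_image v i"
proof -
  have "(\<lambda>z. basis_series [i] (j # z)) = (if i = j then basis_series [] else (\<lambda>z. 0))" for j
    by (auto simp: basis_series_def)
  then have "tensor_mult (letter_image v j) (word_translation v (\<lambda>z. basis_series [i] (j # z))) w =
      (if i = j then letter_image v i w else 0)" for j w
    by (simp add: word_translation_one[OF v] tensor_mult_one_right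
        series_linear_zero[OF series_linear_word_translation])
  then show ?thesis
    by (subst word_translation_eq[OF v]) (auto simp: basis_series_def)
qed

lemma is_tensor_translation_word_translation:
  assumes "constant_free v"
  shows "is_tensor_translation v (word_translation v)"
proof -
  have "continuous_on UNIV (word_translation v)"
    unfolding word_translation_def[abs_def] by (rule continuous_on_pairing)
  then show ?thesis
    unfolding is_tensor_translation_def algebra_morphism_def
    by (simp add: word_translation_mult[OF assms] word_translation_one[OF assms]
        word_translation_letter[OF assms] series_linear_word_translation letter_image_def)
qed

lemma basis_series_Cons:
  "basis_series (i # w) = tensor_mult (basis_series [i]) (basis_series w)"
proof
  fix z :: "'a list"
  show "basis_series (i # w) z = tensor_mult (basis_series [i]) (basis_series w) z"
  proof (cases z)
    case (Cons j z')
    have "(\<lambda>z. basis_series [i] (j # z)) = (if i = j then basis_series [] else (\<lambda>z. 0))"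
      by (auto simp: basis_series_def)
    then show ?thesis
      by (simp add: Cons tensor_mult_Cons tensor_mult_one_left tensor_mult_zero_left)
         (auto simp: basis_series_def)
  qed (simp add: basis_series_def)
qed

text \<open>A word is the product of its letters, on which both morphisms are prescribed; continuity
  does the rest.\<close>

lemma is_tensor_translation_unique:
  fixes v :: "'l::finite \<Rightarrow> 'l list \<Rightarrow> real"
  assumes "is_tensor_translation v M" "is_tensor_translation v M'"
  shows "M = M'"
proof (rule word.continuous_linear_eqI)
  show "M (basis_series w) = M' (basis_series w)" for w
  proof (induction w)
    case (Cons i w)
    then show ?case
      using assms unfolding basis_series_Cons[of i w] is_tensor_translation_def algebra_morphism_def
      by simp
  qed (use assms in \<open>simp add: is_tensor_translation_def algebra_morphism_def\<close>)
qed (use assms in \<open>simp_all add: is_tensor_translation_def algebra_morphism_def\<close>)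

lemma tensor_translation_eq:
  assumes "constant_free v"
  shows "tensor_translation v = word_translation v"
  unfolding tensor_translation_def
proof (rule the_equality)
  show "is_tensor_translation v (word_translation v)"
    by (rule is_tensor_translation_word_translation[OF assms])
  then show "M = word_translation v" if "is_tensor_translation v M" for M
    by (rule is_tensor_translation_unique[OF that])
qed

section \<open>The shuffle product and primitive families\<close>

lemma shuffle_lin: "shuffle p q = lin (\<lambda>u. lin (\<lambda>w. shuffle_words u w) q) p"
  unfolding shuffle_def lin_def
  by (simp add: scl_sum) (simp add: scl_def[symmetric])

lemma shuffle_simps:
  "shuffle (p + p') q = shuffle p q + shuffle p' q"
  "shuffle p (q + q') = shuffle p q + shuffle p q'"
  "shuffle (scl c p) q = scl c (shuffle p q)"
  "shuffle p (scl c q) = scl c (shuffle p q)"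
  "shuffle (\<Sum>i\<in>A. f i) q = (\<Sum>i\<in>A. shuffle (f i) q)"
  "shuffle p (\<Sum>i\<in>A. g i) = (\<Sum>i\<in>A. shuffle p (g i))"
  "shuffle (single u 1) (single w 1) = shuffle_words u w"
  by (simp_all add: shuffle_lin lin_add lin_left_add lin_scl lin_left_scl lin_sum lin_left_sum)

lemma shuffle_words_Nil_right [simp]: "shuffle_words u [] = single u 1"
  by (cases u) simp_all

lemma shuffle_Nil: "shuffle (single [] 1) q = q" "shuffle p (single [] 1) = p"
  for p q :: "'a list \<Rightarrow>\<^sub>0 real"
proof -
  have "shuffle_words [] = (\<lambda>w :: 'a list. single w 1)" by (rule ext) simp
  then show "shuffle (single [] 1) q = q" by (simp add: shuffle_lin)
qed (simp add: shuffle_lin)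

lemma shuffle_push_forward_Cons:
  "shuffle (push_forward ((#) i) p) (push_forward ((#) j) q) =
     push_forward ((#) i) (shuffle p (push_forward ((#) j) q)) +
     push_forward ((#) j) (shuffle (push_forward ((#) i) p) q)"
  by (simp add: shuffle_lin lin_push_forward push_forward_lin_right lin_left_add)

text \<open>The recursion of \<open>shuffle_words\<close>, extended bilinearly to combinations
  without the empty word.\<close>

lemma shuffle_sum_Cons:
  fixes P Q :: "'l::finite \<Rightarrow> ('l list \<Rightarrow>\<^sub>0 real)"
  defines "p \<equiv> \<Sum>i\<in>UNIV. push_forward ((#) i) (P i)"
    and "q \<equiv> \<Sum>j\<in>UNIV. push_forward ((#) j) (Q j)"
  shows "shuffle p q = (\<Sum>i\<in>UNIV. push_forward ((#) i) (shuffle (P i) q)) +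
    (\<Sum>j\<in>UNIV. push_forward ((#) j) (shuffle p (Q j)))"
proof -
  have "shuffle p q =
      (\<Sum>j\<in>UNIV. \<Sum>i\<in>UNIV. push_forward ((#) i) (shuffle (P i) (push_forward ((#) j) (Q j)))) +
      (\<Sum>j\<in>UNIV. \<Sum>i\<in>UNIV. push_forward ((#) j) (shuffle (push_forward ((#) i) (P i)) (Q j)))"
    unfolding p_def q_def
    by (simp only: shuffle_simps(5,6) shuffle_push_forward_Cons sum.distrib)
  also have "(\<Sum>j\<in>UNIV. \<Sum>i\<in>UNIV. push_forward ((#) i) (shuffle (P i) (push_forward ((#) j) (Q j)))) =
      (\<Sum>i\<in>UNIV. \<Sum>j\<in>UNIV. push_forward ((#) i) (shuffle (P i) (push_forward ((#) j) (Q j))))"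
    by (rule sum.swap)
  finally show ?thesis
    unfolding p_def q_def by (simp only: shuffle_simps(5,6) push_forward_simps(5))
qed

lemma pairing_shuffle: "pairing x (shuffle p q) =
    pairing (\<lambda>u. pairing (\<lambda>w. pairing x (shuffle_words u w)) q) p"
  by (simp add: shuffle_lin pairing_lin)

lemma keys_shuffle_words: "z \<in> keys (shuffle_words u w) \<Longrightarrow> length z = length u + length w"
proof (induction u w arbitrary: z rule: shuffle_words.induct)
  case (3 a u b w)
  from 3(3) have "z \<in> keys (push_forward ((#) a) (shuffle_words u (b # w))) \<or>
      z \<in> keys (push_forward ((#) b) (shuffle_words (a # u) w))"
    using keys_add by fastforce
  then show ?case
    using 3(1,2) keys_push_forward by fastforce
qed auto

text \<open>Deconcatenation is a morphism for the shuffle product.\<close>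

lemma pairing_tensor_mult_shuffle_words:
  "pairing (tensor_mult f g) (shuffle_words u w) =
    (\<Sum>k\<le>length u. \<Sum>l\<le>length w. pairing f (shuffle_words (take k u) (take l w)) *
       pairing g (shuffle_words (drop k u) (drop l w)))"
proof (induction u w arbitrary: f rule: shuffle_words.induct)
  case (1 w)
  then show ?case by (simp add: tensor_mult_def)
next
  case (2 a u)
  have "pairing g (shuffle_words x []) = g x" for x by simp
  then show ?case by (simp add: tensor_mult_def del: sum.atMost_Suc)
next
  case (3 a u b w)
  let ?L = "\<lambda>c z. f (c # z)"
  let ?G = "\<lambda>k l. pairing g (shuffle_words (drop k (a # u)) (drop l (b # w)))"
  let ?F = "\<lambda>k l. pairing f (shuffle_words (take k (a # u)) (take l (b # w)))"
  have "pairing (tensor_mult f g) (shuffle_words (a # u) (b # w)) =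
      f [] * ?G 0 0 + pairing (tensor_mult (?L a) g) (shuffle_words u (b # w)) +
      pairing (tensor_mult (?L b) g) (shuffle_words (a # u) w)"
    by (simp add: pairing_add pairing_push_forward tensor_mult_Cons pairing_left_add
        pairing_left_scale algebra_simps)
  also have "pairing (tensor_mult (?L a) g) (shuffle_words u (b # w)) =
      (\<Sum>k\<le>length u. ?F (Suc k) 0 * ?G (Suc k) 0) +
      (\<Sum>k\<le>length u. \<Sum>l\<le>length w.
        pairing (?L a) (shuffle_words (take k u) (take (Suc l) (b # w))) * ?G (Suc k) (Suc l))"
    by (simp add: 3(1) sum.atMost_Suc_shift sum.distrib del: sum.atMost_Suc)
  also have "pairing (tensor_mult (?L b) g) (shuffle_words (a # u) w) =
      (\<Sum>l\<le>length w. ?F 0 (Suc l) * ?G 0 (Suc l)) +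
      (\<Sum>k\<le>length u. \<Sum>l\<le>length w.
        pairing (?L b) (shuffle_words (take (Suc k) (a # u)) (take l w)) * ?G (Suc k) (Suc l))"
    by (simp add: 3(2) sum.atMost_Suc_shift del: sum.atMost_Suc)
  also have "f [] * ?G 0 0 + ((\<Sum>k\<le>length u. ?F (Suc k) 0 * ?G (Suc k) 0) +
      (\<Sum>k\<le>length u. \<Sum>l\<le>length w.
        pairing (?L a) (shuffle_words (take k u) (take (Suc l) (b # w))) * ?G (Suc k) (Suc l))) +
      ((\<Sum>l\<le>length w. ?F 0 (Suc l) * ?G 0 (Suc l)) +
      (\<Sum>k\<le>length u. \<Sum>l\<le>length w.
        pairing (?L b) (shuffle_words (take (Suc k) (a # u)) (take l w)) * ?G (Suc k) (Suc l))) =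
      ?F 0 0 * ?G 0 0 + (\<Sum>l\<le>length w. ?F 0 (Suc l) * ?G 0 (Suc l)) +
      (\<Sum>k\<le>length u. ?F (Suc k) 0 * ?G (Suc k) 0 +
        (\<Sum>l\<le>length w. ?F (Suc k) (Suc l) * ?G (Suc k) (Suc l)))"
    by (simp add: pairing_add pairing_push_forward sum.distrib distrib_right)
  also have "\<dots> = (\<Sum>k\<le>length (a # u). \<Sum>l\<le>length (b # w). ?F k l * ?G k l)"
    unfolding list.size add_Suc_right add_0_right sum.atMost_Suc_shift by simp
  finally show ?case .
qed

definition primitive_family :: "('l \<Rightarrow> 'l list \<Rightarrow> real) \<Rightarrow> bool" where
  "primitive_family v \<longleftrightarrow> (\<forall>i. v i \<in> lie_series)"

lemma lie_series_shuffle: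
  assumes "x \<in> lie_series"
  shows "pairing x (shuffle_words u w) = x u * basis_series [] w + basis_series [] u * x w"
proof -
  have "shuffle_coproduct x = (\<lambda>(u, w). x u * basis_series [] w + basis_series [] u * x w)"
    using assms by (simp add: lie_series_def)
  from fun_cong[OF this, of "(u, w)"] show ?thesis
    by (simp add: shuffle_coproduct_def)
qed

lemma lie_series_Nil: "x \<in> lie_series \<Longrightarrow> x [] = 0"
  using lie_series_shuffle[of x "[]" "[]"] by (simp add: basis_series_def)

lemma primitive_family_constant_free: "primitive_family v \<Longrightarrow> constant_free v"
  by (simp add: primitive_family_def constant_free_def lie_series_Nil)

text \<open>The letters are themselves primitive: a word of length one does not occur in a shuffle
  of two nonempty words.\<close>

lemma letter_image_shuffle:
  assumes "primitive_family v"
  shows "pairing (letter_image v i) (shuffle_words u w) =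
    letter_image v i u * basis_series [] w + basis_series [] u * letter_image v i w"
proof -
  have "pairing (basis_series [i]) (shuffle_words u w) =
      basis_series [i] u * basis_series [] w + basis_series [] u * basis_series [i] w"
  proof (cases "u = [] \<or> w = []")
    case False
    then have "[i] \<notin> keys (shuffle_words u w)"
      using keys_shuffle_words[of "[i]" u w] by (cases u; cases w) auto
    then show ?thesis using False
      by (simp add: pairing_basis in_keys_iff) (simp add: basis_series_def)
  qed (auto simp: basis_series_def)
  moreover have "pairing (v i) (shuffle_words u w) =
      v i u * basis_series [] w + basis_series [] u * v i w"
    using assms lie_series_shuffle unfolding primitive_family_def by blast
  ultimately show ?thesis
    unfolding letter_image_def pairing_left_add by (simp add: algebra_simps)
qed

lemma basis_series_take:
  "k \<le> length w \<Longrightarrow> basis_series [] (take k w) = (if k = 0 then 1 else 0 :: real)"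
  by (auto simp: basis_series_def)

text \<open>\<open>T\<^sub>v\<close> is compatible with the shuffle coproduct because the images of the letters are
  primitive.\<close>

lemma pairing_word_translation_shuffle:
  fixes v :: "'l::finite \<Rightarrow> 'l list \<Rightarrow> real"
  assumes v: "primitive_family v"
  shows "pairing (word_translation v x) (shuffle_words u w) =
    pairing x (shuffle (word_dual v u) (word_dual v w))"
proof (induction "length u + length w" arbitrary: u w x rule: less_induct)
  case less
  note cf = primitive_family_constant_free[OF v]
  let ?M = "word_translation v"
  let ?u = "letter_image v"
  let ?L = "\<lambda>i z. x (i # z)"
  \<comment> \<open>For nonempty \<open>w\<close> this is the part of \<open>word_dual v w\<close>
    that follows a first letter i.\<close>
  let ?P = "\<lambda>i w. \<Sum>k\<le>length w. scl (?u i (take k w)) (word_dual v (drop k w))"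
  show ?case
  proof (cases "u = [] \<or> w = []")
    case True
    then show ?thesis by (auto simp: shuffle_Nil word_translation_def)
  next
    case False
    then have ne: "u \<noteq> []" "w \<noteq> []" by auto
    \<comment> \<open>The induction hypothesis does not reach k = 0, but there the weight is
      zero.\<close>
    have IHu: "?u i (take k u) * pairing (?M (?L i)) (shuffle_words (drop k u) w) =
        ?u i (take k u) * pairing (?L i) (shuffle (word_dual v (drop k u)) (word_dual v w))" for i k
      using ne by (cases "k = 0") (simp_all add: letter_image_Nil[OF cf] less)
    have IHw: "?u i (take k w) * pairing (?M (?L i)) (shuffle_words u (drop k w)) =
        ?u i (take k w) * pairing (?L i) (shuffle (word_dual v u) (word_dual v (drop k w)))" for i k
      using ne by (cases "k = 0") (simp_all add: letter_image_Nil[OF cf] less)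
    have "pairing (?M x) (shuffle_words u w) =
        pairing (\<lambda>z. \<Sum>i\<in>UNIV. tensor_mult (?u i) (?M (?L i)) z) (shuffle_words u w)"
    proof (rule pairing_cong)
      fix z assume "z \<in> keys (shuffle_words u w)"
      then have "z \<noteq> []" using keys_shuffle_words[of z u w] ne by auto
      then show "?M x z = (\<Sum>i\<in>UNIV. tensor_mult (?u i) (?M (?L i)) z)"
        by (rule word_translation_nonempty[OF cf])
    qed
    also have "\<dots> = (\<Sum>i\<in>UNIV. \<Sum>k\<le>length u. \<Sum>l\<le>length w.
        (?u i (take k u) * basis_series [] (take l w) +
          basis_series [] (take k u) * ?u i (take l w)) *
        pairing (?M (?L i)) (shuffle_words (drop k u) (drop l w)))"
      by (simp add: pairing_left_sum pairing_tensor_mult_shuffle_words letter_image_shuffle[OF v])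
    \<comment> \<open>Primitivity forces one of the two initial blocks to be empty, so of the double
      sum only the terms with k = 0 or l = 0 remain.\<close>
    also have "\<dots> = (\<Sum>i\<in>UNIV.
        (\<Sum>k\<le>length u. ?u i (take k u) * pairing (?M (?L i)) (shuffle_words (drop k u) w)) +
        (\<Sum>l\<le>length w. ?u i (take l w) * pairing (?M (?L i)) (shuffle_words u (drop l w))))"
    proof (rule sum.cong[OF refl])
      fix i :: 'l
      have "(\<Sum>l\<le>length w. (?u i (take k u) * basis_series [] (take l w) +
          basis_series [] (take k u) * ?u i (take l w)) *
        pairing (?M (?L i)) (shuffle_words (drop k u) (drop l w))) =
        ?u i (take k u) * pairing (?M (?L i)) (shuffle_words (drop k u) w) + (if k = 0 then
        (\<Sum>l\<le>length w. ?u i (take l w) * pairing (?M (?L i)) (shuffle_words u (drop l w))) else 0)"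
        if "k \<le> length u" for k
      proof -
        have "(\<Sum>l\<le>length w. ?u i (take k u) * basis_series [] (take l w) *
            pairing (?M (?L i)) (shuffle_words (drop k u) (drop l w))) =
          (\<Sum>l\<le>length w. if l = 0 then ?u i (take k u) *
            pairing (?M (?L i)) (shuffle_words (drop k u) (drop l w)) else 0)"
          by (rule sum.cong) (simp_all add: basis_series_take)
        then show ?thesis
          using that by (simp add: distrib_right sum.distrib basis_series_take sum.delta')
      qed
      then show "(\<Sum>k\<le>length u. \<Sum>l\<le>length w. (?u i (take k u) * basis_series [] (take l w) +
          basis_series [] (take k u) * ?u i (take l w)) *
        pairing (?M (?L i)) (shuffle_words (drop k u) (drop l w))) =
        (\<Sum>k\<le>length u. ?u i (take k u) * pairing (?M (?L i)) (shuffle_words (drop k u) w)) +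
        (\<Sum>l\<le>length w. ?u i (take l w) * pairing (?M (?L i)) (shuffle_words u (drop l w)))"
        by (simp add: sum.distrib)
    qed
    also have "\<dots> = (\<Sum>i\<in>UNIV. pairing (?L i) (shuffle (?P i u) (word_dual v w)) +
        pairing (?L i) (shuffle (word_dual v u) (?P i w)))"
      by (simp add: IHu IHw shuffle_simps pairing_sum)
    also have "\<dots> = pairing x (shuffle (word_dual v u) (word_dual v w))"
    proof -
      let ?p = "\<lambda>i w. push_forward ((#) i) (?P i w)"
      have U: "word_dual v u = (\<Sum>i\<in>UNIV. ?p i u)" and W: "word_dual v w = (\<Sum>i\<in>UNIV. ?p i w)"
        by (rule word_dual_nonempty[OF cf], fact)+
      have "shuffle (word_dual v u) (word_dual v w) =
          (\<Sum>i\<in>UNIV. push_forward ((#) i) (shuffle (?P i u) (word_dual v w))) +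
          (\<Sum>j\<in>UNIV. push_forward ((#) j) (shuffle (word_dual v u) (?P j w)))"
        using shuffle_sum_Cons[of "\<lambda>i. ?P i u" "\<lambda>i. ?P i w"]
        unfolding U[symmetric] W[symmetric] .
      then show ?thesis
        by (simp only: pairing_add pairing_sum pairing_push_forward sum.distrib)
    qed
    finally show ?thesis .
  qed
qed

lemma pairing_word_translation_grouplike:
  fixes v :: "'l::finite \<Rightarrow> 'l list \<Rightarrow> real"
  assumes v: "primitive_family v"
    and x: "\<And>p q. pairing x (shuffle p q) = pairing x p * pairing x q"
  shows "pairing (word_translation v x) (shuffle p q) =
    pairing (word_translation v x) p * pairing (word_translation v x) q"
proof -
  have "pairing (word_translation v x) (shuffle p q) =
      pairing (\<lambda>u. pairing (\<lambda>w. word_translation v x u * word_translation v x w) q) p"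
    unfolding pairing_shuffle[of "word_translation v x"] pairing_word_translation_shuffle[OF v] x
    by (simp add: word_translation_def)
  then show ?thesis
    by (simp add: pairing_left_scale pairing_left_scale')
qed

section \<open>Coefficients and support of the dual map on words\<close>

lemma polynomial_combination_word_dual:
  "polynomial_combination (\<lambda>v. word_dual v w)"
proof (induction w rule: measure_induct_rule[of length])
  case (less w)
  show ?case
  proof (cases "w = []")
    case False
    have "polynomial_combination (\<lambda>v. \<Sum>i\<in>UNIV. push_forward ((#) i)
       (\<Sum>k\<in>{1..length w}. scl (letter_image v i (take k w)) (word_dual v (drop k w))))"
      unfolding letter_image_def
      by (intro polynomial_combination_sum polynomial_combination_push_forward
          polynomial_combination_scl coordinate_polynomial.add coordinate_polynomial.const
          coordinate_polynomial.coord less.IH) auto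
    then show ?thesis using False by (subst word_dual.simps) simp
  qed (simp add: polynomial_combination_const)
qed

text \<open>A word \<open>z\<close> in the support arises by contracting the consecutive nonempty
  blocks of a partition of \<open>w\<close> to single letters, and the letter i can replace a block
  of at most \<kappa> i letters only. This is how the degree of \<open>v\<close> enters the Hoelder
  exponent.\<close>

lemma keys_word_dual:
  assumes \<kappa>: "\<And>i z. length z > \<kappa> i \<Longrightarrow> letter_image v i z = 0"
    and "z \<in> keys (word_dual v w)"
  shows "length z \<le> length w \<and> length w \<le> sum_list (map \<kappa> z)"
  using assms(2)
proof (induction w arbitrary: z rule: measure_induct_rule[of length])
  case (less w)
  show ?case
  proof (cases "w = []")
    case True
    then show ?thesis using less.prems by simp
  next
    case False
    with less.prems have "z \<in> keys (\<Sum>i\<in>UNIV. push_forward ((#) i)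
        (\<Sum>k\<in>{1..length w}. scl (letter_image v i (take k w)) (word_dual v (drop k w))))"
      by (simp only: word_dual.simps[of v w] if_False)
    then obtain i where "z \<in> keys (push_forward ((#) i)
        (\<Sum>k\<in>{1..length w}. scl (letter_image v i (take k w)) (word_dual v (drop k w))))"
      by (rule in_keys_sumE)
    then obtain z' where "z' \<in>
        keys (\<Sum>k\<in>{1..length w}. scl (letter_image v i (take k w)) (word_dual v (drop k w)))"
      and z: "z = i # z'"
      by (rule in_keys_push_forwardE)
    from this(1) obtain k where "k \<in> {1..length w}" and
      "z' \<in> keys (scl (letter_image v i (take k w)) (word_dual v (drop k w)))"
      by (rule in_keys_sumE)
    then have k: "1 \<le> k" "k \<le> length w" and
      "z' \<in> keys (scl (letter_image v i (take k w)) (word_dual v (drop k w)))"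
      by simp_all
    then have nz: "letter_image v i (take k w) \<noteq> 0" and "z' \<in> keys (word_dual v (drop k w))"
      by (auto simp: in_keys_iff)
    then have "length z' \<le> length (drop k w) \<and> length (drop k w) \<le> sum_list (map \<kappa> z')"
      using less.IH[of "drop k w" z'] k by simp
    moreover have "k \<le> \<kappa> i"
      using \<kappa>[of i "take k w"] nz k by (auto simp: not_less[symmetric])
    ultimately show ?thesis using k z by auto
  qed
qed

section \<open>The Connes--Kreimer coproduct\<close>

lemma forest_coproduct_simps [simp]:
  "forest_coproduct {#} = 1"
  "forest_coproduct (add_mset t F) = tree_coproduct t * forest_coproduct F"
  "forest_coproduct (F + G) = forest_coproduct F * forest_coproduct G"
  by (simp_all add: forest_coproduct_def)

text \<open>The cuts that leave a nonempty trunk.\<close>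

primrec tree_cuts :: "'l rtree \<Rightarrow> ('l forest \<times> 'l forest \<Rightarrow>\<^sub>0 real)" where
  "tree_cuts (Node i F) = push_forward (\<lambda>(a, b). (a, {#Node i b#})) (forest_coproduct F)"

lemma tree_coproduct_eq: "tree_coproduct t = single ({#t#}, {#}) 1 + tree_cuts t"
  by (cases t) (simp add: forest_coproduct_def)

declare tree_coproduct.simps [simp del]

lemma forest_labels_simps [simp]:
  "forest_labels {#} = {#}"
  "forest_labels (add_mset t F) = tree_labels t + forest_labels F"
  "forest_labels (F + G) = forest_labels F + forest_labels G"
  by (simp_all add: forest_labels_def)

declare tree_labels.simps [simp del]

lemma tree_labels_Node [simp]: "tree_labels (Node i F) = add_mset i (forest_labels F)"
  by (simp add: forest_labels_def tree_labels.simps)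

lemma tree_labels_nonempty [simp]: "tree_labels t \<noteq> {#}"
  by (cases t) simp

lemma forest_size_simps [simp]:
  "forest_size {#} = 0"
  "forest_size (add_mset t F) = size (tree_labels t) + forest_size F"
  "forest_size (F + G) = forest_size F + forest_size G"
  by (simp_all add: forest_size_def)

lemma forest_size_eq_0_iff [simp]: "forest_size F = 0 \<longleftrightarrow> F = {#}"
  by (cases F) auto

text \<open>Conditional on the trees of \<open>F\<close> because it is applied inside the induction
  over trees. Tracking the multiset of labels yields the gradings by \<open>forest_size\<close> and
  by \<open>forest_zeros\<close> at once.\<close>

lemma keys_forest_coproduct_aux:
  assumes "\<And>t a b. t \<in># F \<Longrightarrow> (a, b) \<in> keys (tree_coproduct t) \<Longrightarrow>
    forest_labels a + forest_labels b = tree_labels t"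
    and "(a, b) \<in> keys (forest_coproduct F)"
  shows "forest_labels a + forest_labels b = forest_labels F"
  using assms
proof (induction F arbitrary: a b)
  case (add t F)
  from add.prems(2) obtain a1 b1 a2 b2 where
    1: "(a1, b1) \<in> keys (tree_coproduct t)" and 2: "(a2, b2) \<in> keys (forest_coproduct F)"
    and ab: "a = a1 + a2" "b = b1 + b2"
    by (auto elim: in_keys_multE)
  have "forest_labels a1 + forest_labels b1 = tree_labels t"
    using add.prems(1)[of t] 1 by simp
  moreover have "forest_labels a2 + forest_labels b2 = forest_labels F"
    by (rule add.IH[OF _ 2]) (use add.prems(1) in auto)
  ultimately show ?case
    unfolding ab by (simp add: add_ac)
qed (simp add: zero_prod_def)

lemma keys_tree_coproduct:
  "(a, b) \<in> keys (tree_coproduct t) \<Longrightarrow> forest_labels a + forest_labels b = tree_labels t"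
proof (induction t arbitrary: a b)
  case (Node i F)
  from Node.prems consider "(a, b) = ({#Node i F#}, {#})" | "(a, b) \<in> keys (tree_cuts (Node i F))"
    unfolding tree_coproduct_eq using keys_add[of "single ({#Node i F#}, {#}) (1::real)"] by fastforce
  then show ?case
  proof cases
    case 2
    then obtain a' b' where "(a', b') \<in> keys (forest_coproduct F)" "a = a'" "b = {#Node i b'#}"
      unfolding tree_cuts.simps by (auto elim: in_keys_push_forwardE)
    then show ?thesis
      using keys_forest_coproduct_aux[of F a' b'] Node.IH by simp
  qed simp
qed

lemma keys_forest_coproduct:
  "(a, b) \<in> keys (forest_coproduct F) \<Longrightarrow> forest_labels a + forest_labels b = forest_labels F"
  using keys_forest_coproduct_aux keys_tree_coproduct by blast

lemma keys_tree_cuts: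
  assumes "(a, b) \<in> keys (tree_cuts t)"
  obtains r where "b = {#r#}" "forest_labels a + tree_labels r = tree_labels t"
proof (cases t)
  case (Node i F)
  with assms obtain b' where "(a, b') \<in> keys (forest_coproduct F)" "b = {#Node i b'#}"
    by (auto elim: in_keys_push_forwardE)
  then show ?thesis
    using that[of "Node i b'"] keys_forest_coproduct[of a b' F] Node by simp
qed

lemma lin_forest_coproduct:
  fixes g :: "'l forest \<times> 'l forest \<Rightarrow> ('c::comm_monoid_add \<Rightarrow>\<^sub>0 real)"
  assumes "g 0 = 1" "\<And>a b. g (a + b) = g a * g b"
  shows "lin g (forest_coproduct F) = prod_mset (image_mset (\<lambda>t. lin g (tree_coproduct t)) F)"
proof (induction F)
  case empty
  have "lin g (single 0 1) = 1" by (simp only: lin_single assms(1)) simp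
  then show ?case by simp
qed (simp add: lin_mult[of g, OF assms(2)])

text \<open>Applying the counit to the branches is multiplicative and commutes with grafting the
  trunk onto a root, so the identity passes from the branches of a node to the tree.\<close>

lemma counit_left:
  "lin (\<lambda>(a, b). if a = {#} then single b 1 else 0) (forest_coproduct F) = single F 1"
    (is "lin ?g _ = _")
proof -
  have g: "?g 0 = 1" "?g (a + b) = ?g a * ?g b" for a b :: "'a forest \<times> 'a forest"
    by (auto simp: zero_prod_def plus_prod_def mult_single case_prod_unfold)
  have prod: "prod_mset (image_mset (\<lambda>t. single {#t#} (1::real)) F) = single F 1" for F :: "'a forest"
    by (induction F) (simp_all add: mult_single)
  have "lin ?g (tree_coproduct t) = single {#t#} 1" for t :: "'a rtree"
  proof (induction t)
    case (Node i F)
    have "lin ?g (forest_coproduct F) = prod_mset (image_mset (\<lambda>t. single {#t#} 1) F)"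
      unfolding lin_forest_coproduct[of ?g, OF g]
      by (intro arg_cong[of _ _ prod_mset] image_mset_cong) (rule Node)
    then have *: "lin ?g (forest_coproduct F) = single F 1" by (simp only: prod)
    have "lin ?g (tree_coproduct (Node i F)) =
        lin (\<lambda>k. push_forward (\<lambda>b. {#Node i b#}) (?g k)) (forest_coproduct F)"
      by (simp add: tree_coproduct_eq lin_add lin_push_forward)
         (intro lin_cong, auto simp: push_forward_simps)
    also have "\<dots> = single {#Node i F#} 1"
      unfolding push_forward_lin_right[symmetric] * by (simp add: push_forward_simps)
    finally show ?case .
  qed
  then show ?thesis
    unfolding lin_forest_coproduct[of ?g, OF g] by (simp only: prod)
qed

text \<open>The cuts in \<open>tree_cuts\<close> have a nonempty trunk, so only the full cut of each
  tree survives.\<close>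

lemma counit_right:
  "lin (\<lambda>(a, b). if b = {#} then single a 1 else 0) (forest_coproduct F) = single F 1"
    (is "lin ?g _ = _")
proof -
  have g: "?g 0 = 1" "?g (a + b) = ?g a * ?g b" for a b :: "'a forest \<times> 'a forest"
    by (auto simp: zero_prod_def plus_prod_def mult_single case_prod_unfold)
  have "lin ?g (tree_coproduct t) = single {#t#} 1" for t :: "'a rtree"
    by (cases t) (simp add: tree_coproduct_eq lin_add lin_push_forward case_prod_unfold)
  moreover have "prod_mset (image_mset (\<lambda>t. single {#t#} (1::real)) F) = single F 1"
    by (induction F) (simp_all add: mult_single)
  ultimately show ?thesis
    unfolding lin_forest_coproduct[of ?g, OF g] by simp
qed

lemma gl_mult_one_left: "gl_mult (basis_series {#}) y = y"
proof
  fix F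
  have "gl_mult (basis_series {#}) y F =
      pairing (\<lambda>k. pairing y (case k of (a, b) \<Rightarrow> if a = {#} then single b 1 else 0)) (forest_coproduct F)"
    unfolding gl_mult_def by (rule pairing_cong) (auto simp: basis_series_def)
  then show "gl_mult (basis_series {#}) y F = y F"
    unfolding pairing_lin[symmetric] counit_left by simp
qed

lemma gl_mult_one_right: "gl_mult x (basis_series {#}) = x"
proof
  fix F
  have "gl_mult x (basis_series {#}) F =
      pairing (\<lambda>k. pairing x (case k of (a, b) \<Rightarrow> if b = {#} then single a 1 else 0)) (forest_coproduct F)"
    unfolding gl_mult_def by (rule pairing_cong) (auto simp: basis_series_def)
  then show "gl_mult x (basis_series {#}) F = x F"
    unfolding pairing_lin[symmetric] counit_right by simp
qed

text \<open>Finiteness alternates: trees with at most n nodes give forests with at most n nodes, and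
  adding a root to these gives the trees with at most n + 1 nodes.\<close>

lemma finite_trees: "finite {t :: 'l::finite rtree. size (tree_labels t) \<le> n}"
  and finite_forests: "finite {F :: 'l::finite forest. forest_size F \<le> n}"
proof -
  have forests: "finite {F :: 'l forest. forest_size F \<le> n}"
    if "finite {t :: 'l rtree. size (tree_labels t) \<le> n}" for n
  proof -
    let ?A = "{t :: 'l rtree. size (tree_labels t) \<le> n}"
    have "F \<in> mset ` {ts. set ts \<subseteq> ?A \<and> length ts \<le> n}" if "forest_size F \<le> n" for F :: "'l forest"
    proof -
      obtain ts where ts: "mset ts = F" by (metis ex_mset)
      have "size F \<le> forest_size F" for F :: "'l forest"
      proof (induction F)
        case (add t F)
        have "0 < size (tree_labels t)" by (simp add: nonempty_has_size[symmetric])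
        with add show ?case by simp
      qed simp
      then have "length ts \<le> n" using that ts by (metis order_trans size_mset)
      moreover have "size (tree_labels t) \<le> n" if "t \<in> set ts" for t
      proof -
        have "t \<in># F" using that ts by auto
        then obtain G where "F = add_mset t G" by (metis mset_add)
        then show ?thesis using \<open>forest_size F \<le> n\<close> by simp
      qed
      ultimately show ?thesis using ts by auto
    qed
    then have "{F :: 'l forest. forest_size F \<le> n} \<subseteq> mset ` {ts. set ts \<subseteq> ?A \<and> length ts \<le> n}"
      by auto
    then show ?thesis
      by (rule finite_subset[OF _ finite_imageI[OF finite_lists_length_le[OF that]]])
  qed
  have trees: "finite {t :: 'l rtree. size (tree_labels t) \<le> n}" for n
  proof (induction n)
    case 0
    then show ?case by simp
  next
    case (Suc n)
    have "{t :: 'l rtree. size (tree_labels t) \<le> Suc n} \<subseteq>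
        (\<lambda>(i, F). Node i F) ` (UNIV \<times> {F. forest_size F \<le> n})"
    proof
      fix t :: "'l rtree" assume "t \<in> {t. size (tree_labels t) \<le> Suc n}"
      then show "t \<in> (\<lambda>(i, F). Node i F) ` (UNIV \<times> {F. forest_size F \<le> n})"
        by (cases t) (auto simp: forest_size_def)
    qed
    then show ?case
      by (rule finite_subset[OF _ finite_imageI[OF finite_cartesian_product[OF finite forests[OF Suc]]]])
  qed
  show "finite {t :: 'l rtree. size (tree_labels t) \<le> n}" by (rule trees)
  show "finite {F :: 'l forest. forest_size F \<le> n}" by (rule forests[OF trees])
qed

interpretation forest: graded_coalgebra forest_coproduct "{#} :: 'l::finite forest" forest_size gl_mult
proof
  fix x y :: "'l forest \<Rightarrow> real" and a b F :: "'l forest" and n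
  show "gl_mult x y F = pairing (\<lambda>(a, b). x a * y b) (forest_coproduct F)"
    by (simp add: gl_mult_def)
  show "(a, b) \<in> keys (forest_coproduct F) \<Longrightarrow> forest_size a + forest_size b = forest_size F"
    using keys_forest_coproduct[of a b F] unfolding forest_size_def by (metis size_union)
  show "finite {F :: 'l forest. forest_size F \<le> n}"
    by (rule finite_forests)
qed (simp_all add: gl_mult_one_left gl_mult_one_right)

text \<open>Both sides of coassociativity are multiplicative in \<open>F\<close>.\<close>

lemma coassociative:
  "lin (\<lambda>(a, b). push_forward (\<lambda>(a1, a2). (a1, a2, b)) (forest_coproduct a)) (forest_coproduct F) =
   lin (\<lambda>(a, b). push_forward (\<lambda>(b1, b2). (a, b1, b2)) (forest_coproduct b)) (forest_coproduct F)"
    (is "lin ?l _ = lin ?r _")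
proof -
  have l: "?l (a, b) = push_forward (\<lambda>(a1, a2). (a1, a2, {#})) (forest_coproduct a) * single ({#}, {#}, b) 1"
    for a b :: "'a forest"
    unfolding push_forward_times_single prod.case
    by (rule arg_cong2[where f = push_forward]) auto
  have r: "?r (a, b) = push_forward (\<lambda>(b1, b2). ({#}, b1, b2)) (forest_coproduct b) * single (a, {#}, {#}) 1"
    for a b :: "'a forest"
    unfolding push_forward_times_single prod.case
    by (rule arg_cong2[where f = push_forward]) auto
  have l0: "?l 0 = 1" and r0: "?r 0 = 1"
    by (simp_all only: zero_prod_def prod.case forest_coproduct_simps)
       (simp_all add: push_forward_one zero_prod_def)
  have l_mult: "?l (k + k') = ?l k * ?l k'" for k k' :: "'a forest \<times> 'a forest"
  proof -
    obtain a b a' b' where k: "k = (a, b)" "k' = (a', b')" by (cases k, cases k')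
    have "single ({#}, {#}, b + b') (1::real) =
        single ({#} :: 'a forest, {#} :: 'a forest, b) 1 * single ({#}, {#}, b') 1"
      by (simp add: mult_single)
    then show ?thesis
      unfolding k add_Pair l forest_coproduct_simps
      by (subst push_forward_mult) (auto simp: mult_ac)
  qed
  have r_mult: "?r (k + k') = ?r k * ?r k'" for k k' :: "'a forest \<times> 'a forest"
  proof -
    obtain a b a' b' where k: "k = (a, b)" "k' = (a', b')" by (cases k, cases k')
    have "single (a + a', {#}, {#}) (1::real) =
        single (a, {#} :: 'a forest, {#} :: 'a forest) 1 * single (a', {#}, {#}) 1"
      by (simp add: mult_single)
    then show ?thesis
      unfolding k add_Pair r forest_coproduct_simps
      by (subst push_forward_mult) (auto simp: mult_ac)
  qed
  have "lin ?l (tree_coproduct t) = lin ?r (tree_coproduct t)" for t :: "'a rtree"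
  proof (induction t)
    case (Node i F)
    let ?B = "\<lambda>(a, b, c). (a, b, {#Node i c#})"
    have IH: "lin ?l (forest_coproduct F) = lin ?r (forest_coproduct F)"
      unfolding lin_forest_coproduct[of ?l, OF l0 l_mult] lin_forest_coproduct[of ?r, OF r0 r_mult]
      by (intro arg_cong[of _ _ prod_mset] image_mset_cong) (rule Node)
    have "lin ?l (tree_coproduct (Node i F)) =
        push_forward (\<lambda>(a, b). (a, b, {#})) (tree_coproduct (Node i F)) +
        push_forward ?B (lin ?l (forest_coproduct F))"
      by (simp add: tree_coproduct_eq[of "Node i F"] lin_add lin_push_forward push_forward_lin_right
          case_prod_unfold push_forward_push_forward)
    moreover have "lin ?r (tree_coproduct (Node i F)) =
        push_forward (\<lambda>(a, b). (a, b, {#})) (tree_coproduct (Node i F)) +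
        push_forward ?B (lin ?r (forest_coproduct F))"
    proof -
      have "?r (a, {#Node i b#}) = single (a, {#Node i b#}, {#}) 1 + push_forward ?B (?r (a, b))"
        for a b :: "'a forest"
        by (simp add: tree_coproduct_eq[of "Node i b"] push_forward_simps push_forward_push_forward
            case_prod_unfold)
      then have "lin ?r (tree_cuts (Node i F)) =
          lin (\<lambda>(a, b). single (a, {#Node i b#}, {#}) 1 + push_forward ?B (?r (a, b))) (forest_coproduct F)"
        by (simp add: lin_push_forward case_prod_unfold)
      also have "\<dots> = push_forward (\<lambda>(a, b). (a, b, {#})) (tree_cuts (Node i F)) +
          push_forward ?B (lin ?r (forest_coproduct F))"
        by (simp add: push_forward_lin_right push_forward_push_forward case_prod_unfold
            lin_left_add push_forward_lin[of "\<lambda>p. (fst p, {#Node i (snd p)#}, {#})"])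
      moreover have "?r ({#Node i F#}, {#}) = single ({#Node i F#}, {#}, {#}) 1"
        by (simp add: push_forward_unit zero_prod_def)
      ultimately show ?thesis
        by (simp add: tree_coproduct_eq[of "Node i F"] lin_add push_forward_simps add.assoc)
    qed
    ultimately show ?case using IH by simp
  qed
  then show ?thesis
    unfolding lin_forest_coproduct[of ?l, OF l0 l_mult] lin_forest_coproduct[of ?r, OF r0 r_mult]
    by simp
qed

lemma gl_mult_assoc: "gl_mult (gl_mult x y) z = gl_mult x (gl_mult y z)"
proof
  fix F
  let ?xyz = "\<lambda>(a, b, c). x a * y b * z c"
  have "gl_mult (gl_mult x y) z F = pairing ?xyz (lin (\<lambda>(a, b).
      push_forward (\<lambda>(a1, a2). (a1, a2, b)) (forest_coproduct a)) (forest_coproduct F))"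
    by (simp add: gl_mult_def pairing_lin case_prod_unfold pairing_push_forward
        pairing_left_scale'[symmetric])
  also have "\<dots> = gl_mult x (gl_mult y z) F"
    unfolding coassociative
    by (simp add: gl_mult_def pairing_lin case_prod_unfold pairing_push_forward mult.assoc
        pairing_left_scale[symmetric])
  finally show "gl_mult (gl_mult x y) z F = gl_mult x (gl_mult y z) F" .
qed

section \<open>Translations of forests\<close>

text \<open>Encoded as the product of the two embedded factors in the algebra of the tensor square,
  so that bilinearity and \<open>tensor_mult\<close> follow from its ring laws.\<close>

definition tensor :: "('l forest \<Rightarrow>\<^sub>0 real) \<Rightarrow> ('l forest \<Rightarrow>\<^sub>0 real) \<Rightarrow> ('l forest \<times> 'l forest \<Rightarrow>\<^sub>0 real)" where
  "tensor p q = push_forward (\<lambda>a. (a, {#})) p * push_forward (\<lambda>b. ({#}, b)) q"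

definition graft :: "'l \<Rightarrow> ('l forest \<Rightarrow>\<^sub>0 real) \<Rightarrow> ('l forest \<Rightarrow>\<^sub>0 real)" where
  "graft i p = push_forward (\<lambda>a. {#Node i a#}) p"

lemma tensor_simps:
  "tensor (p + p') q = tensor p q + tensor p' q"
  "tensor p (q + q') = tensor p q + tensor p q'"
  "tensor (scl c p) q = scl c (tensor p q)"
  "tensor p (scl c q) = scl c (tensor p q)"
  "tensor p (\<Sum>i\<in>A. f i) = (\<Sum>i\<in>A. tensor p (f i))"
  "tensor 0 q = 0" "tensor p 0 = 0"
  "tensor (single a 1) (single b 1) = single (a, b) 1"
  by (simp_all add: tensor_def push_forward_simps distrib_left distrib_right scl_mult
      sum_distrib_left mult_single)

lemma tensor_one_right: "tensor p 1 = push_forward (\<lambda>a. (a, {#})) p"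
  by (simp add: tensor_def push_forward_one zero_prod_def)

lemma tensor_mult: "tensor (p * p') (q * q') = tensor p q * tensor p' q'"
  unfolding tensor_def
  by (subst (1 2) push_forward_mult) (auto simp: mult_ac)

lemma lin_tensor_right: "lin (\<lambda>k. tensor p (g k)) q = tensor p (lin g q)"
  by (induction q rule: poly_mapping_linear_induct) (simp_all add: lin_add tensor_simps)

lemma push_forward_tensor:
  "push_forward (\<lambda>(a, b). (a, {#Node i b#})) (tensor p q) = tensor p (graft i q)"
  unfolding graft_def
proof (induction p rule: poly_mapping_linear_induct)
  case (add a c p)
  have "push_forward (\<lambda>(a, b). (a, {#Node i b#})) (tensor (single a c) q) =
      tensor (single a c) (push_forward (\<lambda>a. {#Node i a#}) q)"
    by (induction q rule: poly_mapping_linear_induct)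
       (simp_all add: push_forward_simps tensor_simps, simp add: tensor_def push_forward_simps mult_single)
  with add show ?case by (simp add: tensor_simps push_forward_simps)
qed (simp add: tensor_simps push_forward_simps)

lemma pairing_tensor:
  "pairing (\<lambda>(a, b). x a * y b) (tensor p q) = pairing x p * pairing y q"
proof (induction p rule: poly_mapping_linear_induct)
  case (add a c p)
  have "pairing (\<lambda>(a, b). x a * y b) (tensor (single a c) q) = pairing x (single a c) * pairing y q"
    by (induction q rule: poly_mapping_linear_induct)
       (simp_all add: pairing_add tensor_simps algebra_simps,
        simp add: tensor_def push_forward_simps mult_single)
  with add show ?case by (simp add: tensor_simps pairing_add algebra_simps)
qed (simp add: tensor_simps)

lemma graft_simps:
  "graft i 0 = 0" "graft i (p + q) = graft i p + graft i q"
  "graft i (single a c) = single {#Node i a#} c" "graft i (scl c p) = scl c (graft i p)"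
  by (simp_all add: graft_def push_forward_simps)

text \<open>Grafting onto a root is a Hochschild 1-cocycle; the recursive definition of the
  coproduct says this on basis elements.\<close>

lemma coproduct_graft:
  "lin forest_coproduct (graft i p) =
    tensor (graft i p) 1 + push_forward (\<lambda>(a, b). (a, {#Node i b#})) (lin forest_coproduct p)"
proof (induction p rule: poly_mapping_linear_induct)
  case (add F c p)
  have "lin forest_coproduct (graft i (single F c)) = tensor (graft i (single F c)) 1 +
      push_forward (\<lambda>(a, b). (a, {#Node i b#})) (lin forest_coproduct (single F c))"
    by (simp add: graft_simps tree_coproduct_eq scl_add_right tensor_one_right push_forward_simps)
  with add show ?case
    by (simp add: graft_simps lin_add tensor_simps push_forward_simps add_ac)
qed (simp_all add: graft_simps tensor_simps push_forward_simps)

definition bullet_image :: "('l \<Rightarrow> 'l forest \<Rightarrow> real) \<Rightarrow> 'l \<Rightarrow> 'l forest \<Rightarrow> real" where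
  "bullet_image v i = (\<lambda>F. basis_series {#bullet i#} F + v i F)"

text \<open>With these congruences the termination proof of \<open>tree_dual\<close> sees that
  recursive calls are made on branches of actual cuts only.\<close>

lemma lin_cong_strong [fundef_cong]:
  "p = q \<Longrightarrow> (\<And>k. k \<in> keys q \<Longrightarrow> g k = h k) \<Longrightarrow> lin g p = lin h q"
  using lin_cong by metis

lemma image_mset_cong_strong [fundef_cong]:
  "F = G \<Longrightarrow> (\<And>t. t \<in># G \<Longrightarrow> f t = g t) \<Longrightarrow> image_mset f F = image_mset g G"
  by (auto intro: image_mset_cong)

lemma member_size_tree_labels: "t \<in># F \<Longrightarrow> size (tree_labels t) \<le> forest_size F"
  by (induction F) auto

lemma tree_cuts_smaller:
  assumes "(a, b) \<in> keys (tree_cuts t)" "s \<in># a"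
  shows "size (tree_labels s) < size (tree_labels t)"
proof -
  obtain r where "forest_labels a + tree_labels r = tree_labels t"
    using assms(1) by (rule keys_tree_cuts)
  then have "forest_size a + size (tree_labels r) = size (tree_labels t)"
    unfolding forest_size_def by (metis size_union)
  moreover have "0 < size (tree_labels r)" by (simp add: nonempty_has_size[symmetric])
  ultimately show ?thesis using member_size_tree_labels[OF assms(2)] by linarith
qed

text \<open>The transpose of \<open>M\<^sub>v\<close> contracts disjoint subtrees to single nodes: the trunk of each cut is
  contracted to a node \<open>i\<close> with weight \<open>\<langle>\<bullet>\<^sub>i + v\<^sub>i, trunk\<rangle>\<close>, and the branches are treated
  recursively.\<close>

function tree_dual :: "('l::finite \<Rightarrow> 'l forest \<Rightarrow> real) \<Rightarrow> 'l rtree \<Rightarrow> ('l forest \<Rightarrow>\<^sub>0 real)" where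
  "tree_dual v t = lin (\<lambda>(a, b). \<Sum>i\<in>UNIV. scl (bullet_image v i b)
     (graft i (prod_mset (image_mset (\<lambda>s. tree_dual v s) a)))) (tree_cuts t)"
  by pat_completeness auto
termination
  by (relation "Wellfounded.measure (\<lambda>(v, t). size (tree_labels t))") (auto dest: tree_cuts_smaller)

declare tree_dual.simps [simp del]

definition forest_dual :: "('l::finite \<Rightarrow> 'l forest \<Rightarrow> real) \<Rightarrow> 'l forest \<Rightarrow> ('l forest \<Rightarrow>\<^sub>0 real)" where
  "forest_dual v F = prod_mset (image_mset (tree_dual v) F)"

definition forest_translation ::
    "('l::finite \<Rightarrow> 'l forest \<Rightarrow> real) \<Rightarrow> ('l forest \<Rightarrow> real) \<Rightarrow> 'l forest \<Rightarrow> real" where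
  "forest_translation v x = (\<lambda>F. pairing x (forest_dual v F))"

lemma forest_dual_simps [simp]:
  "forest_dual v {#} = 1"
  "forest_dual v (add_mset t F) = tree_dual v t * forest_dual v F"
  "forest_dual v (F + G) = forest_dual v F * forest_dual v G"
  by (simp_all add: forest_dual_def)

text \<open>The contribution of one cut of a tree, with branches \<open>a\<close> and trunk
  \<open>b\<close>.\<close>

definition contract :: "('l::finite \<Rightarrow> 'l forest \<Rightarrow> real) \<Rightarrow> 'l forest \<Rightarrow> 'l forest \<Rightarrow> ('l forest \<Rightarrow>\<^sub>0 real)" where
  "contract v a b = (\<Sum>i\<in>UNIV. scl (bullet_image v i b) (graft i (forest_dual v a)))"

lemma tree_dual_eq: "tree_dual v t = lin (\<lambda>(a, b). contract v a b) (tree_cuts t)"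
  unfolding contract_def forest_dual_def by (subst tree_dual.simps) simp

definition tree_family :: "('l \<Rightarrow> 'l forest \<Rightarrow> real) \<Rightarrow> bool" where
  "tree_family v \<longleftrightarrow> (\<forall>i. v i \<in> tree_series)"

lemma bullet_image_tree_series: "tree_family v \<Longrightarrow> bullet_image v i \<in> tree_series"
  unfolding tree_family_def tree_series_def bullet_image_def basis_series_def by auto

text \<open>The full cut of a tree leaves an empty trunk and so contributes nothing. It can be added
  to \<open>tree_cuts\<close> or removed from the coproduct freely, which is needed because
  coassociativity concerns the full coproduct.\<close>

lemma contract_empty: "tree_family v \<Longrightarrow> contract v a {#} = 0"
  using bullet_image_tree_series[of v] unfolding contract_def tree_series_def by simp

lemma coproduct_contract:
  assumes "lin forest_coproduct (forest_dual v a) =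
    lin (\<lambda>(a1, a2). tensor (forest_dual v a1) (forest_dual v a2)) (forest_coproduct a)"
  shows "lin forest_coproduct (contract v a b) = tensor (contract v a b) 1 +
    lin (\<lambda>(a1, a2). tensor (forest_dual v a1) (contract v a2 b)) (forest_coproduct a)"
proof -
  have "lin forest_coproduct (contract v a b) =
      (\<Sum>i\<in>UNIV. scl (bullet_image v i b) (tensor (graft i (forest_dual v a)) 1)) +
      (\<Sum>i\<in>UNIV. scl (bullet_image v i b) (push_forward (\<lambda>(a, b). (a, {#Node i b#}))
        (lin forest_coproduct (forest_dual v a))))"
    unfolding contract_def by (simp add: lin_sum lin_scl coproduct_graft scl_add_right sum.distrib)
  also have "(\<Sum>i\<in>UNIV. scl (bullet_image v i b) (tensor (graft i (forest_dual v a)) 1)) =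
      tensor (contract v a b) 1"
    by (simp add: contract_def tensor_one_right push_forward_simps)
  also have "(\<Sum>i\<in>UNIV. scl (bullet_image v i b) (push_forward (\<lambda>(a, b). (a, {#Node i b#}))
        (lin forest_coproduct (forest_dual v a)))) =
      lin (\<lambda>(a1, a2). tensor (forest_dual v a1) (contract v a2 b)) (forest_coproduct a)"
    unfolding assms contract_def
    by (simp add: push_forward_lin_right case_prod_unfold push_forward_tensor[unfolded case_prod_unfold]
        tensor_simps lin_left_sum lin_left_scl)
  finally show ?thesis .
qed

text \<open>A cut of a contracted tree amounts to a cut of the original one followed by a cut of its
  branches. Coassociativity regroups this as a cut followed by a cut of the trunk, and contracting
  the trunk along the second cut is \<open>forest_dual\<close> of the trunk.\<close>

lemma coproduct_forest_dual:
  assumes v: "tree_family v"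
  shows "lin forest_coproduct (forest_dual v F) =
    lin (\<lambda>(a, b). tensor (forest_dual v a) (forest_dual v b)) (forest_coproduct F)"
    (is "_ = lin ?T _")
proof -
  have T0: "?T 0 = 1"
    by (simp add: zero_prod_def tensor_one_right push_forward_one)
  have T_mult: "?T (k + k') = ?T k * ?T k'" for k k' :: "'a forest \<times> 'a forest"
    by (cases k; cases k') (simp add: tensor_mult)
  have forest: "lin forest_coproduct (forest_dual v F) = lin ?T (forest_coproduct F)"
    if "\<And>t. t \<in># F \<Longrightarrow> lin forest_coproduct (tree_dual v t) = lin ?T (tree_coproduct t)" for F
    using that
  proof (induction F)
    case empty
    have "lin forest_coproduct (single {#} 1) = 1" by (simp only: lin_single) simp
    moreover have "lin ?T (single 0 1) = 1" by (simp only: lin_single T0) simp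
    ultimately show ?case by simp
  next
    case (add t F)
    then show ?case
      by (simp add: lin_mult[of forest_coproduct] lin_mult[of ?T, OF T_mult])
  qed
  have tree: "lin forest_coproduct (tree_dual v t) = lin ?T (tree_coproduct t)" for t
  proof (induction t rule: measure_induct_rule[of "\<lambda>t. size (tree_labels t)"])
    case (less t)
    let ?W = "\<lambda>(a1, a2, b). tensor (forest_dual v a1) (contract v a2 b)"
    have "lin forest_coproduct (tree_dual v t) =
        lin (\<lambda>(a, b). lin forest_coproduct (contract v a b)) (tree_cuts t)"
      unfolding tree_dual_eq lin_lin by (simp add: case_prod_unfold)
    also have "\<dots> = lin (\<lambda>(a, b). tensor (contract v a b) 1 +
        lin (\<lambda>(a1, a2). ?W (a1, a2, b)) (forest_coproduct a)) (tree_cuts t)"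
    proof (rule lin_cong)
      fix k assume k: "k \<in> keys (tree_cuts t)"
      obtain a b where ab: "k = (a, b)" by (cases k)
      have "lin forest_coproduct (forest_dual v a) = lin ?T (forest_coproduct a)"
        using k unfolding ab by (intro forest less tree_cuts_smaller)
      then show "(case k of (a, b) \<Rightarrow> lin forest_coproduct (contract v a b)) =
          (case k of (a, b) \<Rightarrow> tensor (contract v a b) 1 +
            lin (\<lambda>(a1, a2). ?W (a1, a2, b)) (forest_coproduct a))"
        unfolding ab using coproduct_contract[of v a b] by simp
    qed
    also have "\<dots> = tensor (tree_dual v t) 1 +
        lin (\<lambda>(a, b). lin (\<lambda>(a1, a2). ?W (a1, a2, b)) (forest_coproduct a)) (tree_cuts t)"
      by (simp add: tree_dual_eq tensor_one_right push_forward_lin_right case_prod_unfold lin_left_add)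
    also have "lin (\<lambda>(a, b). lin (\<lambda>(a1, a2). ?W (a1, a2, b)) (forest_coproduct a)) (tree_cuts t) =
        lin (\<lambda>(a, b). lin (\<lambda>(a1, a2). ?W (a1, a2, b)) (forest_coproduct a)) (forest_coproduct {#t#})"
      by (simp add: tree_coproduct_eq lin_add contract_empty[OF v] tensor_simps case_prod_unfold)
    also have "\<dots> = lin ?W (lin (\<lambda>(a, b).
        push_forward (\<lambda>(a1, a2). (a1, a2, b)) (forest_coproduct a)) (forest_coproduct {#t#}))"
      by (simp add: lin_lin lin_push_forward case_prod_unfold)
    also have "\<dots> = lin (\<lambda>(a, b). tensor (forest_dual v a)
        (lin (\<lambda>(b1, b2). contract v b1 b2) (forest_coproduct b))) (forest_coproduct {#t#})"
      unfolding coassociative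
      by (simp add: lin_lin lin_push_forward case_prod_unfold lin_tensor_right)
    also have "\<dots> = lin (\<lambda>(a, b). tensor (forest_dual v a)
        (lin (\<lambda>(b1, b2). contract v b1 b2) (forest_coproduct b))) (tree_cuts t)"
    proof -
      have "lin (\<lambda>(b1, b2). contract v b1 b2) (single (0, 0) 1) = 0"
        by (simp add: contract_empty[OF v])
      then have "lin (\<lambda>(b1, b2). contract v b1 b2) (1 :: 'a forest \<times> 'a forest \<Rightarrow>\<^sub>0 real) = 0"
        unfolding zero_prod_def[symmetric] by simp
      then show ?thesis by (simp add: tree_coproduct_eq lin_add tensor_simps)
    qed
    also have "\<dots> = lin ?T (tree_cuts t)"
    proof (rule lin_cong)
      fix k assume k: "k \<in> keys (tree_cuts t)"
      obtain a b where ab: "k = (a, b)" by (cases k)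
      from k obtain r where b: "b = {#r#}" unfolding ab by (rule keys_tree_cuts)
      have "lin (\<lambda>(b1, b2). contract v b1 b2) (forest_coproduct b) = forest_dual v b"
        by (simp add: b tree_coproduct_eq lin_add contract_empty[OF v] tree_dual_eq)
      then show "(case k of (a, b) \<Rightarrow> tensor (forest_dual v a)
          (lin (\<lambda>(b1, b2). contract v b1 b2) (forest_coproduct b))) = ?T k"
        by (simp add: ab)
    qed
    finally show ?case
      by (simp add: tree_coproduct_eq lin_add)
  qed
  show ?thesis by (rule forest[OF tree])
qed

lemma forest_translation_gl_mult:
  assumes "tree_family v"
  shows "forest_translation v (gl_mult x y) = gl_mult (forest_translation v x) (forest_translation v y)"
proof
  fix F
  have "forest_translation v (gl_mult x y) F =
      pairing (\<lambda>(a, b). x a * y b) (lin forest_coproduct (forest_dual v F))"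
    unfolding forest_translation_def gl_mult_def pairing_lin ..
  also have "\<dots> = gl_mult (forest_translation v x) (forest_translation v y) F"
    unfolding coproduct_forest_dual[OF assms] pairing_lin
    by (simp add: gl_mult_def forest_translation_def case_prod_unfold
        pairing_tensor[unfolded case_prod_unfold])
  finally show "forest_translation v (gl_mult x y) F =
      gl_mult (forest_translation v x) (forest_translation v y) F" .
qed

section \<open>Support and coefficients of the dual map on forests\<close>

lemma in_keys_tree_dualE:
  assumes "z \<in> keys (tree_dual v t)"
  obtains a b i a' where "(a, b) \<in> keys (tree_cuts t)" "bullet_image v i b \<noteq> 0"
    "a' \<in> keys (forest_dual v a)" "z = {#Node i a'#}"
proof -
  from assms obtain k where k: "k \<in> keys (tree_cuts t)"
    and "z \<in> keys (case k of (a, b) \<Rightarrow> contract v a b)"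
    unfolding tree_dual_eq by (rule in_keys_linE)
  then have "z \<in> keys (contract v (fst k) (snd k))" by (simp add: case_prod_unfold)
  then obtain i where "z \<in> keys (scl (bullet_image v i (snd k)) (graft i (forest_dual v (fst k))))"
    unfolding contract_def by (rule in_keys_sumE)
  then have nz: "bullet_image v i (snd k) \<noteq> 0" and "z \<in> keys (graft i (forest_dual v (fst k)))"
    by (auto simp: in_keys_iff)
  from this(2) obtain a' where "a' \<in> keys (forest_dual v (fst k))" "z = {#Node i a'#}"
    unfolding graft_def by (rule in_keys_push_forwardE)
  with k nz show ?thesis by (intro that[of "fst k" "snd k" i a']) simp_all
qed

text \<open>Each tree is contracted to single trees, so the number of trees is kept. Hence the
  translation fixes the unit and preserves tree series.\<close>

lemma size_forest_dual:
  "z \<in> keys (forest_dual v F) \<Longrightarrow> size z = size F"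
proof (induction F arbitrary: z)
  case (add t F)
  then obtain a b where a: "a \<in> keys (tree_dual v t)" and b: "b \<in> keys (forest_dual v F)"
    and z: "z = a + b"
    by (auto elim: in_keys_multE)
  from a have "size a = 1" by (auto elim: in_keys_tree_dualE)
  then show ?case using add.IH[OF b] z by simp
qed simp

lemma keys_forest_dual_aux:
  assumes "\<And>t a. t \<in># F \<Longrightarrow> a \<in> keys (tree_dual v t) \<Longrightarrow>
      forest_size a \<le> size (tree_labels t) \<and>
      size (tree_labels t) \<le> sum_mset (image_mset \<kappa> (forest_labels a))"
    and "z \<in> keys (forest_dual v F)"
  shows "forest_size z \<le> forest_size F \<and> forest_size F \<le> sum_mset (image_mset \<kappa> (forest_labels z))"
  using assms
proof (induction F arbitrary: z)
  case (add t F)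
  from add.prems(2) obtain a b where a: "a \<in> keys (tree_dual v t)" and b: "b \<in> keys (forest_dual v F)"
    and z: "z = a + b"
    by (auto elim: in_keys_multE)
  have "forest_size b \<le> forest_size F \<and> forest_size F \<le> sum_mset (image_mset \<kappa> (forest_labels b))"
    by (rule add.IH[OF _ b]) (use add.prems(1) in auto)
  moreover have "forest_size a \<le> size (tree_labels t) \<and>
      size (tree_labels t) \<le> sum_mset (image_mset \<kappa> (forest_labels a))"
    using add.prems(1)[OF _ a] by simp
  ultimately show ?case by (simp add: z)
qed simp

text \<open>As for words: a node with label i replaces a nonempty subtree of at most \<kappa> i
  nodes.\<close>

lemma keys_forest_dual:
  assumes \<kappa>: "\<And>i F. forest_size F > \<kappa> i \<Longrightarrow> bullet_image v i F = 0"
    and z: "z \<in> keys (forest_dual v F)"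
  shows "forest_size z \<le> forest_size F \<and> forest_size F \<le> sum_mset (image_mset \<kappa> (forest_labels z))"
proof (rule keys_forest_dual_aux[OF _ z])
  show "forest_size a \<le> size (tree_labels t) \<and>
      size (tree_labels t) \<le> sum_mset (image_mset \<kappa> (forest_labels a))"
    if "a \<in> keys (tree_dual v t)" for t a
    using that
  proof (induction t arbitrary: a rule: measure_induct_rule[of "\<lambda>t. size (tree_labels t)"])
    case (less t)
    from less.prems obtain c d i a' where cd: "(c, d) \<in> keys (tree_cuts t)"
      and nz: "bullet_image v i d \<noteq> 0"
      and a': "a' \<in> keys (forest_dual v c)" and a: "a = {#Node i a'#}"
      by (rule in_keys_tree_dualE)
    from cd obtain r where d: "d = {#r#}" and r: "forest_labels c + tree_labels r = tree_labels t"
      by (rule keys_tree_cuts)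
    have "forest_size a' \<le> forest_size c \<and>
        forest_size c \<le> sum_mset (image_mset \<kappa> (forest_labels a'))"
      by (rule keys_forest_dual_aux[OF _ a']) (use less.IH tree_cuts_smaller[OF cd] in blast)
    moreover have "forest_size c + size (tree_labels r) = size (tree_labels t)"
      using arg_cong[OF r, of size] by (simp add: forest_size_def)
    moreover have "0 < size (tree_labels r)" by (simp add: nonempty_has_size[symmetric])
    moreover have "size (tree_labels r) \<le> \<kappa> i"
      using \<kappa>[of i d] nz d by (auto simp: not_less[symmetric])
    ultimately show ?case by (simp add: a forest_size_def)
  qed
qed

lemma polynomial_combination_tree_dual:
  "polynomial_combination (\<lambda>v. tree_dual v t)"
proof (induction t rule: measure_induct_rule[of "\<lambda>t. size (tree_labels t)"])
  case (less t)
  have forest: "polynomial_combination (\<lambda>v. forest_dual v F)"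
    if "\<And>s. s \<in># F \<Longrightarrow> size (tree_labels s) < size (tree_labels t)" for F :: "'a forest"
    using that
    by (induction F) (simp_all add: polynomial_combination_const polynomial_combination_mult less.IH)
  have "polynomial_combination (\<lambda>v. \<Sum>k\<in>keys (tree_cuts t). scl (lookup (tree_cuts t) k)
      (\<Sum>i\<in>UNIV. scl (basis_series {#bullet i#} (snd k) + v i (snd k)) (graft i (forest_dual v (fst k)))))"
    unfolding graft_def
    by (intro polynomial_combination_sum polynomial_combination_scl polynomial_combination_push_forward
        coordinate_polynomial.add coordinate_polynomial.const coordinate_polynomial.coord forest)
       (auto intro: tree_cuts_smaller)
  then show ?case
    unfolding tree_dual_eq lin_def contract_def bullet_image_def case_prod_unfold .
qed

lemma polynomial_combination_forest_dual:
  "polynomial_combination (\<lambda>v. forest_dual v F)"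
  by (induction F) (simp_all add: polynomial_combination_const polynomial_combination_mult
      polynomial_combination_tree_dual)

section \<open>The defining properties of the branched translation\<close>

lemma series_linear_forest_translation: "series_linear (forest_translation v)"
  unfolding forest_translation_def[abs_def] by (rule series_linear_pairing)

lemma forest_translation_empty [simp]: "forest_translation v x {#} = x {#}"
  by (simp add: forest_translation_def pairing_one)

lemma forest_translation_one: "forest_translation v (basis_series {#}) = basis_series {#}"
proof
  fix F
  show "forest_translation v (basis_series {#}) F = basis_series {#} F"
  proof (cases "F = {#}")
    case False
    then have "{#} \<notin> keys (forest_dual v F)" using size_forest_dual[of "{#}" v F] by auto
    then show ?thesis
      using False by (simp add: forest_translation_def pairing_basis in_keys_iff)
        (simp add: basis_series_def)
  qed simp
qed

lemma forest_translation_tree_series: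
  assumes "x \<in> tree_series"
  shows "forest_translation v x \<in> tree_series"
proof -
  have "pairing x (forest_dual v F) = 0" if "size F \<noteq> 1" for F
  proof -
    have "pairing x (forest_dual v F) = pairing (\<lambda>_. 0) (forest_dual v F)"
    proof (rule pairing_cong)
      fix z assume "z \<in> keys (forest_dual v F)"
      then have "size z \<noteq> 1" using size_forest_dual[of z v F] that by simp
      then show "x z = 0" using assms by (simp add: tree_series_def)
    qed
    then show ?thesis by simp
  qed
  then show ?thesis by (simp add: tree_series_def forest_translation_def)
qed

text \<open>The single node i arises only from cuts without branches, and the weighted sum over
  these cuts is \<open>gl_mult\<close> with the unit on the left.\<close>

lemma forest_translation_bullet:
  assumes v: "tree_family v"
  shows "forest_translation v (basis_series {#bullet i#}) = bullet_image v i"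
proof
  fix F
  show "forest_translation v (basis_series {#bullet i#}) F = bullet_image v i F"
  proof (cases "size F = 1")
    case False
    have "basis_series {#bullet i#} \<in> tree_series"
      by (auto simp: tree_series_def basis_series_def)
    from forest_translation_tree_series[OF this, of v] bullet_image_tree_series[OF v, of i]
    show ?thesis using False by (simp add: tree_series_def)
  next
    case True
    then obtain t where F: "F = {#t#}" using size_1_singleton_mset by blast
    have lookup_graft: "lookup (graft j p) {#bullet i#} = (if i = j then lookup p {#} else 0)"
      for j and p :: "'a forest \<Rightarrow>\<^sub>0 real"
    proof (induction p rule: poly_mapping_linear_induct)
      case (add k c p)
      have "lookup (single {#Node j k#} c) {#bullet i#} = (if i = j then lookup (single k c) {#} else 0)"
        by (simp add: lookup_single when_def bullet_def)
      with add show ?case by (simp add: graft_simps lookup_add)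
    qed (simp add: graft_simps)
    have lookup_dual: "lookup (forest_dual v a) {#} = (if a = {#} then 1 else 0)" for a
      using size_forest_dual[of "{#}" v a] by (auto simp: in_keys_iff)
    have "lookup (contract v a b) {#bullet i#} = (if a = {#} then bullet_image v i b else 0)" for a b
      by (simp add: contract_def lookup_sum lookup_graft lookup_dual if_distrib[of "(*) _"] sum.delta
          cong: if_cong)
    then have "pairing (basis_series {#bullet i#}) (tree_dual v t) =
        pairing (\<lambda>(a, b). basis_series {#} a * bullet_image v i b) (tree_cuts t)"
      unfolding tree_dual_eq pairing_lin pairing_basis
      by (intro pairing_cong) (auto simp: basis_series_def)
    also have "\<dots> = gl_mult (basis_series {#}) (bullet_image v i) {#t#}"
      by (simp add: gl_mult_def tree_coproduct_eq pairing_add basis_series_def)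
    finally show ?thesis by (simp add: F forest_translation_def forest.mult_one_left)
  qed
qed

section \<open>The pre-Lie product\<close>

text \<open>On the terms with a single branch, multiplicativity of the coproduct becomes a Leibniz rule,
  which is the recursion of \<open>edge_cuts\<close>.\<close>

definition branch_part :: "nat \<Rightarrow> ('l forest \<times> 'l forest \<Rightarrow>\<^sub>0 real) \<Rightarrow> ('l forest \<times> 'l forest \<Rightarrow>\<^sub>0 real)" where
  "branch_part n p = lin (\<lambda>(a, b). if size a = n then single (a, b) 1 else 0) p"

lemma branch_part_simps:
  "branch_part n 0 = 0"
  "branch_part n (p + q) = branch_part n p + branch_part n q"
  "branch_part n (single (a, b) c) = (if size a = n then single (a, b) c else 0)"
  by (simp_all add: branch_part_def lin_add)

lemma branch_part_mult_single:
  "branch_part 0 (p * single (a, b) c) = branch_part 0 p * branch_part 0 (single (a, b) c)"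
  "branch_part 1 (p * single (a, b) c) =
     branch_part 1 p * branch_part 0 (single (a, b) c) + branch_part 0 p * branch_part 1 (single (a, b) c)"
proof -
  show "branch_part 0 (p * single (a, b) c) = branch_part 0 p * branch_part 0 (single (a, b) c)"
    by (induction p rule: poly_mapping_linear_induct)
       (auto simp: branch_part_simps distrib_right mult_single)
  show "branch_part 1 (p * single (a, b) c) =
     branch_part 1 p * branch_part 0 (single (a, b) c) + branch_part 0 p * branch_part 1 (single (a, b) c)"
    by (induction p rule: poly_mapping_linear_induct)
       (auto simp: branch_part_simps distrib_right distrib_left mult_single add_is_1)
qed

lemma branch_part_mult:
  "branch_part 0 (p * q) = branch_part 0 p * branch_part 0 q"
  "branch_part 1 (p * q) = branch_part 1 p * branch_part 0 q + branch_part 0 p * branch_part 1 q"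
proof -
  show "branch_part 0 (p * q) = branch_part 0 p * branch_part 0 q"
    by (induction q rule: poly_mapping_linear_induct)
       (auto simp: branch_part_simps(1,2) distrib_left branch_part_mult_single)
  show "branch_part 1 (p * q) = branch_part 1 p * branch_part 0 q + branch_part 0 p * branch_part 1 q"
    by (induction q rule: poly_mapping_linear_induct)
       (auto simp: branch_part_simps(1,2) distrib_left branch_part_mult_single[unfolded One_nat_def])
qed

lemma branch_part_trunk:
  "branch_part n (push_forward (\<lambda>(a, b). (a, f b)) p) = push_forward (\<lambda>(a, b). (a, f b)) (branch_part n p)"
  by (induction p rule: poly_mapping_linear_induct)
     (auto simp: branch_part_simps push_forward_simps)

lemma one_forest_pair: "(1 :: 'a forest \<times> 'a forest \<Rightarrow>\<^sub>0 real) = single ({#}, {#}) 1"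
  unfolding single_one[symmetric] zero_prod_def ..

lemma branch_part_one:
  "branch_part 0 (1 :: 'a forest \<times> 'a forest \<Rightarrow>\<^sub>0 real) = 1"
  "branch_part 1 (1 :: 'a forest \<times> 'a forest \<Rightarrow>\<^sub>0 real) = 0"
proof -
  show "branch_part 0 (1 :: 'a forest \<times> 'a forest \<Rightarrow>\<^sub>0 real) = 1"
    "branch_part 1 (1 :: 'a forest \<times> 'a forest \<Rightarrow>\<^sub>0 real) = 0"
    unfolding one_forest_pair branch_part_simps by simp_all
qed

lemma branch_part_0_tree: "branch_part 0 (tree_coproduct t) = single ({#}, {#t#}) 1"
proof (induction t)
  case (Node i F)
  then have "branch_part 0 (forest_coproduct F) = single ({#}, F) 1"
  proof (induction F)
    case empty
    show ?case unfolding forest_coproduct_simps branch_part_one by (rule one_forest_pair)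
  qed (simp add: branch_part_mult mult_single)
  then show ?case
    by (simp add: tree_coproduct_eq branch_part_simps branch_part_trunk push_forward_simps)
qed

lemma branch_part_0_forest: "branch_part 0 (forest_coproduct F) = single ({#}, F) 1"
proof (induction F)
  case empty
  show ?case unfolding forest_coproduct_simps branch_part_one by (rule one_forest_pair)
qed (simp add: branch_part_mult branch_part_0_tree mult_single)

lemma branch_part_1_forest:
  "branch_part 1 (forest_coproduct F) =
    (\<Sum>t\<in>#F. branch_part 1 (tree_coproduct t) * single ({#}, F - {#t#}) 1)"
proof (induction F)
  case empty
  show ?case by (simp add: branch_part_one[unfolded One_nat_def])
next
  case (add s F)
  have *: "branch_part 1 (tree_coproduct t) * single ({#}, add_mset s F - {#t#}) 1 =
      single ({#}, {#s#}) 1 * (branch_part 1 (tree_coproduct t) * single ({#}, F - {#t#}) 1)"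
    if "t \<in># F" for t
  proof -
    have "add_mset s F - {#t#} = add_mset s (F - {#t#})"
      using diff_union_single_conv[OF that, of "{#s#}"] by simp
    then have "single ({#}, add_mset s F - {#t#}) 1 =
        single ({#} :: 'a forest, {#s#}) (1::real) * single ({#}, F - {#t#}) 1"
      by (simp add: mult_single)
    then show ?thesis by (simp only: mult.left_commute)
  qed
  have "(\<Sum>t\<in>#F. branch_part 1 (tree_coproduct t) * single ({#}, add_mset s F - {#t#}) 1) =
      single ({#}, {#s#}) 1 * (\<Sum>t\<in>#F. branch_part 1 (tree_coproduct t) * single ({#}, F - {#t#}) 1)"
    unfolding sum_mset_distrib_left
    by (intro arg_cong[of _ _ sum_mset] image_mset_cong) (rule *)
  then show ?case
    by (simp add: branch_part_mult[unfolded One_nat_def] branch_part_0_tree branch_part_0_forest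
        add.IH[unfolded One_nat_def])
qed

lemma push_forward_sum_mset: "push_forward g (\<Sum>t\<in>#F. f t) = (\<Sum>t\<in>#F. push_forward g (f t))"
  by (induction F) (simp_all add: push_forward_simps)

lemma branch_part_1_tree:
  "branch_part 1 (tree_coproduct t) =
    single ({#t#}, {#}) 1 + (\<Sum>(a, b)\<in>#edge_cuts t. single ({#a#}, {#b#}) 1)"
proof (induction t)
  case (Node i F)
  let ?B = "\<lambda>(a, b). (a, {#Node i b#})"
  have "push_forward ?B (branch_part 1 (tree_coproduct t) * single ({#}, F - {#t#}) 1) =
      single ({#t#}, {#Node i (F - {#t#})#}) 1 +
      (\<Sum>(a, b)\<in>#edge_cuts t. single ({#a#}, {#Node i (add_mset b (F - {#t#}))#}) 1)"
    if t: "t \<in># F" for t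
  proof -
    have "(\<Sum>(a, b)\<in>#E. single ({#a#}, {#b#}) 1) * single ({#}, F - {#t#}) (1::real) =
        (\<Sum>(a, b)\<in>#E. single ({#a#}, add_mset b (F - {#t#})) 1)" for E :: "('a rtree \<times> 'a rtree) multiset"
      by (induction E) (auto simp: distrib_right mult_single)
    then show ?thesis
      by (simp only: Node[OF t] distrib_right mult_single push_forward_simps push_forward_sum_mset)
         (simp add: push_forward_simps case_prod_unfold)
  qed
  then have "push_forward ?B (branch_part 1 (forest_coproduct F)) =
      (\<Sum>t\<in>#F. single ({#t#}, {#Node i (F - {#t#})#}) 1 +
      (\<Sum>(a, b)\<in>#edge_cuts t. single ({#a#}, {#Node i (add_mset b (F - {#t#}))#}) 1))"
    unfolding branch_part_1_forest push_forward_sum_mset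
    by (intro arg_cong[of _ _ sum_mset] image_mset_cong)
  also have "\<dots> = (\<Sum>(a, b)\<in>#edge_cuts (Node i F). single ({#a#}, {#b#}) 1)"
  proof -
    have S: "(\<Sum>x\<in>#sum_mset (image_mset f G). g x) = (\<Sum>t\<in>#G. \<Sum>x\<in>#f t. g x)"
      for f :: "'a rtree \<Rightarrow> ('a rtree \<times> 'a rtree) multiset" and G
        and g :: "'a rtree \<times> 'a rtree \<Rightarrow> ('a forest \<times> 'a forest \<Rightarrow>\<^sub>0 real)"
      by (induction G) simp_all
    show ?thesis
      unfolding edge_cuts.simps S by (simp add: image_mset.compositionality o_def case_prod_unfold)
  qed
  finally show ?case
    by (simp add: tree_coproduct_eq branch_part_simps branch_part_trunk)
qed

lemma sum_mset_eq_sum_count: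
  fixes f :: "'b \<Rightarrow> real"
  shows "(\<Sum>k\<in>#E. f k) = (\<Sum>k\<in>set_mset E. real (count E k) * f k)"
proof -
  have "(\<Sum>k\<in>#E. f k) = (\<Sum>k\<in>S. real (count E k) * f k)" if "finite S" "set_mset E \<subseteq> S" for S
    using that(2)
  proof (induction E)
    case (add j E)
    have "(\<Sum>k\<in>S. real (count (add_mset j E) k) * f k) =
        (\<Sum>k\<in>S. real (count E k) * f k + (if k = j then f j else 0))"
      by (rule sum.cong) (auto simp: algebra_simps)
    then show ?case using add that(1) by (simp add: sum.distrib)
  qed simp
  then show ?thesis by blast
qed

lemma pairing_sum_mset_single:
  "pairing (\<lambda>(a, b). x a * y b) (\<Sum>(a, b)\<in>#E. single ({#a#}, {#b#}) 1) =
    (\<Sum>k\<in>#E. x {#fst k#} * y {#snd k#})"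
  by (induction E) (simp_all add: pairing_add case_prod_unfold)

text \<open>On tree series only the cuts with a single branch and a single trunk contribute, and
  these are the edge cuts. The pre-Lie morphism property thus follows from multiplicativity and the
  preservation of the number of trees.\<close>

lemma pre_lie_eq_gl_mult:
  assumes x: "x \<in> tree_series" and y: "y \<in> tree_series"
  shows "pre_lie x y = (\<lambda>F. if size F = 1 then gl_mult x y F else 0)"
proof
  fix F
  show "pre_lie x y F = (if size F = 1 then gl_mult x y F else 0)"
  proof (cases "size F = 1")
    case True
    then obtain t where F: "F = {#t#}" using size_1_singleton_mset by blast
    let ?xy = "\<lambda>(a, b). x a * y b"
    have "gl_mult x y F = pairing ?xy (branch_part 1 (tree_coproduct t))"
      unfolding gl_mult_def branch_part_def pairing_lin F
      by (simp, intro pairing_cong) (use x in \<open>auto simp: tree_series_def\<close>)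
    also have "\<dots> = pairing ?xy (\<Sum>(a, b)\<in>#edge_cuts t. single ({#a#}, {#b#}) 1)"
      using y by (simp add: branch_part_1_tree[unfolded One_nat_def] pairing_add tree_series_def)
    also have "\<dots> = (\<Sum>k\<in>#edge_cuts t. x {#fst k#} * y {#snd k#})"
      by (rule pairing_sum_mset_single)
    finally show ?thesis
      unfolding sum_mset_eq_sum_count
      by (simp add: pre_lie_def F case_prod_unfold mult.assoc)
  qed (simp add: pre_lie_def)
qed

lemma forest_translation_pre_lie:
  assumes v: "tree_family v" and x: "x \<in> tree_series" and y: "y \<in> tree_series"
  shows "forest_translation v (pre_lie x y) = pre_lie (forest_translation v x) (forest_translation v y)"
proof
  fix F
  let ?M = "forest_translation v"
  have "?M (pre_lie x y) F = (if size F = 1 then ?M (gl_mult x y) F else 0)"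
  proof (cases "size F = 1")
    case True
    show ?thesis
      unfolding forest_translation_def if_P[OF True]
    proof (rule pairing_cong)
      fix z assume "z \<in> keys (forest_dual v F)"
      then have "size z = 1" using size_forest_dual[of z v F] True by simp
      then show "pre_lie x y z = gl_mult x y z" by (simp add: pre_lie_eq_gl_mult[OF x y])
    qed
  next
    case False
    have "pre_lie x y \<in> tree_series" by (simp add: tree_series_def pre_lie_def)
    from forest_translation_tree_series[OF this, of v] show ?thesis
      using False by (simp add: tree_series_def)
  qed
  then show "?M (pre_lie x y) F = pre_lie (?M x) (?M y) F"
    by (simp add: forest_translation_gl_mult[OF v] pre_lie_eq_gl_mult forest_translation_tree_series x y)
qed

lemma is_branched_translation_forest_translation:
  assumes "tree_family v"
  shows "is_branched_translation v (forest_translation v)"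
proof -
  have "continuous_on UNIV (forest_translation v)"
    unfolding forest_translation_def[abs_def] by (rule continuous_on_pairing)
  then show ?thesis
    unfolding is_branched_translation_def algebra_morphism_def
    by (simp add: series_linear_forest_translation forest_translation_one
        forest_translation_gl_mult[OF assms] forest_translation_tree_series
        forest_translation_pre_lie[OF assms] forest_translation_bullet[OF assms] bullet_image_def)
qed

section \<open>Bullets generate the forests\<close>

lemma gl_mult_basis:
  "gl_mult (basis_series a) (basis_series b) F = lookup (forest_coproduct F) (a, b)"
proof -
  have "(\<lambda>(c, d). basis_series a c * basis_series b d) = basis_series (a, b)"
    by (auto simp: basis_series_def)
  then show ?thesis by (simp add: gl_mult_def pairing_basis)
qed

text \<open>Coefficients of the coproduct are nonnegative, so nothing cancels and one positive
  contribution shows that a coefficient is positive.\<close>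

definition nonneg :: "('b \<Rightarrow>\<^sub>0 real) \<Rightarrow> bool" where
  "nonneg p \<longleftrightarrow> (\<forall>k. 0 \<le> lookup p k)"

lemma nonneg_add: "nonneg p \<Longrightarrow> nonneg q \<Longrightarrow> nonneg (p + q)"
  by (simp add: nonneg_def lookup_add)

lemma nonneg_push_forward: "nonneg p \<Longrightarrow> nonneg (push_forward g p)"
  by (auto simp: nonneg_def push_forward_lin lookup_lin pairing_def lookup_single when_def
      intro!: sum_nonneg)

lemma nonneg_mult:
  fixes p q :: "'b::comm_monoid_add \<Rightarrow>\<^sub>0 real"
  assumes "nonneg p" "nonneg q"
  shows "nonneg (p * q)" "lookup p k * lookup q l \<le> lookup (p * q) (k + l)"
proof -
  have "p * q = (\<Sum>k\<in>keys p. \<Sum>l\<in>keys q. single (k + l) (lookup p k * lookup q l))"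
  proof -
    have e: "(\<Sum>k\<in>keys p. single k (lookup p k)) = p" for p :: "'b \<Rightarrow>\<^sub>0 real"
      using lin_ident[of p] by (simp add: lin_def del: lin_ident)
    show ?thesis
      by (subst (1) e[of p, symmetric], subst (1) e[of q, symmetric]) (simp only: sum_product mult_single)
  qed
  then have e: "lookup (p * q) j = (\<Sum>k\<in>keys p. \<Sum>l\<in>keys q. if k + l = j then lookup p k * lookup q l else 0)"
    for j by (simp add: lookup_sum lookup_single when_def)
  have nn: "0 \<le> (if k + l = j then lookup p k * lookup q l else 0)" for k l j
    using assms by (simp add: nonneg_def)
  show "nonneg (p * q)"
    unfolding nonneg_def e by (intro allI sum_nonneg nn)
  show "lookup p k * lookup q l \<le> lookup (p * q) (k + l)"
  proof (cases "k \<in> keys p \<and> l \<in> keys q")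
    case True
    have "lookup p k * lookup q l \<le> (\<Sum>l'\<in>keys q. if k + l' = k + l then lookup p k * lookup q l' else 0)"
      using member_le_sum[of l "keys q" "\<lambda>l'. if k + l' = k + l then lookup p k * lookup q l' else 0"]
        True nn by simp
    also have "\<dots> \<le> lookup (p * q) (k + l)"
      unfolding e
      by (rule member_le_sum[of k "keys p" "\<lambda>k'. \<Sum>l'\<in>keys q. if k' + l' = k + l then lookup p k' * lookup q l' else 0"])
         (use True nn in \<open>auto intro!: sum_nonneg\<close>)
    finally show ?thesis .
  next
    case False
    then have "lookup p k * lookup q l = 0" by (auto simp: in_keys_iff)
    moreover have "0 \<le> lookup (p * q) (k + l)" using \<open>nonneg (p * q)\<close> by (simp add: nonneg_def)
    ultimately show ?thesis by linarith
  qed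
qed

lemma nonneg_one: "nonneg 1"
  by (simp add: nonneg_def lookup_one when_def)

lemma nonneg_tree_coproduct: "nonneg (tree_coproduct t)"
proof (induction t)
  case (Node i F)
  then have "nonneg (forest_coproduct F)"
    by (induction F) (simp_all add: nonneg_one nonneg_mult)
  then show ?case
    unfolding tree_coproduct_eq tree_cuts.simps
    by (intro nonneg_add nonneg_push_forward) (auto simp: nonneg_def lookup_single when_def)
qed

lemma nonneg_forest_coproduct: "nonneg (forest_coproduct F)"
  by (induction F) (simp_all add: nonneg_one nonneg_mult nonneg_tree_coproduct)

text \<open>The full cut of \<open>t\<close> together with the empty cut of \<open>G\<close>
  contributes to this coefficient.\<close>

lemma lookup_coproduct_add_mset:
  fixes t :: "'l::finite rtree"
  shows "0 < lookup (forest_coproduct (add_mset t G)) ({#t#}, G)"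
proof -
  have "lookup (tree_coproduct t) ({#t#}, {#}) = 1"
    using gl_mult_basis[of "{#t#}" "{#}" "{#t#}"] forest.mult_one_right[of "basis_series {#t#}"]
    by (simp add: basis_series_def)
  moreover have "lookup (forest_coproduct G) ({#}, G) = 1"
    using gl_mult_basis[of "{#}" G G] forest.mult_one_left[of "basis_series G"]
    by (simp add: basis_series_def)
  ultimately have "1 \<le> lookup (tree_coproduct t * forest_coproduct G) (({#t#}, {#}) + ({#}, G))"
    using nonneg_mult(2)[OF nonneg_tree_coproduct nonneg_forest_coproduct, of t "({#t#}, {#})" G "({#}, G)"]
    by simp
  then show ?thesis by simp
qed

text \<open>\<open>F1\<close> consists of the trees of \<open>F\<close> that are cut off whole; each
  other tree leaves exactly one trunk. If the branches contain nothing else, the other trees were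
  not cut at all.\<close>

lemma keys_forest_coproduct_size:
  fixes F :: "'l::finite forest"
  assumes "(a, b) \<in> keys (forest_coproduct F)"
  shows "\<exists>F1. F1 \<subseteq># a \<and> size F = size F1 + size b \<and> (F1 = a \<longrightarrow> F = a + b)"
  using assms
proof (induction F arbitrary: a b)
  case empty
  then show ?case by (simp add: zero_prod_def)
next
  case (add t F)
  then obtain a1 b1 a2 b2 where 1: "(a1, b1) \<in> keys (tree_coproduct t)"
    and 2: "(a2, b2) \<in> keys (forest_coproduct F)" and ab: "a = a1 + a2" "b = b1 + b2"
    by (auto elim!: in_keys_multE)
  from add.IH[OF 2] obtain F1 where
    F1: "F1 \<subseteq># a2" "size F = size F1 + size b2" "F1 = a2 \<longrightarrow> F = a2 + b2" by blast
  show ?case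
  proof (cases "(a1, b1) = ({#t#}, {#})")
    case True
    then show ?thesis using F1 by (intro exI[of _ "add_mset t F1"]) (auto simp: ab)
  next
    case False
    then have cut: "(a1, b1) \<in> keys (tree_cuts t)"
      using 1 by (auto simp: tree_coproduct_eq in_keys_iff lookup_add lookup_single when_def split: if_splits)
    then obtain r where r: "b1 = {#r#}" by (rule keys_tree_cuts)
    have "a1 = {#} \<longrightarrow> r = t"
    proof
      assume "a1 = {#}"
      then have "lookup (tree_coproduct t) ({#}, {#r#}) \<noteq> 0" using 1 r by (simp add: in_keys_iff)
      then have "gl_mult (basis_series {#}) (basis_series {#r#}) {#t#} \<noteq> 0"
        by (simp add: gl_mult_basis)
      then have "basis_series {#r#} {#t#} \<noteq> (0 :: real)"
        by (simp only: forest.mult_one_left not_False_eq_True)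
      then show "r = t" by (simp add: basis_series_def split: if_splits)
    qed
    then show ?thesis
      using F1 r by (intro exI[of _ F1]) (auto simp: ab intro: subset_mset.add_increasing)
  qed
qed

text \<open>The single branch is either a whole tree of \<open>F\<close>, which the second
  hypothesis excludes, or was cut out of a tree that leaves its trunk in \<open>G\<close>.\<close>

lemma keys_forest_coproduct_single_branch:
  fixes F :: "'l::finite forest"
  assumes "lookup (forest_coproduct F) ({#t#}, G) \<noteq> 0" "F \<noteq> add_mset t G"
  shows "size F = size G"
proof -
  from keys_forest_coproduct_size[of "{#t#}" G F] assms(1) obtain F1 where
    F1: "F1 \<subseteq># {#t#}" "size F = size F1 + size G" "F1 = {#t#} \<longrightarrow> F = add_mset t G"
    by (auto simp: in_keys_iff)
  have "F1 = {#}"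
  proof (rule ccontr)
    assume "F1 \<noteq> {#}"
    moreover have "size F1 \<le> 1" using size_mset_mono[OF F1(1)] by simp
    ultimately have "size F1 = 1" by (simp add: nonempty_has_size)
    then obtain s where "F1 = {#s#}" using size_1_singleton_mset by blast
    then show False using F1 assms(2) mset_subset_eqD[OF F1(1), of s] by simp
  qed
  with F1 show ?thesis by simp
qed

lemma lookup_coproduct_labels:
  "lookup (forest_coproduct F) (a, b) \<noteq> 0 \<Longrightarrow> forest_labels F = forest_labels a + forest_labels b"
  using keys_forest_coproduct[of a b F] by (simp add: in_keys_iff)

lemma lookup_coproduct_trees:
  "lookup (forest_coproduct {#Node j H#}) ({#t#}, {#Node i G#}) =
     (if i = j then lookup (forest_coproduct H) ({#t#}, G) else 0)"
proof -
  have "lookup (push_forward (\<lambda>(a, b). (a, {#Node j b#})) p) ({#t#}, {#Node i G#}) =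
      (if i = j then lookup p ({#t#}, G) else 0)" for p :: "'a forest \<times> 'a forest \<Rightarrow>\<^sub>0 real"
  proof (induction p rule: poly_mapping_linear_induct)
    case (add k c p)
    obtain a b where k: "k = (a, b)" by (cases k)
    show ?case using add by (simp add: k push_forward_simps lookup_add lookup_single when_def)
  qed (simp add: push_forward_simps)
  then show ?thesis
    by (simp add: tree_coproduct_eq lookup_add lookup_single)
qed

text \<open>Elimination in a triangular system: agreement on \<open>z\<close> and on all its other
  terms leaves the term \<open>F\<close>, whose coefficient is invertible.\<close>

lemma agree_on_leading_term:
  fixes M M' :: "('b \<Rightarrow> real) \<Rightarrow> ('c \<Rightarrow> real)"
  assumes M: "series_linear M" "series_linear M'" and z: "M z = M' z"
    and S: "finite S" "\<And>F. F \<notin> S \<Longrightarrow> z F = 0" and F: "z F \<noteq> 0"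
    and others: "\<And>F'. F' \<noteq> F \<Longrightarrow> z F' \<noteq> 0 \<Longrightarrow> M (basis_series F') = M' (basis_series F')"
  shows "M (basis_series F) = M' (basis_series F)"
proof
  fix j :: 'c
  have "F \<in> S" using S(2) F by blast
  have "0 = (\<Sum>w\<in>S. z w * M (basis_series w) j) - (\<Sum>w\<in>S. z w * M' (basis_series w) j)"
    using fun_cong[OF series_linear_finite_support[of M S z, OF M(1) S], of j]
      fun_cong[OF series_linear_finite_support[of M' S z, OF M(2) S], of j] z by simp
  also have "\<dots> = (\<Sum>w\<in>S. z w * (M (basis_series w) j - M' (basis_series w) j))"
    by (simp add: sum_subtractf right_diff_distrib)
  also have "\<dots> = (\<Sum>w\<in>S. if w = F then z F * (M (basis_series F) j - M' (basis_series F) j) else 0)"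
  proof (rule sum.cong)
    show "z w * (M (basis_series w) j - M' (basis_series w) j) =
        (if w = F then z F * (M (basis_series F) j - M' (basis_series F) j) else 0)" for w
      using others[of w] by (cases "z w = 0") auto
  qed simp
  also have "\<dots> = z F * (M (basis_series F) j - M' (basis_series F) j)"
    using \<open>F \<in> S\<close> S(1) by simp
  finally show "M (basis_series F) j = M' (basis_series F) j" using F by simp
qed

primrec root_branches :: "'l rtree \<Rightarrow> 'l forest" where
  "root_branches (Node i F) = F"

text \<open>A forest is the leading term of the product of one of its trees with the others, and a tree
  \<open>[\<tau> \<tau>\<^sub>2 \<dots> \<tau>\<^sub>n]\<^sub>i\<close> is the leading term of \<open>\<tau> \<curvearrowright> [\<tau>\<^sub>2 \<dots> \<tau>\<^sub>n]\<^sub>i\<close>: the remaining terms have the same number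
  of nodes and fewer trees, or fewer branches at the root.\<close>

lemma agree_on_forests:
  fixes M M' :: "('l::finite forest \<Rightarrow> real) \<Rightarrow> ('l forest \<Rightarrow> real)"
  assumes M: "algebra_morphism gl_mult (basis_series {#}) M"
    and M': "algebra_morphism gl_mult (basis_series {#}) M'"
    and pre: "\<And>x y. x \<in> tree_series \<Longrightarrow> y \<in> tree_series \<Longrightarrow> M (pre_lie x y) = pre_lie (M x) (M y)"
    and pre': "\<And>x y. x \<in> tree_series \<Longrightarrow> y \<in> tree_series \<Longrightarrow> M' (pre_lie x y) = pre_lie (M' x) (M' y)"
    and bullets: "\<And>i. i \<in> S \<Longrightarrow> M (basis_series {#bullet i#}) = M' (basis_series {#bullet i#})"
    and F: "set_mset (forest_labels F) \<subseteq> S"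
  shows "M (basis_series F) = M' (basis_series F)"
  using F
proof (induction F rule: wf_induct[OF wf_measures[of "[forest_size, size,
    \<lambda>F. size (sum_mset (image_mset root_branches F))]"]])
  case (1 F)
  let ?agree = "\<lambda>F. M (basis_series F) = M' (basis_series F)"
  have IH: "?agree G" if "(G, F) \<in> measures [forest_size, size,
      \<lambda>F. size (sum_mset (image_mset root_branches F))]" "set_mset (forest_labels G) \<subseteq> S" for G
    using 1(1) that by blast
  have lin: "series_linear M" "series_linear M'"
    and mult: "M (gl_mult x y) = gl_mult (M x) (M y)" "M' (gl_mult x y) = gl_mult (M' x) (M' y)"
    and one: "M (basis_series {#}) = basis_series {#}" "M' (basis_series {#}) = basis_series {#}" for x y
    using M M' by (simp_all add: algebra_morphism_def)
  have pos: "0 < size (tree_labels t)" for t :: "'l rtree"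
    by (simp add: nonempty_has_size[symmetric])
  have smaller: "?agree G" if "forest_size G < forest_size F" "forest_labels G \<subseteq># forest_labels F" for G
    using IH[of G] that 1(2) set_mset_mono[OF that(2)] by auto
  let ?S = "{G :: 'l forest. forest_size G \<le> forest_size F}"
  consider "F = {#}" | i where "F = {#bullet i#}" | i t G where "F = {#Node i (add_mset t G)#}"
    | t G where "F = add_mset t G" "G \<noteq> {#}"
  proof (cases F)
    case (add t G)
    show ?thesis
    proof (cases "G = {#}")
      case True
      obtain i H where t: "t = Node i H" by (cases t)
      show ?thesis
        using that(2)[of i] that(3)[of i] add True t by (cases H) (auto simp: bullet_def)
    qed (use that(4)[of t G] add in blast)
  qed (use that in blast)
  then show ?case
  proof cases
    case 1
    then show ?thesis by (simp add: one)
  next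
    case (2 i)
    then show ?thesis using bullets[of i] 1(2) by (simp add: bullet_def)
  next
    case (3 i t G)
    let ?x = "basis_series {#t#}" and ?y = "basis_series {#Node i G#}"
    let ?z = "pre_lie ?x ?y"
    have xy: "?x \<in> tree_series" "?y \<in> tree_series"
      by (auto simp: tree_series_def basis_series_def)
    have z: "?z F' = (if size F' = 1 then lookup (forest_coproduct F') ({#t#}, {#Node i G#}) else 0)" for F'
      by (simp add: pre_lie_eq_gl_mult[OF xy] gl_mult_basis)
    have z_nz: "forest_labels F' = forest_labels F \<and>
        (\<exists>H. F' = {#Node i H#} \<and> lookup (forest_coproduct H) ({#t#}, G) \<noteq> 0)" if nz: "?z F' \<noteq> 0" for F'
    proof -
      have c: "size F' = 1" "lookup (forest_coproduct F') ({#t#}, {#Node i G#}) \<noteq> 0"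
        using nz unfolding z by (auto split: if_splits)
      then obtain s where "F' = {#s#}" using size_1_singleton_mset by blast
      then obtain j H where F': "F' = {#Node j H#}" by (cases s) auto
      show ?thesis
        using c(2) lookup_coproduct_labels[OF c(2)] 3 unfolding F' lookup_coproduct_trees
        by (auto split: if_splits)
    qed
    show ?thesis
    proof (rule agree_on_leading_term[OF lin, of ?z ?S])
      have "?agree {#t#}" "?agree {#Node i G#}"
        using 3 pos[of t] by (auto intro!: smaller)
      then show "M ?z = M' ?z" by (simp add: pre[OF xy] pre'[OF xy])
      show "finite ?S" by (rule finite_forests)
      show "?z F' = 0" if "F' \<notin> ?S" for F'
        using z_nz[of F'] that by (cases "?z F' = 0") (auto simp: forest_size_def)
      show "?z F \<noteq> 0"
        using lookup_coproduct_add_mset[of t G] by (simp add: z 3 lookup_coproduct_trees del: forest_coproduct_simps)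
      show "?agree F'" if ne: "F' \<noteq> F" and nz: "?z F' \<noteq> 0" for F'
      proof -
        from z_nz[OF nz] obtain H where labels: "forest_labels F' = forest_labels F"
          and F': "F' = {#Node i H#}" and c: "lookup (forest_coproduct H) ({#t#}, G) \<noteq> 0" by blast
        have "size H = size G"
          using keys_forest_coproduct_single_branch[OF c] ne by (auto simp: F' 3)
        moreover have "forest_size F' = forest_size F" using labels by (simp add: forest_size_def)
        ultimately have "(F', F) \<in> measures [forest_size, size,
            \<lambda>F. size (sum_mset (image_mset root_branches F))]"
          by (simp add: F' 3)
        then show ?thesis using IH 1(2) labels by simp
      qed
    qed
  next
    case (4 t G)
    let ?z = "gl_mult (basis_series {#t#}) (basis_series G)"
    have labels: "forest_labels F' = forest_labels F" if "?z F' \<noteq> 0" for F'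
      using lookup_coproduct_labels[of F' "{#t#}" G] that by (simp add: gl_mult_basis 4)
    show ?thesis
    proof (rule agree_on_leading_term[OF lin, of ?z ?S])
      have "?agree {#t#}" "?agree G"
        using 4 pos[of t] by (auto intro!: smaller simp: neq0_conv[symmetric] simp del: neq0_conv)
      then show "M ?z = M' ?z" by (simp add: mult)
      show "finite ?S" by (rule finite_forests)
      show "?z F' = 0" if "F' \<notin> ?S" for F'
        using labels[of F'] that by (cases "?z F' = 0") (auto simp: forest_size_def)
      show "?z F \<noteq> 0"
        using lookup_coproduct_add_mset[of t G] by (simp add: gl_mult_basis 4 del: forest_coproduct_simps)
      show "?agree F'" if ne: "F' \<noteq> F" and nz: "?z F' \<noteq> 0" for F'
      proof -
        have "size F' = size G"
          by (rule keys_forest_coproduct_single_branch) (use nz ne 4 in \<open>simp_all add: gl_mult_basis\<close>)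
        moreover have "forest_size F' = forest_size F"
          using labels[OF nz] by (simp add: forest_size_def)
        ultimately have "(F', F) \<in> measures [forest_size, size,
            \<lambda>F. size (sum_mset (image_mset root_branches F))]"
          by (simp add: 4)
        then show ?thesis using IH 1(2) labels[OF nz] by simp
      qed
    qed
  qed
qed

lemma is_branched_translation_unique:
  fixes v :: "'l::finite \<Rightarrow> 'l forest \<Rightarrow> real"
  assumes M: "is_branched_translation v M" and M': "is_branched_translation v M'"
  shows "M = M'"
proof (rule forest.continuous_linear_eqI)
  show "M (basis_series F) = M' (basis_series F)" for F
    by (rule agree_on_forests[where S = UNIV])
       (use M M' in \<open>simp_all add: is_branched_translation_def\<close>)
qed (use M M' in \<open>simp_all add: is_branched_translation_def algebra_morphism_def\<close>)

lemma branched_translation_eq: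
  assumes "tree_family v"
  shows "branched_translation v = forest_translation v"
  unfolding branched_translation_def
proof (rule the_equality)
  show "is_branched_translation v (forest_translation v)"
    by (rule is_branched_translation_forest_translation[OF assms])
  then show "M = forest_translation v" if "is_branched_translation v M" for M
    by (rule is_branched_translation_unique[OF that])
qed

text \<open>\<open>forest_dual v\<close> is multiplicative by construction, so characters go to
  characters; for words the corresponding fact rests on primitivity.\<close>

lemma pairing_forest_translation_grouplike:
  assumes x: "\<And>p q. pairing x (p * q) = pairing x p * pairing x q"
  shows "pairing (forest_translation v x) (p * q) =
    pairing (forest_translation v x) p * pairing (forest_translation v x) q"
proof -
  have "pairing (forest_translation v x) p = pairing x (lin (forest_dual v) p)" for p
    by (simp add: forest_translation_def[abs_def] pairing_lin)
  then show ?thesis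
    by (simp add: lin_mult[of "forest_dual v"] x)
qed

section \<open>Paths in finitely generated subalgebras\<close>

text \<open>A purely algebraic functional, obtained by extending a basis of \<open>W\<close> by
  \<open>z\<close>. It turns membership in a subspace into the vanishing of real numbers, to which
  \<open>sewing_bound\<close> applies.\<close>

lemma separating_functional:
  fixes W :: "('b \<Rightarrow> real) set"
  assumes W: "(\<lambda>_. 0) \<in> W" "\<And>c x y. x \<in> W \<Longrightarrow> y \<in> W \<Longrightarrow> (\<lambda>k. c * x k + y k) \<in> W"
    and z: "z \<notin> W"
  obtains l :: "('b \<Rightarrow> real) \<Rightarrow> real" where
    "\<And>c x y. l (\<lambda>k. c * x k + y k) = c * l x + l y" "\<And>x. x \<in> W \<Longrightarrow> l x = 0" "l z \<noteq> 0"
proof -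
  let ?s = "\<lambda>(c :: real) (f :: 'b \<Rightarrow> real) k. c * f k"
  interpret vector_space_pair ?s "(*) :: real \<Rightarrow> real \<Rightarrow> real"
    by unfold_locales (auto simp: algebra_simps)
  have sub: "vs1.subspace W"
    unfolding vs1.subspace_def
  proof (intro conjI ballI allI)
    show "0 \<in> W" using W(1) by (simp add: zero_fun_def)
    show "x + y \<in> W" if "x \<in> W" "y \<in> W" for x y
      using W(2)[OF that, of 1] by (simp add: plus_fun_def)
    show "(\<lambda>k. c * x k) \<in> W" if "x \<in> W" for c x
      using W(2)[OF that W(1), of c] by simp
  qed
  obtain B where B: "B \<subseteq> W" "vs1.independent B" "W \<subseteq> vs1.span B"
    by (rule vs1.maximal_independent_subset)
  have "vs1.span B \<subseteq> W" by (rule vs1.span_minimal[OF B(1) sub])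
  then have "z \<notin> vs1.span B" using z by blast
  then have "vs1.independent (insert z B)" using B(2) by (rule vs1.independent_insertI)
  then obtain g where g: "Vector_Spaces.linear ?s (*) g"
    and gB: "\<forall>x\<in>insert z B. g x = (if x = z then 1 else 0)"
    using linear_independent_extend[of "insert z B" "\<lambda>x. if x = z then 1 else 0"] by blast
  interpret g: Vector_Spaces.linear ?s "(*)" g by (rule g)
  show ?thesis
  proof (rule that)
    show "g (\<lambda>k. c * x k + y k) = c * g x + g y" for c x y
      using g.add[of "\<lambda>k. c * x k" y] g.scale[of c x] by (simp add: plus_fun_def)
    show "g x = 0" if "x \<in> W" for x
    proof (rule linear_eq_0_on_span[OF g])
      show "x \<in> vs1.span B" using that B(3) by blast
      show "g b = 0" if "b \<in> B" for b using gB that B(1) z by auto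
    qed
    show "g z \<noteq> 0" using gB by simp
  qed
qed

context graded_coalgebra
begin

definition graded_part :: "nat \<Rightarrow> ('b \<Rightarrow> real) \<Rightarrow> 'b \<Rightarrow> real" where
  "graded_part k x = (\<lambda>w. if len w = k then x w else 0)"

text \<open>The degree k part of the algebra generated by the basis series of \<open>E\<close>.
  Generators are multiplied from the left only, which gives an expansion by the first factor;
  closure under products then comes from associativity in \<open>generated_mult\<close>.\<close>

inductive generated :: "'b set \<Rightarrow> nat \<Rightarrow> ('b \<Rightarrow> real) \<Rightarrow> bool" for E where
  gen_one: "generated E 0 (basis_series one)"
| gen_zero: "generated E k (\<lambda>_. 0)"
| gen_lin: "generated E k x \<Longrightarrow> generated E k y \<Longrightarrow> generated E k (\<lambda>w. c * x w + y w)"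
| gen_mult: "e \<in> E \<Longrightarrow> generated E k x \<Longrightarrow> generated E (len e + k) (mult (basis_series e) x)"

lemma mult_eq_0:
  assumes "\<And>a b. (a, b) \<in> keys (cut w) \<Longrightarrow> x a * y b = 0"
  shows "mult x y w = 0"
proof -
  have "mult x y w = mult (\<lambda>_. 0) (\<lambda>_. 0) w"
    by (rule mult_cong) (simp add: assms)
  then show ?thesis by simp
qed

lemma generated_support: "generated E k x \<Longrightarrow> len w \<noteq> k \<Longrightarrow> x w = 0"
proof (induction arbitrary: w rule: generated.induct)
  case gen_one
  then show ?case using len_eq_0_iff by (auto simp: basis_series_def)
next
  case (gen_mult e k x)
  show ?case
  proof (rule mult_eq_0)
    fix a b assume "(a, b) \<in> keys (cut w)"
    then have "a \<noteq> e \<or> len b \<noteq> k" using len_cut[of a b w] gen_mult.prems by auto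
    then show "basis_series e a * x b = 0"
      using gen_mult.IH[of b] by (auto simp: basis_series_def)
  qed
qed auto

lemma generated_add: "generated E k x \<Longrightarrow> generated E k y \<Longrightarrow> generated E k (\<lambda>w. x w + y w)"
  using gen_lin[of E k x y 1] by simp

lemma generated_sum:
  "(\<And>i. i \<in> A \<Longrightarrow> generated E k (x i)) \<Longrightarrow> generated E k (\<lambda>w. \<Sum>i\<in>A. x i w)"
  by (induction A rule: infinite_finite_induct) (simp_all add: gen_zero generated_add)

lemma generated_basis: "e \<in> E \<Longrightarrow> generated E (len e) (basis_series e)"
  using gen_mult[OF _ gen_one, of e E] by (simp add: mult_one_right)

lemma generated_mult:
  assumes assoc: "\<And>x y z. mult (mult x y) z = mult x (mult y z)"
    and x: "generated E j x" and y: "generated E k y"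
  shows "generated E (j + k) (mult x y)"
  using x
proof (induction rule: generated.induct)
  case gen_one
  then show ?case using y by (simp add: mult_one_left)
next
  case (gen_zero j)
  have "mult (\<lambda>_. 0) y = (\<lambda>_. 0)" by (rule ext) simp
  then show ?case using generated.gen_zero by simp
next
  case (gen_lin j x x' c)
  have "mult (\<lambda>w. c * x w + x' w) y = (\<lambda>w. c * mult x y w + mult x' y w)"
    by (rule ext) (simp add: mult_add_left mult_scale_left)
  then show ?case using generated.gen_lin[OF gen_lin.IH] by simp
next
  case (gen_mult e j x)
  then show ?case
    using generated.gen_mult[OF gen_mult.hyps(1) gen_mult.IH] by (simp add: assoc add.assoc)
qed

text \<open>Expansion by the leftmost generator, the analogue of expanding a tensor series by its
  first letter. The equation \<open>len e + j = k\<close> leaves \<open>g e\<close> unconstrained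
  for generators of degree above k.\<close>

lemma generated_decompose:
  assumes E: "finite E" and x: "generated E k x"
  shows "\<exists>c g. (\<forall>e\<in>E. \<forall>j. len e + j = k \<longrightarrow> generated E j (g e)) \<and>
    x = (\<lambda>w. c * basis_series one w + (\<Sum>e\<in>E. mult (basis_series e) (g e) w))"
  using x
proof (induction rule: generated.induct)
  case gen_one
  then show ?case
    by (intro exI[of _ 1] exI[of _ "\<lambda>_ _. 0"]) (auto intro: gen_zero)
next
  case (gen_zero k)
  then show ?case
    by (intro exI[of _ 0] exI[of _ "\<lambda>_ _. 0"]) (auto intro: generated.gen_zero)
next
  case (gen_lin k x y c)
  then obtain a g b h where
    g: "\<forall>e\<in>E. \<forall>j. len e + j = k \<longrightarrow> generated E j (g e)"
      "x = (\<lambda>w. a * basis_series one w + (\<Sum>e\<in>E. mult (basis_series e) (g e) w))" and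
    h: "\<forall>e\<in>E. \<forall>j. len e + j = k \<longrightarrow> generated E j (h e)"
      "y = (\<lambda>w. b * basis_series one w + (\<Sum>e\<in>E. mult (basis_series e) (h e) w))"
    by blast
  show ?case
  proof (intro exI[of _ "c * a + b"] exI[of _ "\<lambda>e w. c * g e w + h e w"] conjI)
    show "(\<lambda>w. c * x w + y w) = (\<lambda>w. (c * a + b) * basis_series one w +
        (\<Sum>e\<in>E. mult (basis_series e) (\<lambda>w. c * g e w + h e w) w))"
      unfolding g(2) h(2)
      by (rule ext)
        (simp add: mult_add_right mult_scale_right sum.distrib sum_distrib_left[symmetric] algebra_simps)
    show "\<forall>e\<in>E. \<forall>j. len e + j = k \<longrightarrow> generated E j (\<lambda>w. c * g e w + h e w)"
      using g(1) h(1) generated.gen_lin by blast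
  qed
next
  case (gen_mult e k x)
  define g where "g e' = (if e' = e then x else (\<lambda>_. 0))" for e'
  have "(\<Sum>e'\<in>E. mult (basis_series e') (g e') w) = mult (basis_series e) x w" for w
  proof -
    have "(\<Sum>e'\<in>E. mult (basis_series e') (g e') w) =
        (\<Sum>e'\<in>E. if e' = e then mult (basis_series e) x w else 0)"
      by (rule sum.cong) (auto simp: g_def)
    then show ?thesis using E gen_mult.hyps(1) by simp
  qed
  then show ?case
    using gen_mult.hyps
    by (intro exI[of _ 0] exI[of _ g]) (auto simp: g_def intro: generated.gen_zero)
qed

text \<open>Membership in the closure of the generated algebra, tested degree by degree.\<close>

definition generated_series :: "'b set \<Rightarrow> ('b \<Rightarrow> real) \<Rightarrow> bool" where
  "generated_series E x \<longleftrightarrow> (\<forall>k. generated E k (graded_part k x))"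

text \<open>Because \<open>E\<close> is finite, an infinite series in the closure is still a finite
  sum of generators times series in the closure. To such a sum a merely linear and multiplicative
  map can be applied.\<close>

lemma generated_series_decompose:
  assumes E: "finite E" and x: "generated_series E x"
  shows "\<exists>c g. (\<forall>e\<in>E. generated_series E (g e)) \<and>
    x = (\<lambda>w. c * basis_series one w + (\<Sum>e\<in>E. mult (basis_series e) (g e) w))"
proof -
  have "\<forall>k. \<exists>c g. (\<forall>e\<in>E. \<forall>j. len e + j = k \<longrightarrow> generated E j (g e)) \<and>
    graded_part k x = (\<lambda>w. c * basis_series one w + (\<Sum>e\<in>E. mult (basis_series e) (g e) w))"
    using generated_decompose[OF E] x unfolding generated_series_def by blast
  then obtain c g where
    g: "\<And>k e j. e \<in> E \<Longrightarrow> len e + j = k \<Longrightarrow> generated E j (g k e)" and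
    dec: "\<And>k. graded_part k x = (\<lambda>w. c k * basis_series one w + (\<Sum>e\<in>E. mult (basis_series e) (g k e) w))"
    by metis
  \<comment> \<open>In degree j the cofactor of \<open>e\<close> is the one chosen for the component
    of \<open>x\<close> of degree \<open>len e + j\<close>.\<close>
  define G where "G e w = g (len e + len w) e w" for e w
  have "generated_series E (G e)" if "e \<in> E" for e
    unfolding generated_series_def
  proof
    fix j
    have gen: "generated E j (g (len e + j) e)" by (rule g[OF that refl])
    have "graded_part j (G e) = g (len e + j) e"
      using generated_support[OF gen] by (auto simp: graded_part_def G_def)
    then show "generated E j (graded_part j (G e))" using gen by simp
  qed
  moreover have "x w = c 0 * basis_series one w + (\<Sum>e\<in>E. mult (basis_series e) (G e) w)" for w
  proof -
    have "mult (basis_series e) (G e) w = mult (basis_series e) (g (len w) e) w" for e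
    proof (rule mult_cong)
      fix a b assume "(a, b) \<in> keys (cut w)"
      then show "basis_series e a * G e b = basis_series e a * g (len w) e b"
        using len_cut[of a b w] by (auto simp: basis_series_def G_def)
    qed
    moreover have "x w = graded_part (len w) x w" by (simp add: graded_part_def)
    moreover have "c (len w) * basis_series one w = c 0 * basis_series one w"
      using len_eq_0_iff[of w] by (auto simp: basis_series_def)
    ultimately show ?thesis by (simp add: dec)
  qed
  ultimately show ?thesis by (intro exI[of _ "c 0"] exI[of _ G]) auto
qed

text \<open>No continuity is needed: the components of degree at most \<open>n\<close> of the image only depend on
  \<open>n\<close> iterations of the decomposition.\<close>

lemma agree_on_generated_series:
  assumes E: "finite E" and M: "algebra_morphism mult (basis_series one) M"
    and M': "algebra_morphism mult (basis_series one) M'"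
    and eq: "\<And>e. e \<in> E \<Longrightarrow> M (basis_series e) = M' (basis_series e)"
    and augment: "\<And>e. e \<in> E \<Longrightarrow> M' (basis_series e) one = 0"
    and x: "generated_series E x"
  shows "M x = M' x"
proof
  have lin: "series_linear M" "series_linear M'"
    and mult: "\<And>x y. M (mult x y) = mult (M x) (M y)" "\<And>x y. M' (mult x y) = mult (M' x) (M' y)"
    and one: "M (basis_series one) = basis_series one" "M' (basis_series one) = basis_series one"
    using M M' by (simp_all add: algebra_morphism_def)
  show "M x w = M' x w" for w
    using x
  proof (induction "len w" arbitrary: x w rule: less_induct)
    case less
    from generated_series_decompose[OF E less.prems] obtain c g where
      g: "\<And>e. e \<in> E \<Longrightarrow> generated_series E (g e)" and
      dec: "x = (\<lambda>w. c * basis_series one w + (\<Sum>e\<in>E. mult (basis_series e) (g e) w))" by blast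
    have "M x w = c * basis_series one w + (\<Sum>e\<in>E. mult (M' (basis_series e)) (M (g e)) w)"
      by (subst dec) (simp add: series_linear_add[OF lin(1)] series_linear_scale[OF lin(1)]
          series_linear_sum[OF lin(1)] mult one eq)
    also have "\<dots> = c * basis_series one w + (\<Sum>e\<in>E. mult (M' (basis_series e)) (M' (g e)) w)"
    proof (intro arg_cong2[where f = "(+)"] refl sum.cong mult_cong)
      fix e a b assume e: "e \<in> E" and ab: "(a, b) \<in> keys (cut w)"
      show "M' (basis_series e) a * M (g e) b = M' (basis_series e) a * M' (g e) b"
      \<comment> \<open>The image of a generator has no constant term, so only the values of
        \<open>M (g e)\<close> in degrees below that of \<open>w\<close> enter, and these are
        covered by the induction hypothesis.\<close>
      proof (cases "a = one")
        case False
        then have "len b < len w" using len_cut[OF ab] len_eq_0_iff[of a] by simp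
        then show ?thesis using less.hyps[OF _ g[OF e]] by simp
      qed (simp add: augment[OF e])
    qed
    also have "\<dots> = M' x w"
      by (subst dec) (simp add: series_linear_add[OF lin(2)] series_linear_scale[OF lin(2)]
          series_linear_sum[OF lin(2)] mult one)
    finally show ?case .
  qed
qed

text \<open>Modulo the subspace generated in degree \<open>k\<close>, the component of degree \<open>k\<close> is an additive
  function of the interval, which vanishes because it is Hoelder continuous of an order above \<open>1\<close>.\<close>

lemma path_generated_series:
  assumes assoc: "\<And>x y z. mult (mult x y) z = mult x (mult y z)"
    and X: "regular_path \<alpha> T X" and \<theta>: "1 < \<theta>"
    and small: "\<And>w. w \<noteq> one \<Longrightarrow> w \<notin> E \<Longrightarrow> \<exists>C\<ge>0. hoelder_bound T X w C \<theta>"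
    and st: "s \<in> {0..T}" "t \<in> {0..T}"
  shows "generated_series E (X s t)"
  unfolding generated_series_def
proof
  show "generated E k (graded_part k (X s t))" for k
    using st
  proof (induction k arbitrary: s t rule: less_induct)
    case (less k)
    show ?case
    proof (cases "k = 0")
      case True
      have "graded_part 0 (X s t) = basis_series one"
        using regular_path_one[OF X less.prems] len_eq_0_iff
        by (auto simp: graded_part_def basis_series_def)
      then show ?thesis using True gen_one by simp
    next
      case False
      show ?thesis
      proof (rule ccontr)
        assume not_gen: "\<not> generated E k (graded_part k (X s t))"
        obtain l where l: "\<And>c x y. l (\<lambda>w. c * x w + y w) = c * l x + l y"
          and l_gen: "\<And>x. x \<in> {x. generated E k x} \<Longrightarrow> l x = 0"
          and l_nz: "l (graded_part k (X s t)) \<noteq> 0"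
          by (rule separating_functional[of "{x. generated E k x}" "graded_part k (X s t)"])
             (use not_gen in \<open>auto intro: gen_zero gen_lin\<close>)
        have l_add: "l (\<lambda>w. x w + y w) = l x + l y" for x y
          using l[of 1 x y] by simp
        have l_0: "l (\<lambda>w. 0) = 0"
          by (rule l_gen) (simp add: gen_zero)
        have l_scale: "l (\<lambda>w. c * x w) = c * l x" for c x
          using l[of c x "\<lambda>w. 0"] l_0 by simp
        have l_sum: "l (\<lambda>w. \<Sum>i\<in>A. x i w) = (\<Sum>i\<in>A. l (x i))" for A :: "'b set" and x
          by (induction A rule: infinite_finite_induct) (simp_all add: l_0 l_add)
        define f where "f s t = l (graded_part k (X s t))" for s t
        define A where "A = {w. len w = k}"
        have fin: "finite A" unfolding A_def by (rule finite_subset[OF _ finite_len[of k]]) auto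
        \<comment> \<open>\<open>l\<close> vanishes on the generators of degree k, so only
          coordinates outside \<open>E\<close> remain, and these have the order \<theta>.\<close>
        have f_eq: "f s t = (\<Sum>w\<in>A - E. X s t w * l (basis_series w))" for s t
        proof -
          have "graded_part k (X s t) = (\<lambda>j. \<Sum>w\<in>A. X s t w * basis_series w j)"
            by (subst finite_support_expansion[OF fin, of "graded_part k (X s t)"])
               (auto simp: graded_part_def A_def intro!: sum.cong ext)
          then have "f s t = (\<Sum>w\<in>A. X s t w * l (basis_series w))"
            unfolding f_def by (simp add: l_sum l_scale)
          also have "\<dots> = (\<Sum>w\<in>A - E. X s t w * l (basis_series w))"
            by (rule sum.mono_neutral_right) (use fin in \<open>auto simp: A_def intro!: l_gen generated_basis\<close>)
          finally show ?thesis .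
        qed
        have "\<exists>C\<ge>0. \<forall>w\<in>A - E. hoelder_bound T X w C \<theta>"
        proof (rule uniform_bound)
          show "finite (A - E)" using fin by simp
          show "\<exists>C\<ge>0. hoelder_bound T X w C \<theta>"
            if "w \<in> A - E" for w
            using small[of w] that False len_eq_0_iff[of w] by (auto simp: A_def)
          show "hoelder_bound T X w C' \<theta>"
            if "hoelder_bound T X w C \<theta>" "C \<le> C'" for w C C'
          proof (intro ballI impI)
            fix s t assume st: "s \<in> {0..T}" "t \<in> {0..T}" "s \<noteq> t"
            have "\<bar>X s t w\<bar> \<le> C * \<bar>t - s\<bar> powr \<theta>" using that(1) st by simp
            also have "\<dots> \<le> C' * \<bar>t - s\<bar> powr \<theta>" using that(2) by (simp add: mult_right_mono)
            finally show "\<bar>X s t w\<bar> \<le> C' * \<bar>t - s\<bar> powr \<theta>" .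
          qed
        qed
        then obtain C where C: "0 \<le> C" "\<And>w s t. w \<in> A - E \<Longrightarrow> s \<in> {0..T} \<Longrightarrow> t \<in> {0..T} \<Longrightarrow> s \<noteq> t \<Longrightarrow>
            \<bar>X s t w\<bar> \<le> C * \<bar>t - s\<bar> powr \<theta>" by blast
        define K where "K = (\<Sum>w\<in>A - E. C * \<bar>l (basis_series w)\<bar>)"
        have bound: "\<bar>f s t\<bar> \<le> K * \<bar>t - s\<bar> powr \<theta>" if "s \<in> {0..T}" "t \<in> {0..T}" "s \<noteq> t" for s t
        proof -
          have "\<bar>f s t\<bar> \<le> (\<Sum>w\<in>A - E. \<bar>X s t w * l (basis_series w)\<bar>)"
            unfolding f_eq by (rule sum_abs)
          also have "\<dots> \<le> (\<Sum>w\<in>A - E. C * \<bar>t - s\<bar> powr \<theta> * \<bar>l (basis_series w)\<bar>)"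
            unfolding abs_mult by (intro sum_mono mult_right_mono C that) auto
          also have "\<dots> = K * \<bar>t - s\<bar> powr \<theta>"
            unfolding K_def sum_distrib_right by (rule sum.cong) (simp_all add: mult_ac)
          finally show ?thesis .
        qed
        have additive: "f s t = f s u + f u t"
          if "s \<in> {0..T}" "u \<in> {0..T}" "t \<in> {0..T}" for s u t
        proof -
          \<comment> \<open>The mixed terms of Chen's relation in degree k. They are products of
            lower components, hence generated by the induction hypothesis, and \<open>l\<close>
            vanishes on them.\<close>
          define r where "r w = (\<Sum>j\<in>{1..<k}. mult (graded_part j (X s u)) (graded_part (k - j) (X u t)) w)" for w
          have r_gen: "generated E k r"
            unfolding r_def
          proof (rule generated_sum)
            fix j assume j: "j \<in> {1..<k}"
            have "generated E (j + (k - j)) (mult (graded_part j (X s u)) (graded_part (k - j) (X u t)))"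
              by (rule generated_mult[OF assoc]) (use j that in \<open>auto intro!: less.IH\<close>)
            then show "generated E k (mult (graded_part j (X s u)) (graded_part (k - j) (X u t)))"
              using j by simp
          qed
          have "graded_part k (X s t) w = (graded_part k (X s u) w + graded_part k (X u t) w) + r w" for w
          proof (cases "len w = k")
            case True
            have "w \<noteq> one" using True False len_eq_0_iff[of w] by auto
            then have "X s t w = X u t w + X s u w + mult (reduced (X s u)) (reduced (X u t)) w"
              using regular_path_one[OF X that(1,2)] regular_path_one[OF X that(2,3)]
              by (subst regular_path_chen[OF X that(1,3,2)], subst mult_split) simp
            also have "mult (reduced (X s u)) (reduced (X u t)) w = r w"
            proof -
              have "reduced (X s u) a * reduced (X u t) b =
                  (\<Sum>j\<in>{1..<k}. graded_part j (X s u) a * graded_part (k - j) (X u t) b)"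
                if ab: "(a, b) \<in> keys (cut w)" for a b
              proof -
                have len: "len a + len b = k" using len_cut[OF ab] True by simp
                have "(\<Sum>j\<in>{1..<k}. graded_part j (X s u) a * graded_part (k - j) (X u t) b) =
                    (\<Sum>j\<in>{1..<k}. if j = len a then X s u a * X u t b else 0)"
                  by (rule sum.cong) (use len in \<open>auto simp: graded_part_def\<close>)
                also have "\<dots> = reduced (X s u) a * reduced (X u t) b"
                  using len len_eq_0_iff[of a] len_eq_0_iff[of b] by (auto simp: reduced_def)
                finally show ?thesis by simp
              qed
              then have "mult (reduced (X s u)) (reduced (X u t)) w =
                  pairing (\<lambda>k'. \<Sum>j\<in>{1..<k}. (case k' of (a, b) \<Rightarrow>
                    graded_part j (X s u) a * graded_part (k - j) (X u t) b)) (cut w)"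
                unfolding mult_eq by (intro pairing_cong) auto
              then show ?thesis unfolding r_def mult_eq pairing_left_sum .
            qed
            finally show ?thesis using True by (simp add: graded_part_def)
          next
            case False
            then show ?thesis using generated_support[OF r_gen] by (simp add: graded_part_def)
          qed
          then have "graded_part k (X s t) =
              (\<lambda>w. (graded_part k (X s u) w + graded_part k (X u t) w) + r w)" by blast
          then show ?thesis using l_gen[of r] r_gen by (simp add: f_def l_add)
        qed
        have "f s t = 0"
        proof (cases "s = t")
          case True
          then show ?thesis using additive[OF less.prems(1) less.prems(1) less.prems(1)] by simp
        next
          case False
          have "\<bar>f s t\<bar> \<le> 0 / (1 - 2 powr (1 - \<theta>)) * \<bar>t - s\<bar> powr \<theta>"
          proof (rule sewing_bound[OF \<theta> \<theta> bound _ less.prems False])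
            fix s t :: real assume st: "s \<in> {0..T}" "t \<in> {0..T}"
            then have "(s + t) / 2 \<in> {0..T}" by auto
            then show "\<bar>f s t - f s ((s + t) / 2) - f ((s + t) / 2) t\<bar> \<le> 0 * \<bar>t - s\<bar> powr \<theta>"
              using additive[of s "(s + t) / 2" t] st by simp
          qed
          then show ?thesis by simp
        qed
        then show False using l_nz by (simp add: f_def)
      qed
    qed
  qed
qed

end

section \<open>Translated rough paths\<close>

lemma hoelder_sup_zero:
  assumes "\<And>u r. u \<in> I \<Longrightarrow> r \<in> I \<Longrightarrow> X u r w = 0"
  shows "hoelder_sup \<gamma> I X w = 0"
  using assms hoelder_sup_le_iff[of 0 \<gamma> I X w] by simp

lemma hoelder_sup_singleton: "hoelder_sup \<gamma> {s} X w = 0"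
  using hoelder_sup_le_iff[of 0 \<gamma> "{s}" X w] by simp

lemma hoelder_sup_mono:
  assumes "I \<subseteq> J"
  shows "hoelder_sup \<gamma> I X w \<le> hoelder_sup \<gamma> J X w"
  unfolding hoelder_sup_def by (rule SUP_subset_mono) (use assms in auto)

text \<open>The common form of the four cases. The polynomial is chosen after a bound
  \<open>R\<close> for the norm over [0,T], because the bounds on the levels above floor(1/\<alpha>)
  are not linear in the norm.\<close>

definition translation_bounded ::
    "(real \<Rightarrow> real \<Rightarrow> (real \<Rightarrow> real \<Rightarrow> 'b \<Rightarrow> real) \<Rightarrow> bool) \<Rightarrow> ('b \<Rightarrow> nat) \<Rightarrow>
     ((real \<Rightarrow> real \<Rightarrow> 'b \<Rightarrow> real) \<Rightarrow> real \<Rightarrow> real \<Rightarrow> ennreal) \<Rightarrow> real \<Rightarrow> real \<Rightarrow> real \<Rightarrow>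
     ('l \<Rightarrow> 'b \<Rightarrow> real) set \<Rightarrow> (('l \<Rightarrow> 'b \<Rightarrow> real) \<Rightarrow> ('b \<Rightarrow> real) \<Rightarrow> 'b \<Rightarrow> real) \<Rightarrow> bool" where
  "translation_bounded rough len N T \<alpha> \<gamma> V M \<longleftrightarrow>
    (\<forall>X v. rough \<alpha> T X \<longrightarrow> N X 0 T < \<infinity> \<longrightarrow> v \<in> V \<longrightarrow> rough \<gamma> T (\<lambda>s t. M v (X s t))) \<and>
    (\<forall>R. \<exists>C. coordinate_polynomial C \<and> (\<forall>X v s t. rough \<alpha> T X \<longrightarrow> N X 0 T \<le> ennreal R \<longrightarrow>
      v \<in> V \<longrightarrow> 0 \<le> s \<longrightarrow> s \<le> t \<longrightarrow> t \<le> T \<longrightarrow>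
      hoelder_norm len \<gamma> (\<lambda>s t. M v (X s t)) s t \<le> ennreal (C v) * N X s t))"

lemma ennreal_finite_bound:
  assumes "x < (\<infinity> :: ennreal)"
  obtains R where "x \<le> ennreal R"
  using assms by (cases x) auto

context graded_coalgebra
begin

text \<open>Chen's relation through the points s and t writes every increment as a product
  containing X s t, so a single vanishing increment makes all of them vanish.\<close>

lemma zero_or_unit:
  assumes chen: "\<And>s u t. s \<in> {0..T} \<Longrightarrow> u \<in> {0..T} \<Longrightarrow> t \<in> {0..T} \<Longrightarrow> X s t = mult (X s u) (X u t)"
    and unit: "\<And>s t. s \<in> {0..T} \<Longrightarrow> t \<in> {0..T} \<Longrightarrow> X s t one = 1 \<or> X s t = (\<lambda>_. 0)"
  shows "(\<forall>s\<in>{0..T}. \<forall>t\<in>{0..T}. X s t one = 1) \<or> (\<forall>s\<in>{0..T}. \<forall>t\<in>{0..T}. X s t = (\<lambda>_. 0))"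
proof (rule disjCI)
  assume "\<not> (\<forall>s\<in>{0..T}. \<forall>t\<in>{0..T}. X s t = (\<lambda>_. 0))"
  then obtain s0 t0 where 0: "s0 \<in> {0..T}" "t0 \<in> {0..T}" "X s0 t0 \<noteq> (\<lambda>_. 0)" by blast
  have "X s t \<noteq> (\<lambda>_. 0)" if "s \<in> {0..T}" "t \<in> {0..T}" for s t
  proof
    assume "X s t = (\<lambda>_. 0)"
    moreover have "X s0 t0 = mult (X s0 s) (mult (X s t) (X t t0))"
      using chen[OF 0(1) that(1) 0(2)] chen[OF that(1,2) 0(2)] by simp
    moreover have "mult (\<lambda>_. 0) (X t t0) = (\<lambda>_. 0)" "mult (X s0 s) (\<lambda>_. 0) = (\<lambda>_. 0)"
      by (rule ext, simp)+
    ultimately show False using 0(3) by simp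
  qed
  then show "\<forall>s\<in>{0..T}. \<forall>t\<in>{0..T}. X s t one = 1" using unit by blast
qed

text \<open>The unit has norm one, so bounds without the factor \<open>\<parallel>X\<parallel>\<close> suffice; but the definition of a
  rough path does not exclude the path that is identically zero.\<close>

lemma translated_path_norm:
  fixes wt :: "'b \<Rightarrow> real" and \<Phi> :: "('l \<Rightarrow> 'b \<Rightarrow> real) \<Rightarrow> 'b \<Rightarrow> ('b \<Rightarrow>\<^sub>0 real)"
  assumes \<alpha>: "0 < \<alpha>"
    and wt_cut: "\<forall>w. \<forall>(a, b)\<in>keys (cut w). wt a + wt b = wt w" and wt_one: "wt one = 0"
    and wt_len: "\<forall>w. \<alpha> * real (len w) \<le> wt w"
    and poly: "\<forall>w. polynomial_combination (\<lambda>v. \<Phi> v w)"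
    and keys_dual: "\<forall>v\<in>V. \<forall>w. \<forall>w'\<in>keys (\<Phi> v w). len w' \<le> len w \<and> \<gamma> * real (len w) \<le> wt w'"
    and P: "\<forall>X. P X \<longrightarrow> regular_path \<alpha> T X \<or> (\<forall>s\<in>{0..T}. \<forall>t\<in>{0..T}. X s t = (\<lambda>_. 0))"
  defines "p \<equiv> nat \<lfloor>1 / \<alpha>\<rfloor>"
  shows "\<exists>C. coordinate_polynomial C \<and> (\<forall>X v. P X \<longrightarrow>
    (SUP w\<in>{w. len w \<le> p}. hoelder_sup (wt w) {0..T} X w) \<le> ennreal R \<longrightarrow> v \<in> V \<longrightarrow>
    (\<forall>w. len w \<le> m \<longrightarrow>
      hoelder_sup (\<gamma> * real (len w)) {0..T} (\<lambda>s t w. pairing (X s t) (\<Phi> v w)) w < \<infinity>) \<and>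
    (\<forall>s t. 0 \<le> s \<longrightarrow> s \<le> t \<longrightarrow> t \<le> T \<longrightarrow>
      (SUP w\<in>{w. len w \<le> m}.
        hoelder_sup (\<gamma> * real (len w)) {s..t} (\<lambda>s t w. pairing (X s t) (\<Phi> v w)) w)
      \<le> ennreal (C v) * (SUP w\<in>{w. len w \<le> p}. hoelder_sup (wt w) {s..t} X w)))"
proof -
  have "1 / \<alpha> < real p + 1" unfolding p_def by linarith
  then have p: "1 < \<alpha> * (real p + 1)" using \<alpha> by (simp add: field_simps)
  \<comment> \<open>\<open>ennreal R\<close> is zero for negative \<open>R\<close>, so
    \<open>R\<close> can be replaced by \<open>max R 0\<close>.\<close>
  have R0: "0 \<le> max R 0" by simp
  have "\<exists>C. coordinate_polynomial C \<and> (\<forall>v. 0 \<le> C v) \<and> (\<forall>X. regular_path \<alpha> T X \<longrightarrow>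
      (\<forall>w. len w \<le> p \<longrightarrow> hoelder_bound T X w (max R 0) (wt w)) \<longrightarrow>
      (\<forall>v\<in>V. \<forall>w. len w \<le> m \<longrightarrow> hoelder_bound T (\<lambda>s t w. pairing (X s t) (\<Phi> v w)) w (C v) (\<gamma> * real (len w))))"
  proof (rule translated_path_bound[OF \<alpha> p R0])
    show "wt a + wt b = wt w" if "(a, b) \<in> keys (cut w)" for a b w using wt_cut that by blast
    show "len w' \<le> len w" "\<gamma> * real (len w) \<le> wt w'" if "v \<in> V" "w' \<in> keys (\<Phi> v w)" for v w w'
      using keys_dual that by blast+
  qed (use wt_len poly in simp_all)
  then obtain C where C: "coordinate_polynomial C" "\<forall>v. 0 \<le> C v" and
    bound: "\<forall>X. regular_path \<alpha> T X \<longrightarrow>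
      (\<forall>w. len w \<le> p \<longrightarrow> hoelder_bound T X w (max R 0) (wt w)) \<longrightarrow>
      (\<forall>v\<in>V. \<forall>w. len w \<le> m \<longrightarrow> hoelder_bound T (\<lambda>s t w. pairing (X s t) (\<Phi> v w)) w (C v) (\<gamma> * real (len w)))"
    by (elim exE conjE) (rule that)
  have C0: "0 \<le> C v" for v using C(2) by simp
  let ?Y = "\<lambda>X v s t w. pairing (X s t) (\<Phi> v w)"
  let ?N = "\<lambda>X s t. SUP w\<in>{w. len w \<le> p}. hoelder_sup (wt w) {s..t} X w"
  show ?thesis
  proof (intro exI[of _ C] conjI C(1) allI impI)
    fix X v w
    assume X: "P X" and R: "?N X 0 T \<le> ennreal R" and v: "v \<in> V"
    have Y: "hoelder_sup (\<gamma> * real (len w)) {0..T} (?Y X v) w \<le> ennreal (C v)" if "len w \<le> m" for w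
      using P[rule_format, OF X]
    proof
      assume reg: "regular_path \<alpha> T X"
      have "\<forall>w. len w \<le> p \<longrightarrow> hoelder_bound T X w (max R 0) (wt w)"
      proof (intro allI impI)
        fix w assume "len w \<le> p"
        then have "hoelder_sup (wt w) {0..T} X w \<le> ?N X 0 T" by (intro SUP_upper) simp
        also have "\<dots> \<le> ennreal (max R 0)" using R by (rule order_trans) (simp add: ennreal_leI)
        finally show "hoelder_bound T X w (max R 0) (wt w)"
          by (subst (asm) hoelder_sup_le_iff) simp_all
      qed
      from bound[rule_format, OF reg this[rule_format] v that] show ?thesis
        by (subst hoelder_sup_le_iff[OF C0]) simp
    next
      assume "\<forall>s\<in>{0..T}. \<forall>t\<in>{0..T}. X s t = (\<lambda>_. 0)"
      then show ?thesis by (subst hoelder_sup_zero) auto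
    qed
    show "hoelder_sup (\<gamma> * real (len w)) {0..T} (?Y X v) w < \<infinity>" if "len w \<le> m"
      using Y[OF that] by (rule le_less_trans) simp
    fix s t :: real
    assume st: "0 \<le> s" "s \<le> t" "t \<le> T"
    have Yst: "hoelder_sup (\<gamma> * real (len w)) {s..t} (?Y X v) w \<le> ennreal (C v)" if "len w \<le> m" for w
      using hoelder_sup_mono[of "{s..t}" "{0..T}"] Y[OF that] st by (meson atLeastatMost_subset_iff order_trans)
    show "(SUP w\<in>{w. len w \<le> m}. hoelder_sup (\<gamma> * real (len w)) {s..t} (?Y X v) w)
        \<le> ennreal (C v) * ?N X s t"
      using P[rule_format, OF X]
    proof
      assume reg: "regular_path \<alpha> T X"
      show ?thesis
      proof (cases "s = t")
        case True
        then show ?thesis by (intro SUP_least) (simp add: hoelder_sup_singleton)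
      next
        case False
        have "1 = ennreal (\<bar>X s t one\<bar> / \<bar>t - s\<bar> powr wt one)"
          using regular_path_one[OF reg, of s t] st False by (simp add: wt_one)
        also have "\<dots> \<le> hoelder_sup (wt one) {s..t} X one"
          unfolding hoelder_sup_def using st False
          by (intro SUP_upper2[of "(s, t)"]) auto
        also have "\<dots> \<le> ?N X s t"
          using len_eq_0_iff[of one] by (intro SUP_upper) simp
        finally have "ennreal (C v) * 1 \<le> ennreal (C v) * ?N X s t"
          by (rule mult_left_mono) simp
        then show ?thesis using Yst by (intro SUP_least) (auto intro: order_trans)
      qed
    next
      assume "\<forall>s\<in>{0..T}. \<forall>t\<in>{0..T}. X s t = (\<lambda>_. 0)"
      then have "hoelder_sup (\<gamma> * real (len w)) {s..t} (?Y X v) w = 0" for w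
        using st by (intro hoelder_sup_zero) auto
      then show ?thesis by (intro SUP_least) simp
    qed
  qed
qed

lemma translation_boundedI:
  fixes wt :: "'b \<Rightarrow> real" and \<Phi> :: "('l \<Rightarrow> 'b \<Rightarrow> real) \<Rightarrow> 'b \<Rightarrow> ('b \<Rightarrow>\<^sub>0 real)"
  assumes \<alpha>: "0 < \<alpha>"
    and wt: "\<forall>w. \<forall>(a, b)\<in>keys (cut w). wt a + wt b = wt w" "wt one = 0"
      "\<forall>w. \<alpha> * real (len w) \<le> wt w"
    and \<Phi>: "\<forall>w. polynomial_combination (\<lambda>v. \<Phi> v w)"
      "\<forall>v\<in>V. \<forall>w. \<forall>w'\<in>keys (\<Phi> v w). len w' \<le> len w \<and> \<gamma> * real (len w) \<le> wt w'"
    and reg: "\<forall>X. rough \<alpha> T X \<longrightarrow>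
      regular_path \<alpha> T X \<or> (\<forall>s\<in>{0..T}. \<forall>t\<in>{0..T}. X s t = (\<lambda>_. 0))"
    and N: "\<forall>X s t. N X s t = (SUP w\<in>{w. len w \<le> nat \<lfloor>1 / \<alpha>\<rfloor>}. hoelder_sup (wt w) {s..t} X w)"
    and M: "\<forall>v\<in>V. M v = (\<lambda>x w. pairing x (\<Phi> v w))"
    and rough: "\<And>X v. rough \<alpha> T X \<Longrightarrow> v \<in> V \<Longrightarrow>
      \<forall>w. hoelder_sup (\<gamma> * real (len w)) {0..T} (\<lambda>s t. M v (X s t)) w < \<infinity> \<Longrightarrow>
      rough \<gamma> T (\<lambda>s t. M v (X s t))"
  shows "translation_bounded rough len N T \<alpha> \<gamma> V M"
proof -
  \<comment> \<open>Used with m = \<open>len w\<close> for finiteness at every level and with m =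
    floor(1/\<gamma>) for the norm.\<close>
  note est = translated_path_norm[where P = "rough \<alpha> T", OF \<alpha> wt \<Phi> reg, folded N[rule_format]]
  show ?thesis
    unfolding translation_bounded_def
  proof (intro conjI allI impI)
    fix X v
    assume X: "rough \<alpha> T X" and fin: "N X 0 T < \<infinity>" and v: "v \<in> V"
    from fin obtain R where R: "N X 0 T \<le> ennreal R" by (rule ennreal_finite_bound)
    show "rough \<gamma> T (\<lambda>s t. M v (X s t))"
    proof (rule rough[OF X v], rule allI)
      fix w
      have "M v = (\<lambda>x w. pairing x (\<Phi> v w))" using M v by blast
      with est[of R "len w"] X R v order_refl[of "len w"]
      show "hoelder_sup (\<gamma> * real (len w)) {0..T} (\<lambda>s t. M v (X s t)) w < \<infinity>"
        by (simp only:) blast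
    qed
  next
    fix R
    from est[of R "nat \<lfloor>1 / \<gamma>\<rfloor>"] obtain C where C: "coordinate_polynomial C" and
      bound: "\<And>X v s t. rough \<alpha> T X \<Longrightarrow> N X 0 T \<le> ennreal R \<Longrightarrow> v \<in> V \<Longrightarrow> 0 \<le> s \<Longrightarrow> s \<le> t \<Longrightarrow> t \<le> T \<Longrightarrow>
          hoelder_norm len \<gamma> (\<lambda>s t w. pairing (X s t) (\<Phi> v w)) s t \<le> ennreal (C v) * N X s t"
      unfolding hoelder_norm_def by blast
    show "\<exists>C. coordinate_polynomial C \<and> (\<forall>X v s t. rough \<alpha> T X \<longrightarrow> N X 0 T \<le> ennreal R \<longrightarrow>
        v \<in> V \<longrightarrow> 0 \<le> s \<longrightarrow> s \<le> t \<longrightarrow> t \<le> T \<longrightarrow>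
        hoelder_norm len \<gamma> (\<lambda>s t. M v (X s t)) s t \<le> ennreal (C v) * N X s t)"
    proof (intro exI[of _ C] conjI C allI impI)
      fix X v s t
      assume *: "rough \<alpha> T X" "N X 0 T \<le> ennreal R" and v: "v \<in> V" and st: "0 \<le> s" "s \<le> t" "t \<le> T"
      have "M v = (\<lambda>x w. pairing x (\<Phi> v w))" using M v by blast
      then show "hoelder_norm len \<gamma> (\<lambda>s t. M v (X s t)) s t \<le> ennreal (C v) * N X s t"
        using bound[OF * v st] by simp
    qed
  qed
qed

end

text \<open>Shuffling with the empty word makes X s t [] idempotent, hence 1 or 0; in the latter
  case every coordinate is zero.\<close>

lemma geometric_rough_path_regular:
  fixes X :: "real \<Rightarrow> real \<Rightarrow> 'l::finite list \<Rightarrow> real"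
  assumes X: "geometric_rough_path \<alpha> T X"
  shows "word.regular_path \<alpha> T X \<or> (\<forall>s\<in>{0..T}. \<forall>t\<in>{0..T}. X s t = (\<lambda>_. 0))"
proof -
  have "X s t [] = 1 \<or> X s t = (\<lambda>_. 0)" if "s \<in> {0..T}" "t \<in> {0..T}" for s t
  proof -
    have "X s t w = X s t w * X s t []" for w
    proof -
      have "pairing (X s t) (shuffle (single w 1) (single [] 1)) =
          pairing (X s t) (single w 1) * pairing (X s t) (single [] 1)"
        using X that unfolding geometric_rough_path_def by blast
      then show ?thesis by (simp add: shuffle_Nil)
    qed
    from this[of "[]"] this show ?thesis by (auto simp: fun_eq_iff)
  qed
  moreover have "X s t = tensor_mult (X s u) (X u t)"
    if "s \<in> {0..T}" "u \<in> {0..T}" "t \<in> {0..T}" for s u t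
    using X that unfolding geometric_rough_path_def by blast
  ultimately show ?thesis
    using word.zero_or_unit[of T X] X unfolding word.regular_path_def geometric_rough_path_def by blast
qed

lemma branched_rough_path_regular:
  fixes X :: "real \<Rightarrow> real \<Rightarrow> 'l::finite forest \<Rightarrow> real"
  assumes X: "branched_rough_path \<alpha> T X"
  shows "forest.regular_path \<alpha> T X \<or> (\<forall>s\<in>{0..T}. \<forall>t\<in>{0..T}. X s t = (\<lambda>_. 0))"
proof -
  have "X s t {#} = 1 \<or> X s t = (\<lambda>_. 0)" if "s \<in> {0..T}" "t \<in> {0..T}" for s t
  proof -
    have "X s t F = X s t F * X s t {#}" for F
    proof -
      have "pairing (X s t) (single F 1 * single {#} 1) =
          pairing (X s t) (single F 1) * pairing (X s t) (single {#} 1)"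
        using X that unfolding branched_rough_path_def by blast
      then show ?thesis by (simp add: mult_single pairing_one)
    qed
    from this[of "{#}"] this show ?thesis by (auto simp: fun_eq_iff)
  qed
  moreover have "X s t = gl_mult (X s u) (X u t)"
    if "s \<in> {0..T}" "u \<in> {0..T}" "t \<in> {0..T}" for s u t
    using X that unfolding branched_rough_path_def by blast
  ultimately show ?thesis
    using forest.zero_or_unit[of T X] X unfolding forest.regular_path_def branched_rough_path_def by blast
qed

lemma geometric_rough_path_translation:
  fixes X :: "real \<Rightarrow> real \<Rightarrow> 'l::finite list \<Rightarrow> real"
  assumes X: "geometric_rough_path \<alpha> T X" and v: "primitive_family v"
    and hoelder: "\<And>w. hoelder_sup (\<gamma> * real (length w)) {0..T} (\<lambda>s t. tensor_translation v (X s t)) w < \<infinity>"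
  shows "geometric_rough_path \<gamma> T (\<lambda>s t. tensor_translation v (X s t))"
proof -
  note cf = primitive_family_constant_free[OF v]
  have "pairing (word_translation v (X s t)) (shuffle p q) =
      pairing (word_translation v (X s t)) p * pairing (word_translation v (X s t)) q"
    if "s \<in> {0..T}" "t \<in> {0..T}" for s t p q
  proof (rule pairing_word_translation_grouplike[OF v])
    show "pairing (X s t) (shuffle p q) = pairing (X s t) p * pairing (X s t) q" for p q
      using X that unfolding geometric_rough_path_def by blast
  qed
  moreover have "word_translation v (X s t) =
      tensor_mult (word_translation v (X s u)) (word_translation v (X u t))"
    if "s \<in> {0..T}" "u \<in> {0..T}" "t \<in> {0..T}" for s u t
  proof -
    have "X s t = tensor_mult (X s u) (X u t)"
      using X that unfolding geometric_rough_path_def by blast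
    then show ?thesis by (simp only: word_translation_mult[OF cf])
  qed
  ultimately show ?thesis
    unfolding geometric_rough_path_def tensor_translation_eq[OF cf] using hoelder[unfolded tensor_translation_eq[OF cf]] by blast
qed

lemma branched_rough_path_translation:
  fixes X :: "real \<Rightarrow> real \<Rightarrow> 'l::finite forest \<Rightarrow> real"
  assumes X: "branched_rough_path \<alpha> T X" and v: "tree_family v"
    and hoelder: "\<And>F. hoelder_sup (\<gamma> * real (forest_size F)) {0..T} (\<lambda>s t. branched_translation v (X s t)) F < \<infinity>"
  shows "branched_rough_path \<gamma> T (\<lambda>s t. branched_translation v (X s t))"
proof -
  have "pairing (forest_translation v (X s t)) (p * q) =
      pairing (forest_translation v (X s t)) p * pairing (forest_translation v (X s t)) q"
    if "s \<in> {0..T}" "t \<in> {0..T}" for s t p q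
  proof (rule pairing_forest_translation_grouplike)
    show "pairing (X s t) (p * q) = pairing (X s t) p * pairing (X s t) q" for p q
      using X that unfolding branched_rough_path_def by blast
  qed
  moreover have "forest_translation v (X s t) =
      gl_mult (forest_translation v (X s u)) (forest_translation v (X u t))"
    if "s \<in> {0..T}" "u \<in> {0..T}" "t \<in> {0..T}" for s u t
  proof -
    have "X s t = gl_mult (X s u) (X u t)"
      using X that unfolding branched_rough_path_def by blast
    then show ?thesis by (simp only: forest_translation_gl_mult[OF v])
  qed
  ultimately show ?thesis
    unfolding branched_rough_path_def branched_translation_eq[OF v] using hoelder[unfolded branched_translation_eq[OF v]] by blast
qed

lemma SUP_finite_less_top:
  fixes f :: "'b \<Rightarrow> ennreal"
  assumes "finite A" "\<And>w. w \<in> A \<Longrightarrow> f w < \<infinity>"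
  shows "(SUP w\<in>A. f w) < \<infinity>"
proof -
  have "(SUP w\<in>A. f w) \<le> sum f A"
    using assms(1) by (intro SUP_least member_le_sum) auto
  also have "\<dots> < \<infinity>" using assms by simp
  finally show ?thesis .
qed

text \<open>\<open>wt w\<close> is the order of the coordinate \<open>w\<close> of X. For z in the
  support of \<open>word_dual v w\<close> the chain \<gamma> |w| \<le> \<gamma> * (sum of \<kappa>
  over z) \<le> \<open>wt z\<close> gives the required exponent.\<close>

lemma geometric_translation_bounded:
  fixes wt :: "'l::finite list \<Rightarrow> real" and \<kappa> :: "'l \<Rightarrow> nat"
  assumes \<alpha>: "0 < \<alpha>" and \<gamma>: "0 \<le> \<gamma>"
    and V: "\<And>v. v \<in> V \<Longrightarrow> primitive_family v"
    and \<kappa>: "\<And>v i z. v \<in> V \<Longrightarrow> length z > \<kappa> i \<Longrightarrow> letter_image v i z = 0"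
    and wt: "wt [] = 0" "\<And>a b. wt (a @ b) = wt a + wt b"
      "\<And>w. \<alpha> * real (length w) \<le> wt w" "\<And>w. \<gamma> * real (sum_list (map \<kappa> w)) \<le> wt w"
    and N: "\<And>X s t. N X s t = (SUP w\<in>{w. length w \<le> nat \<lfloor>1 / \<alpha>\<rfloor>}. hoelder_sup (wt w) {s..t} X w)"
  shows "translation_bounded geometric_rough_path length N T \<alpha> \<gamma> V tensor_translation"
proof (rule word.translation_boundedI[where \<Phi> = word_dual and wt = wt])
  show "\<forall>v\<in>V. \<forall>w. \<forall>z\<in>keys (word_dual v w). length z \<le> length w \<and> \<gamma> * real (length w) \<le> wt z"
  proof (intro ballI allI)
    fix v w z assume that: "v \<in> V" "z \<in> keys (word_dual v w)"
    from keys_word_dual[of \<kappa> v z w, OF \<kappa>[OF that(1)] that(2)]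
    have "length z \<le> length w" "length w \<le> sum_list (map \<kappa> z)" by auto
    moreover have "\<gamma> * real (length w) \<le> \<gamma> * real (sum_list (map \<kappa> z))"
      using calculation(2) \<gamma> by (intro mult_left_mono of_nat_mono)
    ultimately show "length z \<le> length w \<and> \<gamma> * real (length w) \<le> wt z"
      using wt(4)[of z] by linarith
  qed
  show "\<forall>w. \<forall>(a, b)\<in>keys (word_cut w). wt a + wt b = wt w"
  proof (intro allI ballI, clarify)
    show "wt a + wt b = wt w" if "(a, b) \<in> keys (word_cut w)" for a b w
      using keys_word_cut[OF that] wt(2) by simp
  qed
  show "\<forall>v\<in>V. tensor_translation v = (\<lambda>x w. pairing x (word_dual v w))"
    using tensor_translation_eq[OF primitive_family_constant_free[OF V]]
    by (simp add: word_translation_def[abs_def])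
  show "geometric_rough_path \<gamma> T (\<lambda>s t. tensor_translation v (X s t))"
    if "geometric_rough_path \<alpha> T X" "v \<in> V"
      "\<forall>w. hoelder_sup (\<gamma> * real (length w)) {0..T} (\<lambda>s t. tensor_translation v (X s t)) w < \<infinity>" for X v
    using that by (intro geometric_rough_path_translation V) simp_all
  show "\<forall>X. geometric_rough_path \<alpha> T X \<longrightarrow>
      word.regular_path \<alpha> T X \<or> (\<forall>s\<in>{0..T}. \<forall>t\<in>{0..T}. X s t = (\<lambda>_. 0))"
    by (intro allI impI geometric_rough_path_regular)
qed (use \<alpha> wt N in \<open>simp_all add: polynomial_combination_word_dual\<close>)

lemma branched_translation_bounded:
  fixes wt :: "'l::finite forest \<Rightarrow> real" and \<kappa> :: "'l \<Rightarrow> nat"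
  assumes \<alpha>: "0 < \<alpha>" and \<gamma>: "0 \<le> \<gamma>"
    and V: "\<And>v. v \<in> V \<Longrightarrow> tree_family v"
    and \<kappa>: "\<And>v i F. v \<in> V \<Longrightarrow> forest_size F > \<kappa> i \<Longrightarrow> bullet_image v i F = 0"
    and wt: "wt {#} = 0"
      "\<And>F G H. forest_labels F + forest_labels G = forest_labels H \<Longrightarrow> wt F + wt G = wt H"
      "\<And>F. \<alpha> * real (forest_size F) \<le> wt F"
      "\<And>F. \<gamma> * real (sum_mset (image_mset \<kappa> (forest_labels F))) \<le> wt F"
    and N: "\<And>X s t. N X s t =
      (SUP F\<in>{F. forest_size F \<le> nat \<lfloor>1 / \<alpha>\<rfloor>}. hoelder_sup (wt F) {s..t} X F)"
  shows "translation_bounded branched_rough_path forest_size N T \<alpha> \<gamma> V branched_translation"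
proof (rule forest.translation_boundedI[where \<Phi> = forest_dual and wt = wt])
  show "\<forall>v\<in>V. \<forall>F. \<forall>z\<in>keys (forest_dual v F).
      forest_size z \<le> forest_size F \<and> \<gamma> * real (forest_size F) \<le> wt z"
  proof (intro ballI allI)
    fix v F z assume that: "v \<in> V" "z \<in> keys (forest_dual v F)"
    from keys_forest_dual[of \<kappa> v z F, OF \<kappa>[OF that(1)] that(2)]
    have "forest_size z \<le> forest_size F" "forest_size F \<le> sum_mset (image_mset \<kappa> (forest_labels z))"
      by auto
    moreover have "\<gamma> * real (forest_size F) \<le> \<gamma> * real (sum_mset (image_mset \<kappa> (forest_labels z)))"
      using calculation(2) \<gamma> by (intro mult_left_mono of_nat_mono)
    ultimately show "forest_size z \<le> forest_size F \<and> \<gamma> * real (forest_size F) \<le> wt z"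
      using wt(4)[of z] by linarith
  qed
  show "\<forall>F. \<forall>(a, b)\<in>keys (forest_coproduct F). wt a + wt b = wt F"
  proof (intro allI ballI, clarify)
    show "wt a + wt b = wt F" if "(a, b) \<in> keys (forest_coproduct F)" for a b F
      using keys_forest_coproduct[OF that] by (rule wt(2))
  qed
  show "\<forall>v\<in>V. branched_translation v = (\<lambda>x F. pairing x (forest_dual v F))"
    using branched_translation_eq[OF V] by (simp add: forest_translation_def[abs_def])
  show "branched_rough_path \<gamma> T (\<lambda>s t. branched_translation v (X s t))"
    if "branched_rough_path \<alpha> T X" "v \<in> V"
      "\<forall>F. hoelder_sup (\<gamma> * real (forest_size F)) {0..T} (\<lambda>s t. branched_translation v (X s t)) F < \<infinity>" for X v
    using that by (intro branched_rough_path_translation V) simp_all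
  show "\<forall>X. branched_rough_path \<alpha> T X \<longrightarrow>
      forest.regular_path \<alpha> T X \<or> (\<forall>s\<in>{0..T}. \<forall>t\<in>{0..T}. X s t = (\<lambda>_. 0))"
    by (intro allI impI branched_rough_path_regular)
qed (use \<alpha> wt N in \<open>simp_all add: polynomial_combination_forest_dual\<close>)

text \<open>The translation and the identity are both morphisms and agree on the nodes with labels
  other than 0. For this comparison \<open>agree_on_forests\<close> is stated relative to a set of
  labels.\<close>

lemma forest_translation_fixes:
  fixes v :: "'l::{finite, zero} \<Rightarrow> 'l forest \<Rightarrow> real"
  assumes v: "tree_family v" and v0: "\<And>i. i \<noteq> 0 \<Longrightarrow> v i = (\<lambda>_. 0)" and F: "0 \<notin># forest_labels F"
  shows "forest_translation v (basis_series F) = basis_series F"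
proof (rule agree_on_forests[where M' = "\<lambda>x. x" and S = "- {0}"])
  show "algebra_morphism gl_mult (basis_series {#}) (forest_translation v)"
    using is_branched_translation_forest_translation[OF v] by (simp add: is_branched_translation_def)
  show "algebra_morphism gl_mult (basis_series {#}) (\<lambda>x. x)"
    by (simp add: algebra_morphism_def series_linear_def)
  show "forest_translation v (pre_lie x y) = pre_lie (forest_translation v x) (forest_translation v y)"
    if "x \<in> tree_series" "y \<in> tree_series" for x y
    by (rule forest_translation_pre_lie[OF v that])
  show "forest_translation v (basis_series {#bullet i#}) = basis_series {#bullet i#}" if "i \<in> - {0}" for i
    using that v0[of i] by (simp add: forest_translation_bullet[OF v] bullet_image_def)
  show "set_mset (forest_labels F) \<subseteq> - {0}" using F by auto
qed simp

lemma forest_size_eq_1_iff: "forest_size F = 1 \<longleftrightarrow> (\<exists>i. F = {#bullet i#})"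
proof
  assume 1: "forest_size F = 1"
  then obtain t G where F: "F = add_mset t G" by (cases F) auto
  obtain i H where t: "t = Node i H" by (cases t)
  have "size (tree_labels t) = Suc (forest_size H)" by (simp add: t forest_size_def)
  then have "forest_size G = 0" "forest_size H = 0" using 1 by (auto simp: F)
  then show "\<exists>i. F = {#bullet i#}" by (auto simp: F t bullet_def)
qed (auto simp: bullet_def)

text \<open>The (1,\<alpha>)-bound makes the coordinates of \<open>X\<close> outside the forests without label \<open>0\<close> of size at
  most \<open>\<lfloor>1/\<alpha>\<rfloor>\<close> and the tree \<open>\<bullet>\<^sub>0\<close> regular of an order above \<open>1\<close>, so \<open>X\<close> takes values in the algebra
  generated by finitely many forests on which \<open>M\<close> and \<open>M\<^sub>v\<close> agree.\<close>

lemma morphism_eq_branched_translation: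
  fixes X :: "real \<Rightarrow> real \<Rightarrow> 'l::{finite, zero} forest \<Rightarrow> real"
  assumes \<alpha>: "0 < \<alpha>" "\<alpha> \<le> 1" and T: "0 < T"
    and X: "branched_rough_path \<alpha> T X"
    and fin: "hoelder_norm_1 forest_zeros forest_size \<alpha> X 0 T < \<infinity>"
    and v0: "v0 \<in> tree_series"
    and M: "algebra_morphism gl_mult (basis_series {#}) M"
    and M_fix: "\<And>F. 0 \<notin># forest_labels F \<Longrightarrow> M (basis_series F) = basis_series F"
    and M_0: "M (basis_series {#bullet 0#}) = (\<lambda>F. basis_series {#bullet 0#} F + v0 F)"
    and st: "s \<in> {0..T}" "t \<in> {0..T}"
  shows "M (X s t) = branched_translation (only_zero_label v0) (X s t)"
proof -
  let ?v = "only_zero_label v0 :: 'l \<Rightarrow> 'l forest \<Rightarrow> real"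
  have v: "tree_family ?v"
    using v0 by (simp add: tree_family_def only_zero_label_def tree_series_def)
  have v_other: "?v i = (\<lambda>_. 0)" if "i \<noteq> 0" for i
    using that by (simp add: only_zero_label_def)
  have M_v: "algebra_morphism gl_mult (basis_series {#}) (forest_translation ?v)"
    using is_branched_translation_forest_translation[OF v] by (simp add: is_branched_translation_def)
  have lin: "series_linear M" "series_linear (forest_translation ?v)"
    using M M_v by (simp_all add: algebra_morphism_def)
  define p where "p = nat \<lfloor>1 / \<alpha>\<rfloor>"
  \<comment> \<open>The empty forest is left out because the images of generators must have no
    constant term. The only generator with a label 0 is the single node, where M is
    prescribed.\<close>
  define E where "E = {F :: 'l forest. F \<noteq> {#} \<and> forest_size F \<le> p \<and> 0 \<notin># forest_labels F} \<union> {{#bullet 0#}}"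
  have "E \<subseteq> insert {#bullet 0#} {F. forest_size F \<le> p}" by (auto simp: E_def)
  then have "finite E" by (rule finite_subset) (simp add: finite_forests)
  have "1 / \<alpha> < real p + 1" unfolding p_def by linarith
  then have p: "1 < \<alpha> * (real p + 1)" using \<alpha>(1) by (simp add: field_simps)
  have "M (X s t) = forest_translation ?v (X s t)"
    using branched_rough_path_regular[OF X]
  proof
    assume "\<forall>s\<in>{0..T}. \<forall>t\<in>{0..T}. X s t = (\<lambda>_. 0)"
    then have "X s t = (\<lambda>_. 0)" using st by blast
    then show ?thesis using series_linear_zero[OF lin(1)] series_linear_zero[OF lin(2)] by simp
  next
    assume reg: "forest.regular_path \<alpha> T X"
    \<comment> \<open>A forest outside \<open>E\<close> with at most p nodes has at least two nodes
      and a label 0, hence order at least (1 - \<alpha>) + 2 \<alpha> = 1 + \<alpha>; one with more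
      than p nodes has order at least \<alpha> (p + 1).\<close>
    define \<theta> where "\<theta> = min (1 + \<alpha>) (\<alpha> * (real p + 1))"
    have \<theta>: "1 < \<theta>" using \<alpha> p by (simp add: \<theta>_def)
    have gen: "forest.generated_series E (X s t)"
    proof (rule forest.path_generated_series[OF gl_mult_assoc reg \<theta> _ st])
      fix F :: "'l forest" assume F: "F \<noteq> {#}" "F \<notin> E"
      have "\<exists>e\<ge>\<theta>. hoelder_sup e {0..T} X F < \<infinity>"
      proof (cases "forest_size F \<le> p")
        case True
        define e where "e = (1 - \<alpha>) * real (forest_zeros F) + \<alpha> * real (forest_size F)"
        have "hoelder_sup e {0..T} X F \<le> hoelder_norm_1 forest_zeros forest_size \<alpha> X 0 T"
          unfolding hoelder_norm_1_def e_def using True p_def by (intro SUP_upper) simp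
        then have "hoelder_sup e {0..T} X F < \<infinity>" using fin by (rule le_less_trans)
        moreover have "\<theta> \<le> e"
        proof -
          have label: "0 \<in># forest_labels F" and "F \<noteq> {#bullet 0#}"
            using F True by (auto simp: E_def)
          then have "forest_size F \<noteq> 1"
            unfolding forest_size_eq_1_iff by (auto simp: bullet_def)
          moreover have "forest_size F \<noteq> 0" using F(1) by simp
          ultimately have "2 \<le> real (forest_size F)" by linarith
          moreover have "1 \<le> real (forest_zeros F)"
            using label by (simp add: forest_zeros_def Suc_le_eq)
          ultimately have "(1 - \<alpha>) * 1 + \<alpha> * 2 \<le> e"
            unfolding e_def using \<alpha> by (intro add_mono mult_left_mono) auto
          then show ?thesis by (simp add: \<theta>_def)
        qed
        ultimately show ?thesis by blast
      next
        case False
        have "hoelder_sup (\<alpha> * real (forest_size F)) {0..T} X F < \<infinity>"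
          using X by (simp add: branched_rough_path_def)
        moreover have "\<theta> \<le> \<alpha> * real (forest_size F)"
        proof -
          have "\<alpha> * (real p + 1) \<le> \<alpha> * real (forest_size F)"
            using False \<alpha>(1) by (intro mult_left_mono) auto
          then show ?thesis by (simp add: \<theta>_def)
        qed
        ultimately show ?thesis by blast
      qed
      then obtain e C where e: "\<theta> \<le> e" and C: "0 \<le> C" "\<And>s t. s \<in> {0..T} \<Longrightarrow> t \<in> {0..T} \<Longrightarrow> s \<noteq> t \<Longrightarrow>
          \<bar>X s t F\<bar> \<le> C * \<bar>t - s\<bar> powr e"
        unfolding hoelder_sup_finite_iff by blast
      show "\<exists>C\<ge>0. \<forall>s\<in>{0..T}. \<forall>t\<in>{0..T}. s \<noteq> t \<longrightarrow> \<bar>X s t F\<bar> \<le> C * \<bar>t - s\<bar> powr \<theta>"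
      proof (intro exI[of _ "C * T powr (e - \<theta>)"] conjI ballI impI)
        fix s t assume st: "s \<in> {0..T}" "t \<in> {0..T}" "s \<noteq> t"
        have "\<bar>X s t F\<bar> \<le> C * \<bar>t - s\<bar> powr e" by (rule C(2)[OF st])
        also have "\<bar>t - s\<bar> powr e = \<bar>t - s\<bar> powr (e - \<theta>) * \<bar>t - s\<bar> powr \<theta>"
          by (simp add: powr_add[symmetric])
        also have "C * \<dots> \<le> C * (T powr (e - \<theta>) * \<bar>t - s\<bar> powr \<theta>)"
          using C(1) e st by (intro mult_left_mono mult_right_mono powr_mono2) auto
        finally show "\<bar>X s t F\<bar> \<le> C * T powr (e - \<theta>) * \<bar>t - s\<bar> powr \<theta>" by (simp add: mult_ac)
      qed (use C(1) in simp)
    qed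
    show ?thesis
    proof (rule forest.agree_on_generated_series[OF \<open>finite E\<close> M M_v _ _ gen])
      fix F assume F: "F \<in> E"
      show "forest_translation ?v (basis_series F) {#} = 0"
        using F by (auto simp: E_def basis_series_def)
      show "M (basis_series F) = forest_translation ?v (basis_series F)"
      proof (cases "0 \<in># forest_labels F")
        case True
        then have "F = {#bullet 0#}" using F by (auto simp: E_def)
        then show ?thesis
          by (simp add: M_0 forest_translation_bullet[OF v] bullet_image_def) (simp add: only_zero_label_def)
      next
        case False
        then show ?thesis using M_fix forest_translation_fixes[OF v v_other] by simp
      qed
    qed
  qed
  then show ?thesis by (simp add: branched_translation_eq[OF v])
qed

section \<open>Weights of the labels and the four cases\<close>

lemma hoelder_norm_finite:
  fixes X :: "real \<Rightarrow> real \<Rightarrow> 'b \<Rightarrow> real"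
  assumes "\<And>n. finite {w. len w \<le> n}" "\<And>w. hoelder_sup (\<alpha> * real (len w)) {0..T} X w < \<infinity>"
  shows "hoelder_norm len \<alpha> X 0 T < \<infinity>"
  unfolding hoelder_norm_def by (intro SUP_finite_less_top assms)

text \<open>The right-hand side equals n + \<alpha> m: a label 0 has weight 1 and stands for up to N
  letters, any other has weight \<alpha> and stands for one.\<close>

lemma weight_le_hoelder_exponent:
  fixes \<alpha> :: real and n m N :: nat
  assumes "0 < \<alpha>" "\<alpha> \<le> 1" "1 \<le> N"
  shows "min \<alpha> (1 / N) * real (n * N + m) \<le> (1 - \<alpha>) * real n + \<alpha> * real (n + m)"
proof -
  have "min \<alpha> (1 / N) * real (n * N) \<le> (1 / N) * real (n * N)"
    by (intro mult_right_mono) auto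
  moreover have "min \<alpha> (1 / N) * real m \<le> \<alpha> * real m"
    by (intro mult_right_mono) auto
  ultimately show ?thesis using assms by (simp add: algebra_simps)
qed

text \<open>The number of zeros is added on both sides to avoid truncated subtraction of natural
  numbers.\<close>

lemma sum_list_letter_weights:
  "sum_list (map (\<lambda>i. if i = 0 then N else 1) w) + word_zeros w = word_zeros w * N + length w"
  by (induction w) (auto simp: word_zeros_def)

lemma sum_mset_label_weights:
  "sum_mset (image_mset (\<lambda>i. if i = 0 then N else 1) L) + count L 0 = count L 0 * N + size L"
  by (induction L) auto

theorem theorem30:
  fixes \<alpha> T :: real and N :: nat
  assumes "0 < \<alpha>" and "\<alpha> \<le> 1" and "1 \<le> N" and "0 < T"
  shows
   "\<comment> \<open>(i), geometric\<close>
    (\<forall>(X :: real \<Rightarrow> real \<Rightarrow> 'l::{finite, zero} list \<Rightarrow> real) v.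
       geometric_rough_path \<alpha> T X \<longrightarrow> (\<forall>i. v i \<in> lie_polynomials N) \<longrightarrow>
       geometric_rough_path (\<alpha> / N) T (\<lambda>s t. tensor_translation v (X s t)))
  \<and> (\<forall>R :: real. \<exists>C. coordinate_polynomial C \<and>
       (\<forall>(X :: real \<Rightarrow> real \<Rightarrow> 'l list \<Rightarrow> real) v s t.
          geometric_rough_path \<alpha> T X \<longrightarrow> hoelder_norm length \<alpha> X 0 T \<le> ennreal R \<longrightarrow>
          (\<forall>i. v i \<in> lie_polynomials N) \<longrightarrow> 0 \<le> s \<longrightarrow> s \<le> t \<longrightarrow> t \<le> T \<longrightarrow>
          hoelder_norm length (\<alpha> / N) (\<lambda>s t. tensor_translation v (X s t)) s t
            \<le> ennreal (C v) * hoelder_norm length \<alpha> X s t))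
    \<comment> \<open>(i), branched\<close>
  \<and> (\<forall>(X :: real \<Rightarrow> real \<Rightarrow> 'l forest \<Rightarrow> real) v.
       branched_rough_path \<alpha> T X \<longrightarrow> (\<forall>i. v i \<in> tree_polynomials N) \<longrightarrow>
       branched_rough_path (\<alpha> / N) T (\<lambda>s t. branched_translation v (X s t)))
  \<and> (\<forall>R :: real. \<exists>C. coordinate_polynomial C \<and>
       (\<forall>(X :: real \<Rightarrow> real \<Rightarrow> 'l forest \<Rightarrow> real) v s t.
          branched_rough_path \<alpha> T X \<longrightarrow> hoelder_norm forest_size \<alpha> X 0 T \<le> ennreal R \<longrightarrow>
          (\<forall>i. v i \<in> tree_polynomials N) \<longrightarrow> 0 \<le> s \<longrightarrow> s \<le> t \<longrightarrow> t \<le> T \<longrightarrow>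
          hoelder_norm forest_size (\<alpha> / N) (\<lambda>s t. branched_translation v (X s t)) s t
            \<le> ennreal (C v) * hoelder_norm forest_size \<alpha> X s t))
    \<comment> \<open>(ii), geometric\<close>
  \<and> (\<forall>(X :: real \<Rightarrow> real \<Rightarrow> 'l list \<Rightarrow> real) v0.
       geometric_rough_path \<alpha> T X \<longrightarrow> hoelder_norm_1 word_zeros length \<alpha> X 0 T < \<infinity> \<longrightarrow>
       v0 \<in> lie_polynomials N \<longrightarrow>
       geometric_rough_path (min \<alpha> (1 / N)) T
         (\<lambda>s t. tensor_translation (only_zero_label v0) (X s t)))
  \<and> (\<forall>R :: real. \<exists>C. coordinate_polynomial C \<and>
       (\<forall>(X :: real \<Rightarrow> real \<Rightarrow> 'l list \<Rightarrow> real) v0 s t.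
          geometric_rough_path \<alpha> T X \<longrightarrow>
          hoelder_norm_1 word_zeros length \<alpha> X 0 T \<le> ennreal R \<longrightarrow>
          v0 \<in> lie_polynomials N \<longrightarrow> 0 \<le> s \<longrightarrow> s \<le> t \<longrightarrow> t \<le> T \<longrightarrow>
          hoelder_norm length (min \<alpha> (1 / N))
              (\<lambda>s t. tensor_translation (only_zero_label v0) (X s t)) s t
            \<le> ennreal (C (only_zero_label v0 :: 'l \<Rightarrow> 'l list \<Rightarrow> real)) *
              hoelder_norm_1 word_zeros length \<alpha> X s t))
    \<comment> \<open>(ii), branched\<close>
  \<and> (\<forall>(X :: real \<Rightarrow> real \<Rightarrow> 'l forest \<Rightarrow> real) v0.
       branched_rough_path \<alpha> T X \<longrightarrow> hoelder_norm_1 forest_zeros forest_size \<alpha> X 0 T < \<infinity> \<longrightarrow>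
       v0 \<in> tree_polynomials N \<longrightarrow>
       branched_rough_path (min \<alpha> (1 / N)) T
         (\<lambda>s t. branched_translation (only_zero_label v0) (X s t)))
  \<and> (\<forall>R :: real. \<exists>C. coordinate_polynomial C \<and>
       (\<forall>(X :: real \<Rightarrow> real \<Rightarrow> 'l forest \<Rightarrow> real) v0 s t.
          branched_rough_path \<alpha> T X \<longrightarrow>
          hoelder_norm_1 forest_zeros forest_size \<alpha> X 0 T \<le> ennreal R \<longrightarrow>
          v0 \<in> tree_polynomials N \<longrightarrow> 0 \<le> s \<longrightarrow> s \<le> t \<longrightarrow> t \<le> T \<longrightarrow>
          hoelder_norm forest_size (min \<alpha> (1 / N))
              (\<lambda>s t. branched_translation (only_zero_label v0) (X s t)) s t
            \<le> ennreal (C (only_zero_label v0 :: 'l \<Rightarrow> 'l forest \<Rightarrow> real)) *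
              hoelder_norm_1 forest_zeros forest_size \<alpha> X s t))
    \<comment> \<open>(ii), branched: other morphisms with the same action on the label 0\<close>
  \<and> (\<forall>(X :: real \<Rightarrow> real \<Rightarrow> 'l forest \<Rightarrow> real) v0 M.
       branched_rough_path \<alpha> T X \<longrightarrow> hoelder_norm_1 forest_zeros forest_size \<alpha> X 0 T < \<infinity> \<longrightarrow>
       v0 \<in> tree_polynomials N \<longrightarrow>
       algebra_morphism gl_mult (basis_series {#}) M \<longrightarrow>
       (\<forall>g\<in>butcher_group. M g \<in> butcher_group) \<longrightarrow>
       (\<forall>F. 0 \<notin># forest_labels F \<longrightarrow> M (basis_series F) = basis_series F) \<longrightarrow>
       M (basis_series {#bullet 0#}) = (\<lambda>F. basis_series {#bullet 0#} F + v0 F) \<longrightarrow>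
       (\<forall>s\<in>{0..T}. \<forall>t\<in>{0..T}.
          M (X s t) = branched_translation (only_zero_label v0) (X s t)))"
proof -
  let ?VG = "{v :: 'l \<Rightarrow> 'l list \<Rightarrow> real. \<forall>i. v i \<in> lie_polynomials N}"
  let ?WG = "only_zero_label ` lie_polynomials N :: ('l \<Rightarrow> 'l list \<Rightarrow> real) set"
  let ?VB = "{v :: 'l \<Rightarrow> 'l forest \<Rightarrow> real. \<forall>i. v i \<in> tree_polynomials N}"
  let ?WB = "only_zero_label ` tree_polynomials N :: ('l \<Rightarrow> 'l forest \<Rightarrow> real) set"
  \<comment> \<open>In a family (v_0, 0, ..., 0) the labels other than 0 are fixed, so they replace
    blocks of length one only.\<close>
  let ?\<kappa> = "\<lambda>i :: 'l. if i = 0 then N else 1"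
  let ?\<gamma> = "min \<alpha> (1 / N)"
  have zero_lie: "(\<lambda>_. 0) \<in> (lie_series :: ('l list \<Rightarrow> real) set)"
    by (auto simp: lie_series_def shuffle_coproduct_def)
  have G1: "translation_bounded geometric_rough_path length (hoelder_norm length \<alpha>) T \<alpha> (\<alpha> / N) ?VG tensor_translation"
  proof (rule geometric_translation_bounded[where \<kappa> = "\<lambda>_. N" and wt = "\<lambda>w. \<alpha> * real (length w)"])
    show "primitive_family v" if "v \<in> ?VG" for v
      using that by (auto simp: primitive_family_def lie_polynomials_def)
    show "letter_image v i z = 0" if "v \<in> ?VG" "N < length z" for v i z
      using that assms(3) by (auto simp: letter_image_def basis_series_def lie_polynomials_def)
    show "\<alpha> / N * real (sum_list (map (\<lambda>_. N) w)) \<le> \<alpha> * real (length w)" for w :: "'l list"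
      using assms by (simp add: sum_list_triv)
  qed (use assms in \<open>auto simp: algebra_simps hoelder_norm_def\<close>)
  have G2: "translation_bounded geometric_rough_path length (hoelder_norm_1 word_zeros length \<alpha>) T \<alpha> (?\<gamma>) ?WG tensor_translation"
  proof (rule geometric_translation_bounded[where \<kappa> = ?\<kappa> and
        wt = "\<lambda>w. (1 - \<alpha>) * real (word_zeros w) + \<alpha> * real (length w)"])
    show "primitive_family v" if "v \<in> ?WG" for v
      using that zero_lie by (auto simp: primitive_family_def lie_polynomials_def only_zero_label_def)
    show "letter_image v i z = 0" if "v \<in> ?WG" "?\<kappa> i < length z" for v i z
      using that assms(3)
      by (auto simp: letter_image_def basis_series_def lie_polynomials_def only_zero_label_def split: if_splits)
    show "?\<gamma> * real (sum_list (map ?\<kappa> w)) \<le> (1 - \<alpha>) * real (word_zeros w) + \<alpha> * real (length w)" for w :: "'l list"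
    proof -
      obtain m where m: "length w = word_zeros w + m"
        unfolding word_zeros_def using count_le_length[of w 0] le_Suc_ex by blast
      then have "sum_list (map ?\<kappa> w) = word_zeros w * N + m"
        using sum_list_letter_weights[of N w] by simp
      then show ?thesis
        unfolding m using weight_le_hoelder_exponent[OF assms(1-3), of "word_zeros w" m] by simp
    qed
    show "\<alpha> * real (length w) \<le> (1 - \<alpha>) * real (word_zeros w) + \<alpha> * real (length w)" for w :: "'l list"
      using assms by simp
  qed (use assms in \<open>auto simp: word_zeros_def algebra_simps hoelder_norm_1_def\<close>)
  have B1: "translation_bounded branched_rough_path forest_size (hoelder_norm forest_size \<alpha>) T \<alpha> (\<alpha> / N) ?VB branched_translation"
  proof (rule branched_translation_bounded[where \<kappa> = "\<lambda>_. N" and wt = "\<lambda>w. \<alpha> * real (forest_size w)"])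
    show "tree_family v" if "v \<in> ?VB" for v
      using that by (auto simp: tree_family_def tree_polynomials_def)
    show "bullet_image v i F = 0" if "v \<in> ?VB" "N < forest_size F" for v i F
      using that assms(3) by (auto simp: bullet_image_def basis_series_def tree_polynomials_def bullet_def)
    show "\<alpha> * real (forest_size F) + \<alpha> * real (forest_size G) = \<alpha> * real (forest_size H)"
      if "forest_labels F + forest_labels G = forest_labels H" for F G H :: "'l forest"
      unfolding forest_size_def that[symmetric] by (simp add: algebra_simps)
    show "\<alpha> / N * real (sum_mset (image_mset (\<lambda>_. N) (forest_labels F))) \<le> \<alpha> * real (forest_size F)"
      for F :: "'l forest"
      using assms by (simp add: forest_size_def)
  qed (use assms in \<open>auto simp: hoelder_norm_def\<close>)
  have B2: "translation_bounded branched_rough_path forest_size (hoelder_norm_1 forest_zeros forest_size \<alpha>) T \<alpha> (?\<gamma>) ?WB branched_translation"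
  proof (rule branched_translation_bounded[where \<kappa> = ?\<kappa> and
        wt = "\<lambda>F. (1 - \<alpha>) * real (forest_zeros F) + \<alpha> * real (forest_size F)"])
    show "tree_family v" if "v \<in> ?WB" for v
      using that by (auto simp: tree_family_def tree_polynomials_def only_zero_label_def tree_series_def)
    show "bullet_image v i F = 0" if "v \<in> ?WB" "?\<kappa> i < forest_size F" for v i F
      using that assms(3)
      by (auto simp: bullet_image_def basis_series_def tree_polynomials_def only_zero_label_def bullet_def
          split: if_splits)
    show "(1 - \<alpha>) * real (forest_zeros F) + \<alpha> * real (forest_size F) +
        ((1 - \<alpha>) * real (forest_zeros G) + \<alpha> * real (forest_size G)) =
        (1 - \<alpha>) * real (forest_zeros H) + \<alpha> * real (forest_size H)"
      if "forest_labels F + forest_labels G = forest_labels H" for F G H :: "'l forest"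
      unfolding forest_size_def forest_zeros_def that[symmetric] by (simp add: algebra_simps)
    show "?\<gamma> * real (sum_mset (image_mset ?\<kappa> (forest_labels F)))
        \<le> (1 - \<alpha>) * real (forest_zeros F) + \<alpha> * real (forest_size F)" for F :: "'l forest"
    proof -
      obtain m where m: "forest_size F = forest_zeros F + m"
        unfolding forest_zeros_def forest_size_def using count_le_size[of "forest_labels F" 0] le_Suc_ex by blast
      then have "sum_mset (image_mset ?\<kappa> (forest_labels F)) = forest_zeros F * N + m"
        using sum_mset_label_weights[of N "forest_labels F"] by (simp add: forest_zeros_def forest_size_def)
      then show ?thesis
        unfolding m using weight_le_hoelder_exponent[OF assms(1-3), of "forest_zeros F" m]
        by (simp del: of_nat_sum_mset)
    qed
    show "\<alpha> * real (forest_size F) \<le> (1 - \<alpha>) * real (forest_zeros F) + \<alpha> * real (forest_size F)"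
      for F :: "'l forest"
      using assms by simp
  qed (use assms in \<open>auto simp: forest_zeros_def hoelder_norm_1_def\<close>)
  \<comment> \<open>In (i) the norm is finite by the definition of a rough path, as a finite maximum
    of finite suprema; in (ii) finiteness is assumed.\<close>
  have norm_G: "hoelder_norm length \<alpha> X 0 T < \<infinity>" if "geometric_rough_path \<alpha> T X"
    for X :: "real \<Rightarrow> real \<Rightarrow> 'l list \<Rightarrow> real"
    by (rule hoelder_norm_finite[OF word.finite_len]) (use that in \<open>simp add: geometric_rough_path_def\<close>)
  have norm_B: "hoelder_norm forest_size \<alpha> X 0 T < \<infinity>" if "branched_rough_path \<alpha> T X"
    for X :: "real \<Rightarrow> real \<Rightarrow> 'l forest \<Rightarrow> real"
    by (rule hoelder_norm_finite[OF forest.finite_len]) (use that in \<open>simp add: branched_rough_path_def\<close>)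
  note bounds = G1[unfolded translation_bounded_def] G2[unfolded translation_bounded_def]
    B1[unfolded translation_bounded_def] B2[unfolded translation_bounded_def]
  show ?thesis
  proof (intro conjI, goal_cases)
    case 1
    show ?case using bounds(1) norm_G by simp
  next
    case 2
    show ?case using bounds(1) by simp
  next
    case 3
    show ?case using bounds(3) norm_B by simp
  next
    case 4
    show ?case using bounds(3) by simp
  next
    case 5
    show ?case using bounds(2) by blast
  next
    case 6
    show ?case
      using conjunct2[OF bounds(2)] by (elim all_forward ex_forward conj_forward) auto
  next
    case 7
    show ?case using bounds(4) by blast
  next
    case 8
    show ?case
      using conjunct2[OF bounds(4)] by (elim all_forward ex_forward conj_forward) auto
  next
    case 9
    show ?case
      by (intro allI impI ballI morphism_eq_branched_translation[OF assms(1,2,4)])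
         (auto simp: tree_polynomials_def)
  qed
qed

end
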